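(* Let $A$, $N$, $R_s$, $A_{|\Omega_s}$, $D_s$ ($s=1,\dots,N$) come from the discretized and decomposed linear elasticity problem described in the context, and let $M_s:=D_s^{-1}A_{|\Omega_s}D_s^{-1}$. Let the Inexact Schwarz preconditioner be defined by the choice $\tilde A_s=L_sL_s^\top$ for every $s\in\{1,\dots,N\}$, where the triangular matrix $L_s$ is the factor in the no-fill incomplete Cholesky factorization of $R_sAR_s^\top$ (assumed to exist), i.e. $$H:=\sum_{s=1}^NR_s^\top(L_sL_s^\top)^{-1}R_s.$$ Let $N^c$ be a coloring constant. Given any two thresholds $\tau>1$ and $\upsilon\in\,]0,N^c[$, let the coarse space be defined - either as $V_0:=\sum_{s=1}^NR_s^\top\left[\mathcal Y_L(\upsilon,L_sL_s^\top,R_sAR_s^\top)+\mathcal Y_L(\tau^{-1},M_s,L_sL_s^\top)\right]$, - or as $V_0:=\sum_{s=1}^NR_s^\top\left[\operatorname{Ker}(M_s)+\mathcal Y_L(\upsilon,L_sL_s^\top,R_sAR_s^\top)+W_s\,\mathcal Y_H(\tau,W_s^\top L_sL_s^\top W_s,W_s^\top M_sW_s)\right]$, where the columns of $W_s$ form an $\ell_2$-orthonormal basis of $\operatorname{range}(M_s)$. Let $R_0\in\mathbb R^{\dim(V_0)\times n}$ be a matrix whose rows form a basis of $V_0$, and let $P_0$, $H_{hyb}$, $H_{ad}$ and $C_\sharp$ be as in the context. Then, with $\lambda(B)$ denoting an arbitrary eigenvalue of $B$, $$1/\tau\le\lambda(HAP_0)\le N^c/\upsilon\quad\text{if }\lambda(HAP_0)\ne0,$$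 $$1/\tau\le\lambda(H_{hyb}A)\le N^c/\upsilon,$$ $$\left((1+2N^c/\upsilon)\tau\right)^{-1}\le\lambda(H_{ad}A)\le N^c/C_\sharp+1.$$
   Context: Problem. $\Omega=[0,2]\times[0,1]$, $\partial\Omega_D$ is the left-hand side boundary of $\Omega$, $\mathcal V=\{v\in H^1(\Omega)^2: v=0\text{ on }\partial\Omega_D\}$. The bilinear form is $a_\omega(u,v)=\int_\omega[2\mu\,\varepsilon(u):\varepsilon(v)+L\operatorname{div}(u)\operatorname{div}(v)]\,dx$, with $\varepsilon_{ij}(u)=\frac12(\partial u_i/\partial x_j+\partial u_j/\partial x_i)$, $\mu=\frac{E}{2(1+\nu)}$, $L=\frac{E\nu}{(1+\nu)(1-2\nu)}$, $\nu=0.4$. $\mathcal V_h\subset\mathcal V$ is the space of continuous piecewise linear ($\mathbb P_1$) Lagrange finite elements on a uniform mesh of $\Omega$ with element size $h=1/42$ satisfying the Dirichlet condition, with (nodal) basis $\{\phi_k\}_{k=1}^n$, and $A\in\mathbb R^{n\times n}$ is the spd matrix $A_{ij}=a_\Omega(\phi_i,\phi_j)$. Decomposition. $\Omega$ is partitioned into $N=8$ non-overlapping, mesh-conforming subdomains $\Omega_s$ (computed by the graph partitioner Metis). Young's modulus $E$ is either $10^5$ in $\Omega_s$ for odd $s$ and $10^8$ for even $s$, or that distribution augmented by $10^9$ where $y\in[1/7,2/7]\cup[3/7,4/7]\cup[5/7,6/7]$. For each $s$, $\{S_s^1,\dots,S_s^{n_s}\}\subset\{1,\dots,n\}$ is the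 set of degrees of freedom (at the mesh nodes) in $\Omega_s$, including those on its interfaces; $R_s\in\mathbb R^{n_s\times n}$ is the Boolean matrix with $(R_s)_{ij}=1$ if $j=S_s^i$ and $0$ otherwise. The local Neumann matrix is $A_{|\Omega_s}\in\mathbb R^{n_s\times n_s}$, $(A_{|\Omega_s})_{ij}:=a_{\Omega_s}(\phi_{S_s^i},\phi_{S_s^j})$, so that $A=\sum_{s=1}^NR_s^\top A_{|\Omega_s}R_s$. The partition of unity $(D_s)_{s}$ is either the multiplicity scaling $D_s:=R_s\left(\sum_{t=1}^NR_t^\top R_t\right)^{-1}R_s^\top$ for all $s$, or the $k$-scaling: $D_s$ diagonal with $(D_s)_{ii}:=(A_{|\Omega_s})_{ii}/(R_sAR_s^\top)_{ii}$ for all $s$; in both cases $\sum_sR_s^\top D_sR_s=I$. No-fill incomplete Cholesky factorization of an spd matrix $B$: a lower triangular matrix $\mathcal L$ with positive diagonal, whose nonzero entries are confined to the sparsity pattern of the lower triangle of $B$, and such that $(\mathcal L\mathcal L^\top)_{ij}=B_{ij}$ at all positions $(i,j)$ of that pattern. Operators: $P_0:=I-R_0^\top(R_0AR_0^\top)^{-1}R_0A$ ($A$-orthogonal projection with kernel $V_0$), $H_{hyb}:=P_0HP_0^\top+R_0^\top(R_0AR_0^\top)^{-1}R_0$, $H_{ad}:=H+R_0^\top(R_0AR_0^\top)^{-1}R_0$. Coloring constant: $N^c\in\mathbb N$ is such that there are subsets $\mathcal C_1,\dots,\mathcal C_{N^c}$ of $\{1,\dots,N\}$ with $\{1,\dots,N\}=\bigcup_{j}\mathcal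 C_j$ and, for each $j$ and all $s,t\in\mathcal C_j$ with $s\ne t$, $R_sAR_t^\top=0$. Spaces $\mathcal Y_L,\mathcal Y_H$: for $M_A\in\mathbb R^{m\times m}$ symmetric positive semi-definite, $M_B\in\mathbb R^{m\times m}$ symmetric positive definite (spd) and a scalar $\tau>0$, $\mathcal Y_L(\tau,M_A,M_B):=\operatorname{span}\{y: M_Ay=\lambda M_By\text{ with }\lambda<\tau\}$ and $\mathcal Y_H(\tau,M_A,M_B):=\operatorname{span}\{y: M_Ay=\lambda M_By\text{ with }\lambda\ge\tau\}$. Constant $C_\sharp$: $C_\sharp>0$ is such that for every $s=1,\dots,N$ and every $x_s\in\mathbb R^{n_s}$, $x_s^\top R_sAR_s^\top x_s\le C_\sharp^{-1}\,x_s^\top L_sL_s^\top x_s$ (this is the paper's definition of $C_\sharp$ specialized to the non-singular local solvers $\tilde A_s=L_sL_s^\top$). *)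

theory Defs
  imports
    "HOL-Analysis.Analysis"
    "HOL-Library.Set_Algebras"
    "Jordan_Normal_Form.Gauss_Jordan_Elimination"
    "Jordan_Normal_Form.Char_Poly"
    "Jordan_Normal_Form.VS_Connect"
    "Jordan_Normal_Form.Matrix_Kernel"
    "Jordan_Normal_Form.Spectral_Radius"
begin

text \<open>Points of the plane are pairs of reals. Vector components and coordinate directions are
  both indexed by the canonical basis \<^term>\<open>Basis :: (real \<times> real) set\<close>, that is, by
  \<^term>\<open>(1, 0) :: real \<times> real\<close> and \<^term>\<open>(0, 1) :: real \<times> real\<close>.\<close>

type_synonym pt = "real \<times> real"

definition Omega :: "pt set" where
  "Omega = {0..2} \<times> {0..1}"

definition dirichlet_boundary :: "pt set" where
  "dirichlet_boundary = {x \<in> Omega. fst x = 0}"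

definition grid_point :: "nat \<Rightarrow> nat \<Rightarrow> pt" where
  "grid_point i j = (real i / 42, real j / 42)"

definition mesh_nodes :: "pt set" where
  "mesh_nodes = {grid_point i j | i j. i \<le> 84 \<and> j \<le> 42}"

text \<open>The uniform mesh: each of the \<open>84 \<times> 42\<close> square cells of side \<open>1/42\<close> is cut
  into two closed triangles along a diagonal. All cells use the same diagonal; the flag \<open>asc\<close>
  selects the ascending or the descending one.\<close>

definition cell_triangles :: "bool \<Rightarrow> nat \<Rightarrow> nat \<Rightarrow> pt set set" where
  "cell_triangles asc i j =
    (if asc then
       {convex hull {grid_point i j, grid_point (i+1) j, grid_point (i+1) (j+1)},
        convex hull {grid_point i j, grid_point i (j+1), grid_point (i+1) (j+1)}}
     else
       {convex hull {grid_point i j, grid_point (i+1) j, grid_point i (j+1)},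
        convex hull {grid_point (i+1) j, grid_point i (j+1), grid_point (i+1) (j+1)}})"

definition mesh :: "bool \<Rightarrow> pt set set" where
  "mesh asc = (\<Union>i<84. \<Union>j<42. cell_triangles asc i j)"

text \<open>A mesh-conforming non-overlapping partition is given by distributing the triangles among
  the eight subdomains; the \<open>s\<close>-th (closed) subdomain is the union of its triangles.\<close>

definition mesh_partition :: "bool \<Rightarrow> (nat \<Rightarrow> pt set set) \<Rightarrow> bool" where
  "mesh_partition asc cells \<longleftrightarrow>
     (\<forall>s\<in>{1..8}. cells s \<noteq> {}) \<and>
     (\<forall>s\<in>{1..8}. \<forall>t\<in>{1..8}. s \<noteq> t \<longrightarrow> cells s \<inter> cells t = {}) \<and>
     (\<Union>s\<in>{1..8}. cells s) = mesh asc"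

definition subdomain :: "(nat \<Rightarrow> pt set set) \<Rightarrow> nat \<Rightarrow> pt set" where
  "subdomain cells s = \<Union>(cells s)"

text \<open>On the interfaces between subdomains, a Lebesgue null set, the value chosen is immaterial.\<close>

definition young_modulus :: "(nat \<Rightarrow> pt set set) \<Rightarrow> bool \<Rightarrow> pt \<Rightarrow> real" where
  "young_modulus cells layered x =
     (if \<exists>s\<in>{1..8}. odd s \<and> x \<in> subdomain cells s then 10^5 else 10^8) +
     (if layered \<and> snd x \<in> {1/7..2/7} \<union> {3/7..4/7} \<union> {5/7..6/7} then 10^9 else 0)"

definition poisson_ratio :: real where
  "poisson_ratio = 4/10"

definition lame_mu :: "real \<Rightarrow> real" where
  "lame_mu E = E / (2 * (1 + poisson_ratio))"

definition lame_L :: "real \<Rightarrow> real" where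
  "lame_L E = E * poisson_ratio / ((1 + poisson_ratio) * (1 - 2 * poisson_ratio))"

text \<open>The forms below are only evaluated at continuous piecewise linear fields. Those are
  differentiable off the edges of the mesh, a null set, so that the pointwise derivative represents
  the weak one. Since \<^term>\<open>lebesgue\<close> is complete, the unspecified values of
  \<^term>\<open>frechet_derivative\<close> on that null set affect neither measurability nor integrals.\<close>

definition partial_deriv :: "(pt \<Rightarrow> pt) \<Rightarrow> pt \<Rightarrow> pt \<Rightarrow> pt \<Rightarrow> real" where
  "partial_deriv u i j x = inner (frechet_derivative u (at x) j) i"

definition strain :: "(pt \<Rightarrow> pt) \<Rightarrow> pt \<Rightarrow> pt \<Rightarrow> pt \<Rightarrow> real" where
  "strain u i j x = (partial_deriv u i j x + partial_deriv u j i x) / 2"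

definition divergence :: "(pt \<Rightarrow> pt) \<Rightarrow> pt \<Rightarrow> real" where
  "divergence u x = (\<Sum>i\<in>Basis. partial_deriv u i i x)"

definition elasticity_form ::
  "(pt \<Rightarrow> real) \<Rightarrow> pt set \<Rightarrow> (pt \<Rightarrow> pt) \<Rightarrow> (pt \<Rightarrow> pt) \<Rightarrow> real" where
  "elasticity_form E \<omega> u v =
     (LINT x:\<omega>|lebesgue.
        2 * lame_mu (E x) * (\<Sum>i\<in>Basis. \<Sum>j\<in>Basis. strain u i j x * strain v i j x) +
        lame_L (E x) * divergence u x * divergence v x)"

definition P1_space :: "bool \<Rightarrow> (pt \<Rightarrow> pt) set" where
  "P1_space asc =
     {v. continuous_on Omega v \<and>
         (\<forall>T\<in>mesh asc. \<exists>f c. linear f \<and> (\<forall>x\<in>T. v x = f x + c)) \<and>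
         (\<forall>x\<in>dirichlet_boundary. v x = 0)}"

text \<open>A degree of freedom is a node off the Dirichlet boundary together with a component. Lists
  without repetitions are used for arbitrary numberings, counted from 0.\<close>

definition dof_numbering :: "(pt \<times> pt) list \<Rightarrow> bool" where
  "dof_numbering dofs \<longleftrightarrow>
     distinct dofs \<and> set dofs = (mesh_nodes - dirichlet_boundary) \<times> Basis"

definition nodal_basis :: "bool \<Rightarrow> (pt \<times> pt) list \<Rightarrow> (nat \<Rightarrow> pt \<Rightarrow> pt) \<Rightarrow> bool" where
  "nodal_basis asc dofs \<phi> \<longleftrightarrow>
     (\<forall>k<length dofs. \<phi> k \<in> P1_space asc \<and>
        (\<forall>l<length dofs. inner (\<phi> k (fst (dofs ! l))) (snd (dofs ! l)) = (if l = k then 1 else 0)))"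

definition local_dof_numbering ::
  "(pt \<times> pt) list \<Rightarrow> (nat \<Rightarrow> pt set set) \<Rightarrow> (nat \<Rightarrow> nat list) \<Rightarrow> bool" where
  "local_dof_numbering dofs cells S \<longleftrightarrow>
     (\<forall>s\<in>{1..8}. distinct (S s) \<and>
        set (S s) = {k. k < length dofs \<and> fst (dofs ! k) \<in> subdomain cells s})"

definition stiffness_matrix :: "(pt \<Rightarrow> real) \<Rightarrow> nat \<Rightarrow> (nat \<Rightarrow> pt \<Rightarrow> pt) \<Rightarrow> real mat" where
  "stiffness_matrix E n \<phi> = mat n n (\<lambda>(i, j). elasticity_form E Omega (\<phi> i) (\<phi> j))"

definition restriction_matrix :: "nat \<Rightarrow> nat list \<Rightarrow> real mat" where
  "restriction_matrix n S = mat (length S) n (\<lambda>(i, j). if j = S ! i then 1 else 0)"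

definition neumann_matrix ::
  "(pt \<Rightarrow> real) \<Rightarrow> pt set \<Rightarrow> (nat \<Rightarrow> pt \<Rightarrow> pt) \<Rightarrow> nat list \<Rightarrow> real mat" where
  "neumann_matrix E \<omega> \<phi> S =
     mat (length S) (length S) (\<lambda>(i, j). elasticity_form E \<omega> (\<phi> (S ! i)) (\<phi> (S ! j)))"

text \<open>Only meaningful for invertible matrices.\<close>

definition mat_inv :: "real mat \<Rightarrow> real mat" where
  "mat_inv B = the (mat_inverse B)"

definition mat_family_sum :: "nat \<Rightarrow> nat \<Rightarrow> (nat \<Rightarrow> real mat) \<Rightarrow> nat set \<Rightarrow> real mat" where
  "mat_family_sum nr nc F I = mat nr nc (\<lambda>(i, j). \<Sum>s\<in>I. F s $$ (i, j))"

definition vec_span :: "nat \<Rightarrow> real vec set \<Rightarrow> real vec set" where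
  "vec_span m X = LinearCombinations.module.span class_ring (module_vec TYPE(real) m) X"

definition vec_lin_indpt :: "nat \<Rightarrow> real vec set \<Rightarrow> bool" where
  "vec_lin_indpt m X \<longleftrightarrow>
     \<not> LinearCombinations.module.lin_dep class_ring (module_vec TYPE(real) m) X"

definition mat_range :: "real mat \<Rightarrow> real vec set" where
  "mat_range B = {B *\<^sub>v x | x. x \<in> carrier_vec (dim_col B)}"

definition sum_of_subspaces :: "nat \<Rightarrow> (nat \<Rightarrow> real vec set) \<Rightarrow> nat set \<Rightarrow> real vec set" where
  "sum_of_subspaces m X I = {finsum_vec TYPE(real) m y I | y. \<forall>s\<in>I. y s \<in> X s}"

definition rows_form_basis :: "real mat \<Rightarrow> nat \<Rightarrow> real vec set \<Rightarrow> bool" where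
  "rows_form_basis B m V \<longleftrightarrow>
     dim_col B = m \<and> distinct (rows B) \<and> vec_lin_indpt m (set (rows B)) \<and>
     vec_span m (set (rows B)) = V"

definition orthonormal_basis_of_range :: "real mat \<Rightarrow> real mat \<Rightarrow> bool" where
  "orthonormal_basis_of_range W B \<longleftrightarrow>
     dim_row W = dim_row B \<and> transpose_mat W * W = 1\<^sub>m (dim_col W) \<and>
     vec_span (dim_row B) (set (cols W)) = mat_range B"

definition generalized_eigenvectors ::
  "real \<Rightarrow> real mat \<Rightarrow> real mat \<Rightarrow> real vec set" where
  "generalized_eigenvectors l MA MB =
     {y \<in> carrier_vec (dim_row MA). MA *\<^sub>v y = l \<cdot>\<^sub>v (MB *\<^sub>v y)}"

definition Y_L :: "real \<Rightarrow> real mat \<Rightarrow> real mat \<Rightarrow> real vec set" where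
  "Y_L \<tau> MA MB = vec_span (dim_row MA) (\<Union>l\<in>{..<\<tau>}. generalized_eigenvectors l MA MB)"

definition Y_H :: "real \<Rightarrow> real mat \<Rightarrow> real mat \<Rightarrow> real vec set" where
  "Y_H \<tau> MA MB = vec_span (dim_row MA) (\<Union>l\<in>{\<tau>..}. generalized_eigenvectors l MA MB)"

definition no_fill_incomplete_cholesky :: "real mat \<Rightarrow> real mat \<Rightarrow> bool" where
  "no_fill_incomplete_cholesky B L \<longleftrightarrow>
     L \<in> carrier_mat (dim_row B) (dim_row B) \<and>
     (\<forall>i<dim_row B. L $$ (i, i) > 0) \<and>
     (\<forall>i<dim_row B. \<forall>j<dim_row B. L $$ (i, j) \<noteq> 0 \<longrightarrow> j \<le> i \<and> B $$ (i, j) \<noteq> 0) \<and>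
     (\<forall>i<dim_row B. \<forall>j\<le>i. B $$ (i, j) \<noteq> 0 \<longrightarrow> (L * transpose_mat L) $$ (i, j) = B $$ (i, j))"

definition multiplicity_scaling :: "nat \<Rightarrow> (nat \<Rightarrow> real mat) \<Rightarrow> nat \<Rightarrow> real mat" where
  "multiplicity_scaling n R s =
     R s * mat_inv (mat_family_sum n n (\<lambda>t. transpose_mat (R t) * R t) {1..8}) * transpose_mat (R s)"

definition k_scaling :: "real mat \<Rightarrow> real mat \<Rightarrow> real mat \<Rightarrow> real mat" where
  "k_scaling A Rs ANs =
     mat (dim_row Rs) (dim_row Rs)
       (\<lambda>(i, j). if i = j then ANs $$ (i, i) / (Rs * A * transpose_mat Rs) $$ (i, i) else 0)"

definition coloring_constant :: "real mat \<Rightarrow> (nat \<Rightarrow> real mat) \<Rightarrow> nat \<Rightarrow> bool" where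
  "coloring_constant A R Nc \<longleftrightarrow>
     (\<exists>C. (\<Union>j\<in>{1..Nc}. C j) = {1..8} \<and>
        (\<forall>j\<in>{1..Nc}. \<forall>s\<in>C j. \<forall>t\<in>C j. s \<noteq> t \<longrightarrow>
           R s * A * transpose_mat (R t) = 0\<^sub>m (dim_row (R s)) (dim_row (R t))))"

definition coarse_space_1 ::
  "nat \<Rightarrow> real mat \<Rightarrow> (nat \<Rightarrow> real mat) \<Rightarrow> (nat \<Rightarrow> real mat) \<Rightarrow> (nat \<Rightarrow> real mat) \<Rightarrow>
   real \<Rightarrow> real \<Rightarrow> real vec set" where
  "coarse_space_1 n A R L M \<tau> \<upsilon> =
     sum_of_subspaces n
       (\<lambda>s. (\<lambda>x. transpose_mat (R s) *\<^sub>v x) `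
          (Y_L \<upsilon> (L s * transpose_mat (L s)) (R s * A * transpose_mat (R s)) +
           Y_L (inverse \<tau>) (M s) (L s * transpose_mat (L s))))
       {1..8}"

definition coarse_space_2 ::
  "nat \<Rightarrow> real mat \<Rightarrow> (nat \<Rightarrow> real mat) \<Rightarrow> (nat \<Rightarrow> real mat) \<Rightarrow> (nat \<Rightarrow> real mat) \<Rightarrow>
   (nat \<Rightarrow> real mat) \<Rightarrow> real \<Rightarrow> real \<Rightarrow> real vec set" where
  "coarse_space_2 n A R L M W \<tau> \<upsilon> =
     sum_of_subspaces n
       (\<lambda>s. (\<lambda>x. transpose_mat (R s) *\<^sub>v x) `
          (mat_kernel (M s) +
           Y_L \<upsilon> (L s * transpose_mat (L s)) (R s * A * transpose_mat (R s)) +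
           (\<lambda>y. W s *\<^sub>v y) `
             Y_H \<tau> (transpose_mat (W s) * (L s * transpose_mat (L s)) * W s)
                   (transpose_mat (W s) * M s * W s)))
       {1..8}"

definition one_level_schwarz ::
  "nat \<Rightarrow> (nat \<Rightarrow> real mat) \<Rightarrow> (nat \<Rightarrow> real mat) \<Rightarrow> real mat" where
  "one_level_schwarz n R L =
     mat_family_sum n n
       (\<lambda>s. transpose_mat (R s) * mat_inv (L s * transpose_mat (L s)) * R s) {1..8}"

definition coarse_correction :: "real mat \<Rightarrow> real mat \<Rightarrow> real mat" where
  "coarse_correction A R0 = transpose_mat R0 * mat_inv (R0 * A * transpose_mat R0) * R0"

definition coarse_projection :: "real mat \<Rightarrow> real mat \<Rightarrow> real mat" where
  "coarse_projection A R0 = 1\<^sub>m (dim_row A) - coarse_correction A R0 * A"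

definition hybrid_preconditioner :: "real mat \<Rightarrow> real mat \<Rightarrow> real mat \<Rightarrow> real mat" where
  "hybrid_preconditioner A H R0 =
     coarse_projection A R0 * H * transpose_mat (coarse_projection A R0) + coarse_correction A R0"

definition additive_preconditioner :: "real mat \<Rightarrow> real mat \<Rightarrow> real mat \<Rightarrow> real mat" where
  "additive_preconditioner A H R0 = H + coarse_correction A R0"

text \<open>Eigenvalues are taken in the complex plane, as the matrices concerned need not be
  symmetric; a bound on an eigenvalue includes the claim that it is real.\<close>

definition spectrum_of :: "real mat \<Rightarrow> complex set" where
  "spectrum_of B = spectrum (map_mat complex_of_real B)"

definition real_between :: "real \<Rightarrow> complex \<Rightarrow> real \<Rightarrow> bool" where
  "real_between a k b \<longleftrightarrow> k \<in> \<real> \<and> a \<le> Re k \<and> Re k \<le> b"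

end

theory Submission
  imports Defs
begin

text \<open>Inner products with \<open>A\<close> turn the three preconditioned operators into self-adjoint ones, so the
  claim reduces to Rayleigh quotients of real eigenvectors. Put \<open>u s = (L s L s^T)^-1 R s A w\<close>; then
  \<open>(A w)^T H (A w)\<close> is the sum of the local energies of the \<open>u s\<close>. If \<open>w\<close> is \<open>A\<close>-orthogonal to \<open>V0\<close>,
  then \<open>u s\<close> is orthogonal to the low modes in \<open>Y_L \<upsilon>\<close>, and the coloring gives the upper bound. For
  the lower bound, \<open>D s R s w\<close> is split along the local eigenproblems; the parts that are expensive in
  the local energy are absorbed by \<open>V0\<close>, and the rest costs at most \<open>\<tau>\<close> times the Neumann energy,
  which sums up to \<open>w^T A w\<close>. On a triangle, a finite element function has constant strain, so the
  stiffness and Neumann matrices are sums of Gram matrices over the triangles; positive definiteness of \<open>A\<close>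
  follows because a rigid motion vanishing at two nodes is zero, column of nodes by column of nodes
  starting at the Dirichlet boundary.\<close>

text \<open>The extension map from the product of the local spaces has \<open>local_solution\<close>
  as its adjoint, between the \<open>A\<close>-form and the sum of the forms
  \<open>B s = L s L s^T\<close>. So \<open>H A\<close> is the extension composed with its adjoint:
  an upper eigenvalue bound says that extensions are not too expensive in \<open>A\<close>, and by
  duality a lower bound says that every vector has a cheap preimage, up to a coarse vector. Each of
  the two local eigenproblems repairs one of these. On the \<open>A\<close>-orthogonal complement of
  \<open>V0\<close>, the threshold \<open>\<upsilon>\<close> does what \<open>C_sharp\<close> does
  on the whole space. The additive operator is the delicate case, since it acts on vectors with a
  coarse component. Its upper bound therefore keeps \<open>C_sharp\<close>, and its lower bound
  needs one splitting whose pieces obey the \<open>\<tau>\<close> bound and the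
  \<open>\<upsilon>\<close> bound together. This is why each local vector is split twice, the second
  time orthogonally in \<open>B s\<close>, so that the \<open>\<tau>\<close> bound survives. The
  operator \<open>H A P\<close> is treated as self-adjoint for the semidefinite form
  \<open>P^T A P\<close>; that its eigenvalues are real rests on its vanishing on the null space of
  that form.\<close>

unbundle no inner_syntax
unbundle no vec_syntax

section \<open>Bilinear forms of matrices\<close>

definition bform :: "real mat \<Rightarrow> real vec \<Rightarrow> real vec \<Rightarrow> real" where
  "bform M x y = x \<bullet> (M *\<^sub>v y)"

definition sym_mat :: "nat \<Rightarrow> real mat \<Rightarrow> bool" where
  "sym_mat m M \<longleftrightarrow> M \<in> carrier_mat m m \<and> M\<^sup>T = M"

definition psd_mat :: "nat \<Rightarrow> real mat \<Rightarrow> bool" where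
  "psd_mat m M \<longleftrightarrow> sym_mat m M \<and> (\<forall>x\<in>carrier_vec m. 0 \<le> bform M x x)"

definition spd_mat :: "nat \<Rightarrow> real mat \<Rightarrow> bool" where
  "spd_mat m M \<longleftrightarrow> sym_mat m M \<and> (\<forall>x\<in>carrier_vec m. x \<noteq> 0\<^sub>v m \<longrightarrow> 0 < bform M x x)"

text \<open>Entrywise, so that length and entries are available for arbitrary summands; agreement
  with \<open>finsum_vec\<close> is established where the coarse spaces refer to it.\<close>

definition vsum :: "nat \<Rightarrow> ('i \<Rightarrow> real vec) \<Rightarrow> 'i set \<Rightarrow> real vec" where
  "vsum m f I = vec m (\<lambda>i. \<Sum>s\<in>I. f s $ i)"

lemma vsum_carrier [simp]: "vsum m f I \<in> carrier_vec m"
  by (simp add: vsum_def)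

lemma dim_vsum [simp]: "dim_vec (vsum m f I) = m"
  by (simp add: vsum_def)

lemma index_vsum [simp]: "i < m \<Longrightarrow> vsum m f I $ i = (\<Sum>s\<in>I. f s $ i)"
  by (simp add: vsum_def)

lemma vsum_cong: "(\<And>s. s \<in> I \<Longrightarrow> f s = g s) \<Longrightarrow> vsum m f I = vsum m g I"
  by (simp add: vsum_def)

lemma vsum_scalar_prod:
  assumes "y \<in> carrier_vec m" "\<And>s. s \<in> I \<Longrightarrow> f s \<in> carrier_vec m"
  shows "vsum m f I \<bullet> y = (\<Sum>s\<in>I. f s \<bullet> y)"
proof -
  have "vsum m f I \<bullet> y = (\<Sum>i<m. \<Sum>s\<in>I. f s $ i * y $ i)"
    using assms(1) by (simp add: scalar_prod_def sum_distrib_right atLeast0LessThan)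
  also have "\<dots> = (\<Sum>s\<in>I. f s \<bullet> y)"
    using assms by (subst sum.swap) (simp add: scalar_prod_def atLeast0LessThan)
  finally show ?thesis .
qed

lemma scalar_prod_vsum:
  assumes "y \<in> carrier_vec m" "\<And>s. s \<in> I \<Longrightarrow> f s \<in> carrier_vec m"
  shows "y \<bullet> vsum m f I = (\<Sum>s\<in>I. y \<bullet> f s)"
proof -
  have "y \<bullet> vsum m f I = (\<Sum>s\<in>I. f s \<bullet> y)"
    by (rule trans[OF comm_scalar_prod[OF assms(1) vsum_carrier] vsum_scalar_prod[OF assms]])
  also have "\<dots> = (\<Sum>s\<in>I. y \<bullet> f s)"
    using assms by (intro sum.cong refl) (metis comm_scalar_prod)
  finally show ?thesis .
qed

lemma mult_mat_vsum:
  assumes "M \<in> carrier_mat k m" "\<And>s. s \<in> I \<Longrightarrow> f s \<in> carrier_vec m"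
  shows "M *\<^sub>v vsum m f I = vsum k (\<lambda>s. M *\<^sub>v f s) I"
proof (rule eq_vecI)
  fix i assume "i < dim_vec (vsum k (\<lambda>s. M *\<^sub>v f s) I)"
  then have i: "i < k" by simp
  then show "(M *\<^sub>v vsum m f I) $ i = vsum k (\<lambda>s. M *\<^sub>v f s) I $ i"
    using assms by (simp add: scalar_prod_vsum)
qed (use assms in auto)

lemma vsum_empty [simp]: "vsum m f {} = 0\<^sub>v m"
  by (auto simp: vsum_def)

lemma vsum_insert:
  "finite I \<Longrightarrow> i \<notin> I \<Longrightarrow> f i \<in> carrier_vec m \<Longrightarrow> vsum m f (insert i I) = f i + vsum m f I"
  by (intro eq_vecI) auto

lemma vsum_union:
  "finite I \<Longrightarrow> finite J \<Longrightarrow> I \<inter> J = {} \<Longrightarrow> vsum m f (I \<union> J) = vsum m f I + vsum m f J"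
  by (intro eq_vecI) (auto simp: sum.union_disjoint)

lemma vsum_add:
  assumes "\<And>s. s \<in> I \<Longrightarrow> f s \<in> carrier_vec m" "\<And>s. s \<in> I \<Longrightarrow> g s \<in> carrier_vec m"
  shows "vsum m (\<lambda>s. f s + g s) I = vsum m f I + vsum m g I"
proof (rule eq_vecI)
  fix i assume "i < dim_vec (vsum m f I + vsum m g I)"
  then have i: "i < m" by simp
  have "(\<Sum>s\<in>I. (f s + g s) $ i) = (\<Sum>s\<in>I. f s $ i + g s $ i)"
    by (intro sum.cong refl index_add_vec(1)) (metis assms(2) carrier_vecD i)
  then show "vsum m (\<lambda>s. f s + g s) I $ i = (vsum m f I + vsum m g I) $ i"
    using i by (simp add: sum.distrib)
qed simp

lemma bform_smult_left:
  "x \<in> carrier_vec m \<Longrightarrow> M \<in> carrier_mat m k \<Longrightarrow> bform M (c \<cdot>\<^sub>v x) y = c * bform M x y"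
  by (simp add: bform_def)

lemma bform_smult_right:
  "y \<in> carrier_vec k \<Longrightarrow> x \<in> carrier_vec m \<Longrightarrow> M \<in> carrier_mat m k \<Longrightarrow>
    bform M x (c \<cdot>\<^sub>v y) = c * bform M x y"
  unfolding bform_def by (simp add: mult_mat_vec)

lemma bform_add_left:
  "x \<in> carrier_vec m \<Longrightarrow> y \<in> carrier_vec m \<Longrightarrow> z \<in> carrier_vec k \<Longrightarrow> M \<in> carrier_mat m k \<Longrightarrow>
    bform M (x + y) z = bform M x z + bform M y z"
  unfolding bform_def by (rule add_scalar_prod_distrib) auto

lemma bform_minus_left:
  "x \<in> carrier_vec m \<Longrightarrow> y \<in> carrier_vec m \<Longrightarrow> z \<in> carrier_vec k \<Longrightarrow> M \<in> carrier_mat m k \<Longrightarrow>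
    bform M (x - y) z = bform M x z - bform M y z"
  unfolding bform_def by (rule minus_scalar_prod_distrib) auto

lemma bform_add_right:
  "x \<in> carrier_vec m \<Longrightarrow> y \<in> carrier_vec k \<Longrightarrow> z \<in> carrier_vec k \<Longrightarrow> M \<in> carrier_mat m k \<Longrightarrow>
    bform M x (y + z) = bform M x y + bform M x z"
  unfolding bform_def
  by (subst mult_add_distrib_mat_vec) (auto intro!: scalar_prod_add_distrib[where n = m])

lemma bform_minus_right:
  "x \<in> carrier_vec m \<Longrightarrow> y \<in> carrier_vec k \<Longrightarrow> z \<in> carrier_vec k \<Longrightarrow> M \<in> carrier_mat m k \<Longrightarrow>
    bform M x (y - z) = bform M x y - bform M x z"
  unfolding bform_def
  by (subst mult_minus_distrib_mat_vec) (auto intro!: scalar_prod_minus_distrib[where n = m])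

lemma bform_zero_left [simp]: "M \<in> carrier_mat m k \<Longrightarrow> y \<in> carrier_vec k \<Longrightarrow> bform M (0\<^sub>v m) y = 0"
  by (simp add: bform_def)

lemma bform_zero_right [simp]: "M \<in> carrier_mat m k \<Longrightarrow> x \<in> carrier_vec m \<Longrightarrow> bform M x (0\<^sub>v k) = 0"
proof -
  assume a: "M \<in> carrier_mat m k" "x \<in> carrier_vec m"
  have "0 \<cdot>\<^sub>v 0\<^sub>v k = (0\<^sub>v k :: real vec)" by (intro eq_vecI) auto
  then show ?thesis using bform_smult_right[of "0\<^sub>v k" k x m M 0] a by simp
qed

lemma bform_vsum_left:
  assumes "M \<in> carrier_mat m k" "y \<in> carrier_vec k" "\<And>s. s \<in> I \<Longrightarrow> f s \<in> carrier_vec m"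
  shows "bform M (vsum m f I) y = (\<Sum>s\<in>I. bform M (f s) y)"
  unfolding bform_def using assms by (intro vsum_scalar_prod) auto

lemma bform_vsum_right:
  assumes "M \<in> carrier_mat m k" "x \<in> carrier_vec m" "\<And>s. s \<in> I \<Longrightarrow> f s \<in> carrier_vec k"
  shows "bform M x (vsum k f I) = (\<Sum>s\<in>I. bform M x (f s))"
  unfolding bform_def using assms
  by (subst mult_mat_vsum[OF assms(1)]) (auto intro!: scalar_prod_vsum)

lemma transpose_move:
  fixes M :: "real mat"
  assumes "M \<in> carrier_mat k m" "x \<in> carrier_vec k" "y \<in> carrier_vec m"
  shows "(M\<^sup>T *\<^sub>v x) \<bullet> y = x \<bullet> (M *\<^sub>v y)"
  using transpose_vec_mult_scalar[OF assms(1,3,2)] assms by simp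

lemma bform_congruence:
  assumes "N \<in> carrier_mat m m" "P \<in> carrier_mat m k" "x \<in> carrier_vec k" "y \<in> carrier_vec k"
  shows "bform (P\<^sup>T * N * P) x y = bform N (P *\<^sub>v x) (P *\<^sub>v y)"
proof -
  have "bform (P\<^sup>T * N * P) x y = x \<bullet> (P\<^sup>T *\<^sub>v (N *\<^sub>v (P *\<^sub>v y)))"
    unfolding bform_def using assms
    by (subst assoc_mult_mat_vec[of _ k m _ k]) (auto intro!: arg_cong2[where f = scalar_prod])
  also have "\<dots> = (P\<^sup>T *\<^sub>v (N *\<^sub>v (P *\<^sub>v y))) \<bullet> x"
    using assms by (intro comm_scalar_prod[where n = k]) auto
  also have "\<dots> = (N *\<^sub>v (P *\<^sub>v y)) \<bullet> (P *\<^sub>v x)"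
    using assms by (intro transpose_move[where k = m and m = k]) auto
  also have "\<dots> = bform N (P *\<^sub>v x) (P *\<^sub>v y)"
    unfolding bform_def using assms by (intro comm_scalar_prod[where n = m]) auto
  finally show ?thesis .
qed

lemma bform_congruence':
  assumes "N \<in> carrier_mat m m" "P \<in> carrier_mat k m" "x \<in> carrier_vec k" "y \<in> carrier_vec k"
  shows "bform (P * N * P\<^sup>T) x y = bform N (P\<^sup>T *\<^sub>v x) (P\<^sup>T *\<^sub>v y)"
  using bform_congruence[of N m "P\<^sup>T" k x y] assms by simp

section \<open>Symmetric, semidefinite and definite matrices\<close>

lemma sym_matD: "sym_mat m M \<Longrightarrow> M \<in> carrier_mat m m"
  by (simp add: sym_mat_def)

lemma psd_matD: "psd_mat m M \<Longrightarrow> sym_mat m M" "psd_mat m M \<Longrightarrow> M \<in> carrier_mat m m"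
  "psd_mat m M \<Longrightarrow> x \<in> carrier_vec m \<Longrightarrow> 0 \<le> bform M x x"
  by (auto simp: psd_mat_def sym_mat_def)

lemma spd_matD: "spd_mat m M \<Longrightarrow> sym_mat m M" "spd_mat m M \<Longrightarrow> M \<in> carrier_mat m m"
  "spd_mat m M \<Longrightarrow> x \<in> carrier_vec m \<Longrightarrow> x \<noteq> 0\<^sub>v m \<Longrightarrow> 0 < bform M x x"
  by (auto simp: spd_mat_def sym_mat_def)

lemma spd_imp_psd: "spd_mat m M \<Longrightarrow> psd_mat m M"
  unfolding psd_mat_def spd_mat_def
  by (metis bform_zero_left less_eq_real_def sym_matD zero_carrier_vec)

lemma bform_sym:
  assumes "sym_mat m M" "x \<in> carrier_vec m" "y \<in> carrier_vec m"
  shows "bform M x y = bform M y x"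
proof -
  have M: "M \<in> carrier_mat m m" "M\<^sup>T = M"
    using assms(1) by (auto simp: sym_mat_def)
  have "bform M x y = (M\<^sup>T *\<^sub>v x) \<bullet> y"
    unfolding bform_def using transpose_move[OF M(1) assms(2,3)] by simp
  also have "\<dots> = bform M y x"
    unfolding bform_def using assms M by (simp add: comm_scalar_prod[where n = m])
  finally show ?thesis .
qed

lemma sym_mat_congruence:
  assumes "sym_mat m N" "P \<in> carrier_mat m k"
  shows "sym_mat k (P\<^sup>T * N * P)"
proof -
  have "(P\<^sup>T * N * P)\<^sup>T = P\<^sup>T * (N * P)"
    using assms unfolding sym_mat_def
    by (subst transpose_mult[of _ k m _ k]) (auto simp: transpose_mult[of _ k m _ m])
  also have "\<dots> = P\<^sup>T * N * P"
    using assms unfolding sym_mat_def by (auto simp: assoc_mult_mat[of _ k m _ m _ k])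
  finally show ?thesis using assms unfolding sym_mat_def by auto
qed

lemma psd_mat_congruence:
  assumes "psd_mat m N" "P \<in> carrier_mat m k"
  shows "psd_mat k (P\<^sup>T * N * P)"
  using assms sym_mat_congruence[OF psd_matD(1)[OF assms(1)] assms(2)]
  unfolding psd_mat_def
  by (auto simp: bform_congruence[OF psd_matD(2)[OF assms(1)] assms(2)])

lemma spd_mat_congruence:
  assumes "spd_mat m N" "P \<in> carrier_mat m k"
    and inj: "\<And>x. x \<in> carrier_vec k \<Longrightarrow> P *\<^sub>v x = 0\<^sub>v m \<Longrightarrow> x = 0\<^sub>v k"
  shows "spd_mat k (P\<^sup>T * N * P)"
  using assms sym_mat_congruence[OF spd_matD(1)[OF assms(1)] assms(2)]
  unfolding spd_mat_def
  by (simp add: bform_congruence[OF spd_matD(2)[OF assms(1)] assms(2)])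
    (metis assms(2) mult_mat_vec_carrier)

text \<open>The quadratic in \<open>t\<close> attains its minimum \<open>a - b^2/c\<close> at
  \<open>t = -b/c\<close>; for \<open>c = 0\<close> it is affine and stays nonnegative only if
  \<open>b = 0\<close>. Stated for numbers, so that it serves single forms and sums of local forms
  alike.\<close>

lemma discriminant_le:
  fixes a b c :: real
  assumes "\<And>t. 0 \<le> a + 2 * t * b + t\<^sup>2 * c" "0 \<le> c"
  shows "b\<^sup>2 \<le> a * c"
proof (cases "c = 0")
  case True
  have "b = 0"
  proof (rule ccontr)
    assume b: "b \<noteq> 0"
    \<comment> \<open>This \<open>t\<close> gives the affine function the value
      \<open>-1\<close>.\<close>
    have "0 \<le> a + 2 * (-(a+1)/(2*b)) * b + (-(a+1)/(2*b))\<^sup>2 * c" by (rule assms(1))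
    then show False using b True by (simp add: field_simps)
  qed
  then show ?thesis using True by simp
next
  case False
  have "0 \<le> a + 2 * (-b/c) * b + (-b/c)\<^sup>2 * c" by (rule assms(1))
  also have "\<dots> = a - b\<^sup>2/c" using False by (simp add: field_simps power2_eq_square)
  finally show ?thesis using False assms(2) by (simp add: field_simps)
qed

lemma bform_quadratic:
  assumes "sym_mat m M" "x \<in> carrier_vec m" "y \<in> carrier_vec m"
  shows "bform M (x + t \<cdot>\<^sub>v y) (x + t \<cdot>\<^sub>v y) = bform M x x + 2 * t * bform M x y + t\<^sup>2 * bform M y y"
proof -
  note M = sym_matD[OF assms(1)]
  show ?thesis
    using assms M bform_sym[OF assms(1,3,2)]
    by (simp add: bform_add_left[where m = m and k = m] bform_add_right[where m = m and k = m]
      bform_smult_left[where m = m and k = m] bform_smult_right[where m = m and k = m]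
      algebra_simps power2_eq_square)
qed

lemma bform_Cauchy_Schwarz:
  assumes "psd_mat m M" "x \<in> carrier_vec m" "y \<in> carrier_vec m"
  shows "(bform M x y)\<^sup>2 \<le> bform M x x * bform M y y"
proof (rule discriminant_le)
  fix t
  have "0 \<le> bform M (x + t \<cdot>\<^sub>v y) (x + t \<cdot>\<^sub>v y)"
    using assms by (intro psd_matD(3)) auto
  then show "0 \<le> bform M x x + 2 * t * bform M x y + t\<^sup>2 * bform M y y"
    using bform_quadratic[OF psd_matD(1)[OF assms(1)] assms(2,3)] by simp
qed (use assms psd_matD in auto)

text \<open>Cauchy-Schwarz for the pair \<open>M x\<close>, \<open>x\<close> has right-hand side
  zero, and its left-hand side is the fourth power of the Euclidean norm of
  \<open>M x\<close>.\<close>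

lemma psd_mat_null:
  assumes "psd_mat m M" "x \<in> carrier_vec m" "bform M x x = 0"
  shows "M *\<^sub>v x = 0\<^sub>v m"
proof -
  have M: "M \<in> carrier_mat m m" using psd_matD(2)[OF assms(1)] .
  have c: "M *\<^sub>v x \<in> carrier_vec m" using M assms by auto
  have "(bform M (M *\<^sub>v x) x)\<^sup>2 \<le> bform M (M *\<^sub>v x) (M *\<^sub>v x) * bform M x x"
    by (rule bform_Cauchy_Schwarz[OF assms(1) c assms(2)])
  then have "(M *\<^sub>v x) \<bullet> (M *\<^sub>v x) = 0" using assms(3) by (simp add: bform_def)
  then have "(\<Sum>i<m. ((M *\<^sub>v x) $ i)\<^sup>2) = 0"
    using c M by (simp add: scalar_prod_def atLeast0LessThan power2_eq_square)
  then have "\<forall>i<m. (M *\<^sub>v x) $ i = 0" by (subst (asm) sum_nonneg_eq_0_iff) auto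
  then show ?thesis using c M by (intro eq_vecI) auto
qed

section \<open>Inverses, in particular of positive definite matrices\<close>

lemma mat_inv_two_sided:
  assumes "B \<in> carrier_mat m m" "det B \<noteq> 0"
  shows "mat_inv B \<in> carrier_mat m m" "B * mat_inv B = 1\<^sub>m m" "mat_inv B * B = 1\<^sub>m m"
proof -
  have "B \<in> Units (ring_mat TYPE(real) m ())"
    using det_non_zero_imp_unit[OF assms] .
  then obtain C where C: "mat_inverse B = Some C"
    using mat_inverse(1)[OF assms(1), of "()"] by blast
  then show "mat_inv B \<in> carrier_mat m m" "B * mat_inv B = 1\<^sub>m m" "mat_inv B * B = 1\<^sub>m m"
    using mat_inverse(2)[OF assms(1) C] by (simp_all add: mat_inv_def)
qed

lemma spd_mat_det:
  assumes "spd_mat m B"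
  shows "det B \<noteq> 0"
proof
  assume "det B = 0"
  then obtain v where v: "v \<in> carrier_vec m" "v \<noteq> 0\<^sub>v m" "B *\<^sub>v v = 0\<^sub>v m"
    using det_0_iff_vec_prod_zero[OF spd_matD(2)[OF assms]] by auto
  then have "bform B v v = 0" by (simp add: bform_def)
  with spd_matD(3)[OF assms v(1,2)] show False by simp
qed

lemmas spd_mat_inv = mat_inv_two_sided[OF spd_matD(2) spd_mat_det]

lemma mat_inv_vec:
  assumes "spd_mat m B" "x \<in> carrier_vec m"
  shows "B *\<^sub>v (mat_inv B *\<^sub>v x) = x" "mat_inv B *\<^sub>v (B *\<^sub>v x) = x"
proof -
  note i = spd_mat_inv[OF assms(1,1)] and B = spd_matD(2)[OF assms(1)]
  show "B *\<^sub>v (mat_inv B *\<^sub>v x) = x"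
    using assoc_mult_mat_vec[OF B i(1) assms(2)] i(2) assms(2) by simp
  show "mat_inv B *\<^sub>v (B *\<^sub>v x) = x"
    using assoc_mult_mat_vec[OF i(1) B assms(2)] i(3) assms(2) by simp
qed

lemma mat_inv_unique:
  assumes "B \<in> carrier_mat m m" "C \<in> carrier_mat m m" "B * C = 1\<^sub>m m"
  shows "mat_inv B = C"
proof -
  have "det B * det C = 1" using det_mult[OF assms(1,2)] assms(3) by simp
  then have "det B \<noteq> 0" by auto
  note i = mat_inv_two_sided[OF assms(1) this]
  have "mat_inv B = mat_inv B * (B * C)" unfolding assms(3) using i by simp
  also have "\<dots> = mat_inv B * B * C" by (rule assoc_mult_mat[symmetric, OF i(1) assms(1,2)])
  also have "\<dots> = C" using assms(2) unfolding i(3) by simp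
  finally show ?thesis .
qed

lemma mat_inv_diagonal:
  assumes "\<And>i. i < m \<Longrightarrow> d i \<noteq> (0::real)"
  shows "mat_inv (mat m m (\<lambda>(i, j). if i = j then d i else 0)) =
    mat m m (\<lambda>(i, j). if i = j then inverse (d i) else 0)"
proof (rule mat_inv_unique[of _ m])
  show "mat m m (\<lambda>(i, j). if i = j then d i else 0) * mat m m (\<lambda>(i, j). if i = j then inverse (d i) else 0) = 1\<^sub>m m"
    (is "?B * ?C = _")
  proof (rule eq_matI)
    fix i j assume "i < dim_row (1\<^sub>m m :: real mat)" "j < dim_col (1\<^sub>m m :: real mat)"
    then have ij: "i < m" "j < m" by simp_all
    have "(?B * ?C) $$ (i, j) = (\<Sum>k<m. (if i = k then d i else 0) * (if k = j then inverse (d k) else 0))"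
      using ij by (simp add: scalar_prod_def atLeast0LessThan)
    also have "\<dots> = (\<Sum>k<m. if k = i then d i * (if i = j then inverse (d i) else 0) else 0)"
      by (intro sum.cong) auto
    also have "\<dots> = 1\<^sub>m m $$ (i, j)" using ij assms by simp
    finally show "(?B * ?C) $$ (i, j) = 1\<^sub>m m $$ (i, j)" .
  qed auto
qed auto

text \<open>A congruence of the identity by \<open>L^T\<close>, which is injective because its
  determinant is the product of the positive diagonal entries. This makes every local solver
  invertible, however poorly the incomplete factor approximates the local matrix.\<close>

lemma spd_mat_lower_triangular:
  assumes L: "L \<in> carrier_mat m m" and diag: "\<And>i. i < m \<Longrightarrow> 0 < L $$ (i, i)"
    and low: "\<And>i j. i < m \<Longrightarrow> j < m \<Longrightarrow> i < j \<Longrightarrow> L $$ (i, j) = 0"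
  shows "spd_mat m (L * L\<^sup>T)"
proof -
  let ?U = "L\<^sup>T"
  have U: "?U \<in> carrier_mat m m" using L by simp
  have id: "spd_mat m (1\<^sub>m m)"
  proof -
    have "0 < bform (1\<^sub>m m) x x" if x: "x \<in> carrier_vec m" "x \<noteq> 0\<^sub>v m" for x
    proof -
      obtain i where i: "i < m" "x $ i \<noteq> 0" using x by (metis carrier_vecD dim_vec eq_vecI index_zero_vec)
      have "0 < (\<Sum>i<m. x $ i * x $ i)"
        by (rule sum_pos2[of _ i]) (use i in \<open>auto simp: zero_less_mult_iff\<close>)
      then show ?thesis using x by (simp add: bform_def scalar_prod_def atLeast0LessThan)
    qed
    then show ?thesis by (simp add: spd_mat_def sym_mat_def)
  qed
  have "upper_triangular ?U" using low L by (auto simp: upper_triangular_def)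
  then have "det ?U = prod_list (diag_mat ?U)" using det_upper_triangular U by blast
  also have "\<dots> \<noteq> 0" using diag L by (auto simp: prod_list_zero_iff diag_mat_def) (metis less_irrefl)
  finally have d: "det ?U \<noteq> 0" .
  have inj: "x = 0\<^sub>v m" if "x \<in> carrier_vec m" "?U *\<^sub>v x = 0\<^sub>v m" for x
    using d det_0_iff_vec_prod_zero[OF U] that by auto
  show ?thesis using spd_mat_congruence[OF id U inj] L by simp
qed

section \<open>Generalized eigenvector decompositions\<close>

definition krylov :: "nat \<Rightarrow> real mat \<Rightarrow> real poly \<Rightarrow> real vec \<Rightarrow> real vec" where
  "krylov m C p x = vsum m (\<lambda>k. coeff p k \<cdot>\<^sub>v ((*\<^sub>v) C ^^ k) x) {..degree p}"

lemma funpow_mult_mat_vec_carrier [simp]: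
  "C \<in> carrier_mat m m \<Longrightarrow> x \<in> carrier_vec m \<Longrightarrow> ((*\<^sub>v) C ^^ k) x \<in> carrier_vec m"
  by (induction k) auto

lemma krylov_carrier [simp]: "krylov m C p x \<in> carrier_vec m"
  by (simp add: krylov_def)

text \<open>Raising the summation bound past the degree adds only zero coefficients; polynomials of
  different degrees can then be summed over one index set.\<close>

lemma krylov_altdef:
  assumes "C \<in> carrier_mat m m" "x \<in> carrier_vec m" "degree p \<le> N"
  shows "krylov m C p x = vsum m (\<lambda>k. coeff p k \<cdot>\<^sub>v ((*\<^sub>v) C ^^ k) x) {..N}"
proof (rule eq_vecI)
  fix i assume "i < dim_vec (vsum m (\<lambda>k. coeff p k \<cdot>\<^sub>v ((*\<^sub>v) C ^^ k) x) {..N})"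
  then have i: "i < m" by simp
  have "(\<Sum>k\<le>degree p. (coeff p k \<cdot>\<^sub>v ((*\<^sub>v) C ^^ k) x) $ i) = (\<Sum>k\<le>N. (coeff p k \<cdot>\<^sub>v ((*\<^sub>v) C ^^ k) x) $ i)"
  proof (rule sum.mono_neutral_left)
    have "((*\<^sub>v) C ^^ k) x \<in> carrier_vec m" for k using assms by simp
    then have "dim_vec (((*\<^sub>v) C ^^ k) x) = m" for k by (metis carrier_vecD)
    then show "\<forall>k\<in>{..N} - {..degree p}. (coeff p k \<cdot>\<^sub>v ((*\<^sub>v) C ^^ k) x) $ i = 0"
      using i by (auto simp: coeff_eq_0)
  qed (use assms(3) in auto)
  then show "krylov m C p x $ i = vsum m (\<lambda>k. coeff p k \<cdot>\<^sub>v ((*\<^sub>v) C ^^ k) x) {..N} $ i"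
    using i by (simp add: krylov_def)
qed (simp add: krylov_def)

lemma krylov_add:
  assumes "C \<in> carrier_mat m m" "x \<in> carrier_vec m"
  shows "krylov m C (p + q) x = krylov m C p x + krylov m C q x"
proof -
  let ?N = "max (degree p) (degree q)"
  have "krylov m C (p + q) x =
      vsum m (\<lambda>k. coeff p k \<cdot>\<^sub>v ((*\<^sub>v) C ^^ k) x + coeff q k \<cdot>\<^sub>v ((*\<^sub>v) C ^^ k) x) {..?N}"
    using assms degree_add_le_max[of p q]
    by (subst krylov_altdef[where N = ?N]) (auto intro!: vsum_cong simp: add_smult_distrib_vec)
  also have "\<dots> = krylov m C p x + krylov m C q x"
    using assms by (subst vsum_add) (auto simp: krylov_altdef[where N = ?N])
  finally show ?thesis .
qed

lemma krylov_smult: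
  assumes "C \<in> carrier_mat m m" "x \<in> carrier_vec m"
  shows "krylov m C (Polynomial.smult a p) x = a \<cdot>\<^sub>v krylov m C p x"
proof (rule eq_vecI)
  fix i assume "i < dim_vec (a \<cdot>\<^sub>v krylov m C p x)"
  then have i: "i < m" by (simp add: krylov_def)
  have "((*\<^sub>v) C ^^ k) x \<in> carrier_vec m" for k using assms by simp
  then have dim: "dim_vec (((*\<^sub>v) C ^^ k) x) = m" for k by (metis carrier_vecD)
  then have e: "(c \<cdot>\<^sub>v ((*\<^sub>v) C ^^ k) x) $ i = c * (((*\<^sub>v) C ^^ k) x) $ i" for c k
    using i by simp
  show "krylov m C (Polynomial.smult a p) x $ i = (a \<cdot>\<^sub>v krylov m C p x) $ i"
    using i assms by (simp add: e krylov_altdef[where N = "degree p"] degree_smult_le sum_distrib_left mult.assoc)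
qed (simp add: krylov_def)

lemma krylov_pCons:
  assumes C: "C \<in> carrier_mat m m" and x: "x \<in> carrier_vec m"
  shows "krylov m C (pCons a p) x = a \<cdot>\<^sub>v x + C *\<^sub>v krylov m C p x"
proof -
  have car: "((*\<^sub>v) C ^^ k) x \<in> carrier_vec m" for k using assms by simp
  then have dim: "dim_vec (((*\<^sub>v) C ^^ k) x) = m" for k by (metis carrier_vecD)
  have "C *\<^sub>v krylov m C p x = vsum m (\<lambda>k. C *\<^sub>v (coeff p k \<cdot>\<^sub>v ((*\<^sub>v) C ^^ k) x)) {..degree p}"
    unfolding krylov_def using C car by (intro mult_mat_vsum) auto
  also have "\<dots> = vsum m (\<lambda>k. coeff p k \<cdot>\<^sub>v ((*\<^sub>v) C ^^ Suc k) x) {..degree p}"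
    using C car by (intro vsum_cong) (simp add: mult_mat_vec)
  finally have 1: "C *\<^sub>v krylov m C p x = vsum m (\<lambda>k. coeff p k \<cdot>\<^sub>v ((*\<^sub>v) C ^^ Suc k) x) {..degree p}" .
  have 2: "krylov m C (pCons a p) x = vsum m (\<lambda>k. coeff (pCons a p) k \<cdot>\<^sub>v ((*\<^sub>v) C ^^ k) x) {..Suc (degree p)}"
    by (rule krylov_altdef[OF C x]) (rule degree_pCons_le)
  have dim2: "dim_vec (C *\<^sub>v (((*\<^sub>v) C ^^ k) x)) = m" for k using C by simp
  show ?thesis
    unfolding 1 2
  proof (rule eq_vecI)
    fix i assume "i < dim_vec (a \<cdot>\<^sub>v x + vsum m (\<lambda>k. coeff p k \<cdot>\<^sub>v ((*\<^sub>v) C ^^ Suc k) x) {..degree p})"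
    then have i: "i < m" by simp
    show "vsum m (\<lambda>k. coeff (pCons a p) k \<cdot>\<^sub>v ((*\<^sub>v) C ^^ k) x) {..Suc (degree p)} $ i =
      (a \<cdot>\<^sub>v x + vsum m (\<lambda>k. coeff p k \<cdot>\<^sub>v ((*\<^sub>v) C ^^ Suc k) x) {..degree p}) $ i"
      unfolding index_vsum[OF i] sum.atMost_Suc_shift using i x C dim
      by (simp del: index_mult_mat_vec add: dim2)
  qed simp
qed

lemma krylov_0: "x \<in> carrier_vec m \<Longrightarrow> krylov m C 0 x = 0\<^sub>v m"
  by (auto simp: krylov_def intro!: eq_vecI)

text \<open>Horner's rule in the form of \<open>krylov_pCons\<close>. It allows the factors of an
  annihilating polynomial to act one after the other.\<close>

lemma krylov_mult:
  assumes C: "C \<in> carrier_mat m m" and x: "x \<in> carrier_vec m"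
  shows "krylov m C (p * q) x = krylov m C p (krylov m C q x)"
proof (induction p)
  case 0
  show ?case using krylov_0[of x m C] krylov_0[of "krylov m C q x" m C] x by simp
next
  case (pCons a p)
  have "krylov m C (pCons a p * q) x = a \<cdot>\<^sub>v krylov m C q x + (0 \<cdot>\<^sub>v x + C *\<^sub>v krylov m C p (krylov m C q x))"
    using pCons C x by (simp add: krylov_add krylov_smult krylov_pCons)
  also have "0 \<cdot>\<^sub>v x + C *\<^sub>v krylov m C p (krylov m C q x) = C *\<^sub>v krylov m C p (krylov m C q x)"
    using C x by (intro eq_vecI) auto
  finally show ?case using C by (simp add: krylov_pCons)
qed

text \<open>The \<open>m + 1\<close> iterates of \<open>x\<close> under \<open>C\<close>, starting
  with \<open>x\<close> itself, live in dimension \<open>m\<close> and are therefore linearly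
  dependent.\<close>

lemma ex_annihilating_poly:
  assumes C: "C \<in> carrier_mat m m" and x: "x \<in> carrier_vec m"
  shows "\<exists>p. p \<noteq> 0 \<and> krylov m C p x = 0\<^sub>v m"
proof -
  \<comment> \<open>The iterates are the columns. A zero row at the bottom makes the matrix square
    and singular, so a kernel vector \<open>v\<close> exists; its entries become the coefficients of
    \<open>p\<close>.\<close>
  define N where "N = mat (Suc m) (Suc m) (\<lambda>(i, j). if i < m then (((*\<^sub>v) C ^^ j) x) $ i else 0)"
  have N: "N \<in> carrier_mat (Suc m) (Suc m)" by (simp add: N_def)
  have Nt: "N\<^sup>T \<in> carrier_mat (Suc m) (Suc m)" using N by simp
  have "N\<^sup>T *\<^sub>v unit_vec (Suc m) m = 0\<^sub>v (Suc m)"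
    by (rule eq_vecI) (auto simp: N_def scalar_prod_def unit_vec_def if_distrib cong: if_cong)
  then have "det (N\<^sup>T) = 0"
    using det_0_iff_vec_prod_zero[OF Nt] by (intro iffD2[OF det_0_iff_vec_prod_zero[OF Nt]] exI[of _ "unit_vec (Suc m) m"]) auto
  then have "det N = 0" using det_transpose[OF N] by simp
  then obtain v where v: "v \<in> carrier_vec (Suc m)" "v \<noteq> 0\<^sub>v (Suc m)" "N *\<^sub>v v = 0\<^sub>v (Suc m)"
    using det_0_iff_vec_prod_zero[OF N] by auto
  define p where "p = (\<Sum>j\<le>m. monom (v $ j) j)"
  have cp: "coeff p j = (if j \<le> m then v $ j else 0)" for j
    by (simp add: p_def coeff_sum)
  have "p \<noteq> 0"
  proof
    assume "p = 0"
    then have "v $ j = 0" if "j < Suc m" for j using cp[of j] that by simp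
    then show False using v by (metis carrier_vecD eq_vecI index_zero_vec)
  qed
  have "degree p \<le> m" by (rule degree_le) (simp add: cp)
  have car: "((*\<^sub>v) C ^^ k) x \<in> carrier_vec m" for k using assms by simp
  then have dim: "dim_vec (((*\<^sub>v) C ^^ k) x) = m" for k by (metis carrier_vecD)
  have "krylov m C p x = 0\<^sub>v m"
  proof (rule eq_vecI)
    fix i assume "i < dim_vec (0\<^sub>v m :: real vec)"
    then have i: "i < m" by simp
    have "krylov m C p x $ i = (\<Sum>j\<le>m. v $ j * (((*\<^sub>v) C ^^ j) x) $ i)"
      using i dim by (simp add: krylov_altdef[OF C x \<open>degree p \<le> m\<close>] cp)
    also have "\<dots> = (N *\<^sub>v v) $ i"
      using i v(1) by (simp add: N_def scalar_prod_def lessThan_Suc_atMost[symmetric] atLeast0LessThan mult.commute)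
    finally show "krylov m C p x $ i = 0\<^sub>v m $ i" using v i by simp
  qed simp
  with \<open>p \<noteq> 0\<close> show ?thesis by blast
qed

text \<open>A complex root \<open>z\<close> exists; it contributes the factor \<open>X - z\<close>
  if it is real, and otherwise \<open>(X - z)(X - cnj z)\<close>, whose coefficients are real. The
  position of the factor decides what acts on a vector first: the linear factor is applied before
  \<open>q\<close>, the quadratic one after it.\<close>

lemma real_poly_factor:
  fixes p :: "real poly"
  assumes "degree p > 0"
  shows "(\<exists>a q. p = q * [:- a, 1:]) \<or> (\<exists>a b q. b \<noteq> 0 \<and> p = [:a\<^sup>2 + b\<^sup>2, - 2 * a, 1:] * q)"
proof -
  define P where "P = map_poly complex_of_real p"
  have "degree P = degree p" by (simp add: P_def)
  then have "\<not> constant (poly P)" using assms by (simp add: constant_degree)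
  then obtain z where z: "poly P z = 0" using fundamental_theorem_of_algebra by blast
  show ?thesis
  proof (cases "Im z = 0")
    case True
    then have "z = of_real (Re z)" by (simp add: complex_eq_iff)
    then have "poly p (Re z) = 0"
      using z unfolding P_def by (metis of_real_eq_0_iff of_real_hom.poly_map_poly)
    then have "[:- Re z, 1:] dvd p" by (simp add: poly_eq_0_iff_dvd)
    then show ?thesis by (metis dvdE mult.commute)
  next
    case False
    let ?Q = "[:(Re z)\<^sup>2 + (Im z)\<^sup>2, - 2 * Re z, 1:]"
    have dQ: "degree ?Q = 2" by simp
    \<comment> \<open>The remainder is \<open>c + d X\<close> with real coefficients and vanishes at
      \<open>z\<close>; since \<open>Im z\<close> is nonzero, both coefficients are zero.\<close>
    define r where "r = p mod ?Q"
    have "?Q \<noteq> 0" by simp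
    then have "degree r < 2" unfolding r_def using degree_mod_less[of ?Q p] dQ by (metis degree_0 zero_less_numeral)
    then obtain c d where r: "r = [:c, d:]"
      by (metis One_nat_def degree_eq_zeroE degree_pCons_eq less_2_cases_iff pCons_cases pCons_eq_0_iff nat.inject)
    have pe: "p = (p div ?Q) * ?Q + r" unfolding r_def by (rule div_mult_mod_eq[symmetric])
    interpret mh: map_poly_comm_ring_hom complex_of_real by unfold_locales
    have "P = map_poly complex_of_real (p div ?Q * ?Q + r)" unfolding P_def using pe by simp
    also have "\<dots> = map_poly complex_of_real (p div ?Q) * map_poly complex_of_real ?Q + map_poly complex_of_real r"
      by (simp only: mh.hom_mult mh.hom_add)
    finally have "P = map_poly complex_of_real (p div ?Q) * map_poly complex_of_real ?Q + map_poly complex_of_real r" .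
    moreover have "poly (map_poly complex_of_real ?Q) z = 0"
      by (simp add: map_poly_pCons complex_eq_iff power2_eq_square algebra_simps)
    ultimately have "poly (map_poly complex_of_real r) z = 0"
      using z by (simp only: poly_add poly_mult) simp
    then have "of_real c + z * of_real d = 0" by (simp add: r of_real_hom.map_poly_pCons_hom)
    then have "r = 0" using False r by (auto simp: complex_eq_iff)
    then have "p = ?Q * (p div ?Q)" using pe by (simp add: mult.commute)
    then show ?thesis using False by blast
  qed
qed

text \<open>Indexing by the eigenvalue itself gives at most one summand per eigenvalue, so that
  different indices yield orthogonal summands later on. A summand may be zero.\<close>

definition eig_sum :: "nat \<Rightarrow> real mat \<Rightarrow> real vec \<Rightarrow> bool" where
  "eig_sum m C x \<longleftrightarrow> (\<exists>\<Lambda> y. finite \<Lambda> \<and> (\<forall>l\<in>\<Lambda>. y l \<in> carrier_vec m \<and> C *\<^sub>v y l = l \<cdot>\<^sub>v y l) \<and> x = vsum m y \<Lambda>)"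

text \<open>Induction on the degree of a polynomial that annihilates \<open>x\<close>. Self-adjointness rules out
  non-real roots, and it makes the kernel of \<open>(C - a)^2\<close> equal to that of \<open>C - a\<close>.\<close>

lemma selfadjoint_imp_eig_sum:
  assumes B: "spd_mat m B" and C: "C \<in> carrier_mat m m"
    and adj: "\<And>u v. u \<in> carrier_vec m \<Longrightarrow> v \<in> carrier_vec m \<Longrightarrow> bform B u (C *\<^sub>v v) = bform B (C *\<^sub>v u) v"
  shows "x \<in> carrier_vec m \<Longrightarrow> eig_sum m C x"
proof -
  note Bc = spd_matD(2)[OF B]
  have null: "u = 0\<^sub>v m" if "u \<in> carrier_vec m" "bform B u u = 0" for u
    using spd_matD(3)[OF B] that by force
  have krylov_null: "eig_sum m C x" if "p \<noteq> 0" "x \<in> carrier_vec m" "krylov m C p x = 0\<^sub>v m" for p x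
    using that
  proof (induction "degree p" arbitrary: p x rule: less_induct)
    case less
    note x = less.prems(2)
    show ?case
    proof (cases "degree p > 0")
      case False
      then obtain c where p: "p = [:c:]" by (metis degree_eq_zeroE gr0I)
      then have c: "c \<noteq> 0" using less.prems by auto
      have "C *\<^sub>v 0\<^sub>v m = 0\<^sub>v m" using C by (intro eq_vecI) auto
      then have "krylov m C p x = c \<cdot>\<^sub>v x" using krylov_0[of x m C] x C by (simp add: p krylov_pCons)
      then have cx: "c \<cdot>\<^sub>v x = 0\<^sub>v m" using less.prems by simp
      have "x = 0\<^sub>v m"
      proof (rule eq_vecI)
        fix i assume "i < dim_vec (0\<^sub>v m :: real vec)"
        then show "x $ i = 0\<^sub>v m $ i" using arg_cong[OF cx, of "\<lambda>v. v $ i"] x c by simp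
      qed (use x in simp)
      then show ?thesis unfolding eig_sum_def by (intro exI[of _ "{}"]) simp
    next
      case True
      from real_poly_factor[OF this] show ?thesis
      proof (elim disjE exE conjE)
        fix a q assume p: "p = q * [:- a, 1:]"
        define y where "y = C *\<^sub>v x - a \<cdot>\<^sub>v x"
        have y: "y \<in> carrier_vec m" using C x by (simp add: y_def)
        have q0: "q \<noteq> 0" using p less.prems by auto
        have C0: "C *\<^sub>v 0\<^sub>v m = 0\<^sub>v m" using C by (intro eq_vecI) auto
        have k1: "krylov m C [:- a, 1:] x = y"
        proof -
          have "krylov m C [:- a, 1:] x = - a \<cdot>\<^sub>v x + C *\<^sub>v (1 \<cdot>\<^sub>v x + 0\<^sub>v m)"
            using krylov_0[of x m C] C x C0 by (simp add: krylov_pCons)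
          also have "\<dots> = y" using C x by (intro eq_vecI) (auto simp: y_def)
          finally show ?thesis .
        qed
        have "krylov m C q y = 0\<^sub>v m"
          using less.prems(3) krylov_mult[OF C x, of q "[:- a, 1:]"] k1 p by simp
        moreover have "degree q < degree p" unfolding p using q0 by (subst degree_mult_eq) auto
        ultimately have "eig_sum m C y" using less.hyps[of q y] q0 y by blast
        then obtain \<Lambda> w where w: "finite \<Lambda>" "\<And>l. l \<in> \<Lambda> \<Longrightarrow> w l \<in> carrier_vec m"
          "\<And>l. l \<in> \<Lambda> \<Longrightarrow> C *\<^sub>v w l = l \<cdot>\<^sub>v w l" "y = vsum m w \<Lambda>"
          unfolding eig_sum_def by blast
        \<comment> \<open>\<open>C - a\<close> multiplies an eigenvector for \<open>l\<close> by
          \<open>l - a\<close>, so \<open>f l\<close> is a preimage of \<open>w l\<close> under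
          \<open>C - a\<close> whenever \<open>l\<close> differs from \<open>a\<close>.\<close>
        define f where "f l = inverse (l - a) \<cdot>\<^sub>v w l" for l
        have f: "f l \<in> carrier_vec m" "C *\<^sub>v f l = l \<cdot>\<^sub>v f l" if "l \<in> \<Lambda>" for l
          using w(2,3)[OF that] C by (auto simp: f_def mult_mat_vec smult_smult_assoc mult.commute)
        \<comment> \<open>Once these preimages are removed, \<open>(C - a) x'\<close> is the
          component of \<open>y\<close> at \<open>a\<close> alone; it remains to show that this
          component is zero.\<close>
        define x' where "x' = x - vsum m f (\<Lambda> - {a})"
        have x': "x' \<in> carrier_vec m" using x by (simp add: x'_def)
        define z where "z = C *\<^sub>v x' - a \<cdot>\<^sub>v x'"
        have z: "z \<in> carrier_vec m" using C x' by (simp add: z_def)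
        have z_eq: "z = vsum m w (\<Lambda> \<inter> {a})"
        proof (rule eq_vecI)
          fix i assume "i < dim_vec (vsum m w (\<Lambda> \<inter> {a}))"
          then have i: "i < m" by simp
          have "C *\<^sub>v vsum m f (\<Lambda> - {a}) = vsum m (\<lambda>l. l \<cdot>\<^sub>v f l) (\<Lambda> - {a})"
            using C f by (subst mult_mat_vsum) (auto intro!: vsum_cong)
          then have Cf: "(C *\<^sub>v vsum m f (\<Lambda> - {a})) $ i = (\<Sum>l\<in>\<Lambda> - {a}. l * f l $ i)"
            using i carrier_vecD[OF f(1)] by (auto intro!: sum.cong)
          have "z $ i = (C *\<^sub>v x) $ i - (C *\<^sub>v vsum m f (\<Lambda> - {a})) $ i - a * (x $ i - (\<Sum>l\<in>\<Lambda> - {a}. f l $ i))"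
            unfolding z_def x'_def using C x i
            by (subst mult_minus_distrib_mat_vec[OF C x vsum_carrier]) simp
          also have "\<dots> = y $ i - (\<Sum>l\<in>\<Lambda> - {a}. (l - a) * f l $ i)"
            unfolding Cf y_def using C x i
            by (simp add: sum_distrib_left sum_subtractf algebra_simps)
          also have "(\<Sum>l\<in>\<Lambda> - {a}. (l - a) * f l $ i) = (\<Sum>l\<in>\<Lambda> - {a}. w l $ i)"
            using i carrier_vecD[OF w(2)] by (intro sum.cong) (auto simp: f_def)
          also have "y $ i = (\<Sum>l\<in>\<Lambda> - {a}. w l $ i) + (\<Sum>l\<in>\<Lambda> \<inter> {a}. w l $ i)"
            using i w(1,4) by (simp add: sum.Int_Diff[of \<Lambda> _ "{a}"] add.commute)
          finally show "z $ i = vsum m w (\<Lambda> \<inter> {a}) $ i" using i by simp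
        qed (use z in simp)
        have Cz: "C *\<^sub>v z = a \<cdot>\<^sub>v z"
        proof (cases "a \<in> \<Lambda>")
          case True
          then have "z = w a" using z_eq w(2)[OF True] by (auto intro!: eq_vecI)
          then show ?thesis using w(3)[OF True] by simp
        next
          case False
          then have "z = 0\<^sub>v m" using z_eq by simp
          then show ?thesis using C0 by (auto intro!: eq_vecI)
        qed
        \<comment> \<open>Moving one factor \<open>C - a\<close> to the other side turns this into
          \<open>bform B x' ((C - a) z)\<close>, which is zero: a nontrivial Jordan block is
          excluded.\<close>
        have "bform B z z = bform B (C *\<^sub>v x' - a \<cdot>\<^sub>v x') z" by (simp add: z_def)
        also have "\<dots> = bform B (C *\<^sub>v x') z - a * bform B x' z"
          using C x' z Bc by (simp add: bform_minus_left[where m = m and k = m] bform_smult_left[where m = m and k = m])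
        also have "bform B (C *\<^sub>v x') z = bform B x' (a \<cdot>\<^sub>v z)"
          using adj[OF x' z] Cz by simp
        finally have "bform B z z = 0"
          using x' z Bc by (simp add: bform_smult_right[where m = m and k = m])
        then have z0: "z = 0\<^sub>v m" using null z by blast
        have ex: "C *\<^sub>v x' = a \<cdot>\<^sub>v x'"
        proof (rule eq_vecI)
          fix i assume "i < dim_vec (a \<cdot>\<^sub>v x')"
          then show "(C *\<^sub>v x') $ i = (a \<cdot>\<^sub>v x') $ i"
            using arg_cong[OF z0, of "\<lambda>v. v $ i"] x' C by (simp add: z_def)
        qed (use C x' in simp)
        have "x = vsum m (f(a := x')) (insert a (\<Lambda> - {a}))"
        proof -
          have "vsum m (f(a := x')) (\<Lambda> - {a}) = vsum m f (\<Lambda> - {a})" by (intro vsum_cong) auto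
          then have "vsum m (f(a := x')) (insert a (\<Lambda> - {a})) = x' + vsum m f (\<Lambda> - {a})"
            using vsum_insert[of "\<Lambda> - {a}" a "f(a := x')" m] w(1) x' by simp
          also have "\<dots> = x" using x by (intro eq_vecI) (auto simp: x'_def)
          finally show ?thesis by (rule sym)
        qed
        then show ?thesis
          unfolding eig_sum_def using w(1) f x' ex
          by (intro exI[of _ "insert a (\<Lambda> - {a})"] exI[of _ "f(a := x')"]) auto
      next
        fix a b q assume b: "b \<noteq> 0" and p: "p = [:a\<^sup>2 + b\<^sup>2, - 2 * a, 1:] * q"
        define y where "y = krylov m C q x"
        have y: "y \<in> carrier_vec m" by (simp add: y_def)
        define Cy where "Cy = C *\<^sub>v y"
        have Cy: "Cy \<in> carrier_vec m" using C y by (simp add: Cy_def)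
        have q0: "q \<noteq> 0" using p less.prems by auto
        have C0: "C *\<^sub>v 0\<^sub>v m = 0\<^sub>v m" using C by (intro eq_vecI) auto
        have "krylov m C [:a\<^sup>2 + b\<^sup>2, - 2 * a, 1:] y = (a\<^sup>2 + b\<^sup>2) \<cdot>\<^sub>v y + C *\<^sub>v (- 2 * a \<cdot>\<^sub>v y + C *\<^sub>v (1 \<cdot>\<^sub>v y + C *\<^sub>v 0\<^sub>v m))"
          using krylov_0[of y m C] C y by (simp add: krylov_pCons)
        also have "1 \<cdot>\<^sub>v y + C *\<^sub>v 0\<^sub>v m = y" using y C0 by simp
        finally have "(a\<^sup>2 + b\<^sup>2) \<cdot>\<^sub>v y + C *\<^sub>v (- 2 * a \<cdot>\<^sub>v y + Cy) = 0\<^sub>v m"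
          using less.prems(3) krylov_mult[OF C x, of "[:a\<^sup>2 + b\<^sup>2, - 2 * a, 1:]" q] p by (simp add: y_def Cy_def)
        then have "0 = bform B y ((a\<^sup>2 + b\<^sup>2) \<cdot>\<^sub>v y + C *\<^sub>v (- 2 * a \<cdot>\<^sub>v y + Cy))"
          using Bc y by simp
        also have "\<dots> = (a\<^sup>2 + b\<^sup>2) * bform B y y + bform B Cy (- 2 * a \<cdot>\<^sub>v y + Cy)"
          using Bc y Cy C adj[OF y, of "- 2 * a \<cdot>\<^sub>v y + Cy"]
          by (simp add: bform_add_right[where m = m and k = m] bform_smult_right[where m = m and k = m] Cy_def)
        also have "\<dots> = (a\<^sup>2 + b\<^sup>2) * bform B y y - 2 * a * bform B Cy y + bform B Cy Cy"
          using Bc y Cy by (simp add: bform_add_right[where m = m and k = m] bform_smult_right[where m = m and k = m])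
        \<comment> \<open>Completing the square: \<open>C^2 - 2 a C + a^2 + b^2\<close> is
          \<open>(C - a)^2 + b^2\<close>, a sum of two nonnegative terms when tested with
          \<open>y\<close>.\<close>
        also have "\<dots> = b\<^sup>2 * bform B y y + bform B (Cy + (- a) \<cdot>\<^sub>v y) (Cy + (- a) \<cdot>\<^sub>v y)"
          using bform_quadratic[OF spd_matD(1)[OF B] Cy y, of "- a"] by (simp add: algebra_simps)
        finally have s: "b\<^sup>2 * bform B y y + bform B (Cy + (- a) \<cdot>\<^sub>v y) (Cy + (- a) \<cdot>\<^sub>v y) = 0" by simp
        have n1: "0 \<le> bform B (Cy + (- a) \<cdot>\<^sub>v y) (Cy + (- a) \<cdot>\<^sub>v y)" and n2: "0 \<le> bform B y y"
          using psd_matD(3)[OF spd_imp_psd[OF B]] y Cy by auto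
        have "0 \<le> b\<^sup>2 * bform B y y" using n2 by simp
        then have "b\<^sup>2 * bform B y y = 0" using s n1 by linarith
        then have "y = 0\<^sub>v m" using null[OF y] b by simp
        moreover have "degree q < degree p" unfolding p using q0 by (subst degree_mult_eq) auto
        ultimately show ?thesis using less.hyps[of q x] q0 x by (simp add: y_def)
      qed
    qed
  qed
  assume "x \<in> carrier_vec m"
  then show ?thesis using krylov_null ex_annihilating_poly[OF C] by blast
qed

section \<open>Spans and column spaces\<close>

lemma vec_span_superset: "X \<subseteq> carrier_vec m \<Longrightarrow> X \<subseteq> vec_span m X"
  unfolding vec_span_def
proof -
  interpret vec_space "TYPE(real)" m .
  show "X \<subseteq> carrier_vec m \<Longrightarrow> X \<subseteq> span X" using in_own_span[of X] by simp
qed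

lemma vec_span_carrier: "X \<subseteq> carrier_vec m \<Longrightarrow> vec_span m X \<subseteq> carrier_vec m"
  unfolding vec_span_def
proof -
  interpret vec_space "TYPE(real)" m .
  show "X \<subseteq> carrier_vec m \<Longrightarrow> span X \<subseteq> carrier_vec m" using span_is_subset2[of X] by simp
qed

lemma vec_span_zero: "0\<^sub>v m \<in> vec_span m X"
  unfolding vec_span_def
proof -
  interpret vec_space "TYPE(real)" m .
  show "0\<^sub>v m \<in> span X" using span_zero[of X] by simp
qed

lemma vec_span_add:
  assumes "X \<subseteq> carrier_vec m" "x \<in> vec_span m X" "y \<in> vec_span m X"
  shows "x + y \<in> vec_span m X"
proof -
  interpret vec_space "TYPE(real)" m .
  have "x \<in> span X" "y \<in> span X" using assms by (simp_all add: vec_span_def)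
  then have "x + y \<in> span X" using span_add1[of X x y] assms(1) by simp
  then show ?thesis by (simp add: vec_span_def)
qed

lemma vsum_in_vec_span:
  assumes "finite I" "X \<subseteq> carrier_vec m" "\<And>s. s \<in> I \<Longrightarrow> f s \<in> vec_span m X"
  shows "vsum m f I \<in> vec_span m X"
  using assms(1,3)
proof (induction I rule: finite_induct)
  case empty
  show ?case by (simp add: vec_span_zero)
next
  case (insert s I)
  have "f s \<in> carrier_vec m" using insert.prems vec_span_carrier[OF assms(2)] by auto
  then show ?case
    using insert vec_span_add[OF assms(2)] by (simp add: vsum_insert)
qed

lemma vec_span_cols:
  assumes "W \<in> carrier_mat m k"
  shows "vec_span m (set (cols W)) = {W *\<^sub>v c | c. c \<in> carrier_vec k}"
proof -
  interpret vec_space "TYPE(real)" m .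
  have "vec_span m (set (cols W)) = col_space W" by (simp add: vec_span_def col_space_def)
  also have "\<dots> = {W *\<^sub>v c | c. c \<in> carrier_vec k}" using col_space_eq[OF assms] assms by auto
  finally show ?thesis .
qed

text \<open>A relation \<open>W c = 0\<close> becomes a linear combination of the set of columns
  once each column knows its coefficient; \<open>f\<close> recovers it, and distinctness makes the
  index of a column unique.\<close>

lemma vec_lin_indpt_cols_inj:
  assumes W: "W \<in> carrier_mat m k" and dist: "distinct (cols W)" and li: "vec_lin_indpt m (set (cols W))"
    and c: "c \<in> carrier_vec k" "W *\<^sub>v c = 0\<^sub>v m"
  shows "c = 0\<^sub>v k"
proof (rule ccontr)
  assume "c \<noteq> 0\<^sub>v k"
  then obtain i where i: "i < k" "c $ i \<noteq> 0" using c by (metis carrier_vecD dim_vec eq_vecI index_zero_vec)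
  interpret vec_space "TYPE(real)" m .
  have len: "length (cols W) = k" using W by simp
  have sub: "set (cols W) \<subseteq> carrier_vec m" using W cols_dim by blast
  define f where "f v = c $ (SOME i. i < k \<and> cols W ! i = v)" for v
  have f: "f (cols W ! i) = c $ i" if "i < k" for i
  proof -
    have "(SOME j. j < k \<and> cols W ! j = cols W ! i) = i"
      using that dist len by (intro some_equality) (auto simp del: cols_nth simp: nth_eq_iff_index_eq)
    then show ?thesis by (simp add: f_def)
  qed
  have "lincomb f (set (cols W)) = lincomb_list (\<lambda>i. f (cols W ! i)) (cols W)"
    by (rule lincomb_as_lincomb_list_distinct[OF sub dist])
  also have "\<dots> = mat_of_cols m (cols W) *\<^sub>v vec k (\<lambda>i. f (cols W ! i))"
    using lincomb_list_as_mat_mult[of "cols W" "\<lambda>i. f (cols W ! i)"] sub len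
    by (metis carrier_vecD subsetD)
  also have "vec k (\<lambda>i. f (cols W ! i)) = c" using f c by (intro eq_vecI) auto
  also have "mat_of_cols m (cols W) = W" using W by auto
  finally have "lincomb f (set (cols W)) = 0\<^sub>v m" using c by simp
  moreover have "cols W ! i \<in> set (cols W)" using i len by (metis nth_mem)
  moreover have "f (cols W ! i) \<noteq> 0" using f i by simp
  ultimately have "lin_dep (set (cols W))"
    unfolding lin_dep_def by (intro exI[of _ "set (cols W)"] exI[of _ f] exI[of _ "cols W ! i"]) auto
  then show False using li by (simp add: vec_lin_indpt_def)
qed

lemma bform_vsum_orthogonal:
  assumes "M \<in> carrier_mat m m" "finite I" "\<And>s. s \<in> I \<Longrightarrow> y s \<in> carrier_vec m"
    and "\<And>s t. s \<in> I \<Longrightarrow> t \<in> I \<Longrightarrow> s \<noteq> t \<Longrightarrow> bform M (y s) (y t) = 0"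
  shows "bform M (vsum m y I) (vsum m y I) = (\<Sum>s\<in>I. bform M (y s) (y s))"
proof -
  have "bform M (vsum m y I) (vsum m y I) = (\<Sum>s\<in>I. \<Sum>t\<in>I. bform M (y s) (y t))"
    using assms by (subst bform_vsum_left) (auto intro!: sum.cong bform_vsum_right)
  also have "\<dots> = (\<Sum>s\<in>I. \<Sum>t\<in>I. if t = s then bform M (y s) (y s) else 0)"
    using assms(4) by (intro sum.cong) auto
  finally show ?thesis using assms(2) by simp
qed

text \<open>\<open>MB^-1 MA\<close> is self-adjoint for \<open>MB\<close>, so \<open>x\<close> is a
  sum of generalized eigenvectors that are mutually orthogonal for both forms; the sum is cut at the
  eigenvalue \<open>\<tau>\<close>. Definiteness is asked of \<open>MB\<close> alone, which lets a
  singular Neumann matrix play the role of \<open>MA\<close>.\<close>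

lemma pencil_splitting:
  assumes MA: "sym_mat m MA" and MB: "spd_mat m MB" and x: "x \<in> carrier_vec m"
  obtains l h where "l \<in> Y_L \<tau> MA MB" "h \<in> Y_H \<tau> MA MB" "l \<in> carrier_vec m" "h \<in> carrier_vec m"
    "x = l + h" "bform MA l h = 0" "bform MB l h = 0"
    "\<tau> * bform MB h h \<le> bform MA h h" "bform MA l l \<le> \<tau> * bform MB l l"
proof -
  note Ac = sym_matD[OF MA] and Bc = spd_matD(2)[OF MB]
  define C where "C = mat_inv MB * MA"
  have C: "C \<in> carrier_mat m m" using spd_mat_inv(1)[OF MB MB] Ac by (simp add: C_def)
  have BC: "MB *\<^sub>v (C *\<^sub>v v) = MA *\<^sub>v v" if "v \<in> carrier_vec m" for v
    using mat_inv_vec(1)[OF MB, of "MA *\<^sub>v v"] that Ac spd_mat_inv(1)[OF MB MB]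
    by (simp add: C_def)
  have BCf: "bform MB u (C *\<^sub>v v) = bform MA u v" if "v \<in> carrier_vec m" for u v
    using BC[OF that] by (simp add: bform_def)
  have "bform MB u (C *\<^sub>v v) = bform MB (C *\<^sub>v u) v" if "u \<in> carrier_vec m" "v \<in> carrier_vec m" for u v
    using BCf[of v u] BCf[of u v] that bform_sym[OF MA] bform_sym[OF spd_matD(1)[OF MB], of "C *\<^sub>v u" v] C
    by simp
  from selfadjoint_imp_eig_sum[OF MB C this x]
  obtain \<Lambda> y where \<Lambda>: "finite \<Lambda>" and y: "\<And>l. l \<in> \<Lambda> \<Longrightarrow> y l \<in> carrier_vec m"
    and Cy: "\<And>l. l \<in> \<Lambda> \<Longrightarrow> C *\<^sub>v y l = l \<cdot>\<^sub>v y l" and xy: "x = vsum m y \<Lambda>"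
    unfolding eig_sum_def by blast
  have Ay: "MA *\<^sub>v y l = l \<cdot>\<^sub>v (MB *\<^sub>v y l)" if "l \<in> \<Lambda>" for l
    using BC[OF y[OF that]] Cy[OF that] y[OF that] Bc by (simp add: mult_mat_vec)
  have ABy: "bform MA u (y l) = l * bform MB u (y l)" if "l \<in> \<Lambda>" "u \<in> carrier_vec m" for u l
    using Ay[OF that(1)] Bc y that by (simp add: bform_def)
  have oB: "bform MB (y l) (y k) = 0" if "l \<in> \<Lambda>" "k \<in> \<Lambda>" "l \<noteq> k" for l k
  proof -
    have "k * bform MB (y l) (y k) = l * bform MB (y k) (y l)"
      using ABy[of k "y l"] ABy[of l "y k"] bform_sym[OF MA, of "y l" "y k"] that y by simp
    then have "(k - l) * bform MB (y l) (y k) = 0"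
      using bform_sym[OF spd_matD(1)[OF MB], of "y l" "y k"] that y by (simp add: algebra_simps)
    then show ?thesis using that by simp
  qed
  have oA: "bform MA (y l) (y k) = 0" if "l \<in> \<Lambda>" "k \<in> \<Lambda>" "l \<noteq> k" for l k
    using ABy[of k "y l"] oB that y by simp
  define LL HH where "LL = {l \<in> \<Lambda>. l < \<tau>}" and "HH = {l \<in> \<Lambda>. \<not> l < \<tau>}"
  have fin: "finite LL" "finite HH" and sub: "LL \<subseteq> \<Lambda>" "HH \<subseteq> \<Lambda>"
    using \<Lambda> by (auto simp: LL_def HH_def)
  define l h where "l = vsum m y LL" and "h = vsum m y HH"
  have "\<Lambda> = LL \<union> HH" "LL \<inter> HH = {}" by (auto simp: LL_def HH_def)
  then have xlh: "x = l + h" using xy fin by (simp add: l_def h_def vsum_union)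
  have gc: "(\<Union>l\<in>S. generalized_eigenvectors l MA MB) \<subseteq> carrier_vec m" for S
    using Ac by (auto simp: generalized_eigenvectors_def)
  have yg: "y k \<in> generalized_eigenvectors k MA MB" if "k \<in> \<Lambda>" for k
    using Ay y that Ac by (auto simp: generalized_eigenvectors_def)
  have lY: "l \<in> Y_L \<tau> MA MB"
  proof -
    have "vsum m y LL \<in> vec_span m (\<Union>l\<in>{..<\<tau>}. generalized_eigenvectors l MA MB)"
    proof (rule vsum_in_vec_span[OF fin(1) gc])
      fix s assume "s \<in> LL"
      then show "y s \<in> vec_span m (\<Union>l\<in>{..<\<tau>}. generalized_eigenvectors l MA MB)"
        using yg[of s] by (intro vec_span_superset[OF gc, THEN subsetD]) (auto simp: LL_def)
    qed
    then show ?thesis using Ac by (simp add: l_def Y_L_def)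
  qed
  have hY: "h \<in> Y_H \<tau> MA MB"
  proof -
    have "vsum m y HH \<in> vec_span m (\<Union>l\<in>{\<tau>..}. generalized_eigenvectors l MA MB)"
    proof (rule vsum_in_vec_span[OF fin(2) gc])
      fix s assume "s \<in> HH"
      then show "y s \<in> vec_span m (\<Union>l\<in>{\<tau>..}. generalized_eigenvectors l MA MB)"
        using yg[of s] by (intro vec_span_superset[OF gc, THEN subsetD]) (auto simp: HH_def)
    qed
    then show ?thesis using Ac by (simp add: h_def Y_H_def)
  qed
  have cross: "bform M l h = 0" if "M \<in> carrier_mat m m"
    "\<And>l k. l \<in> \<Lambda> \<Longrightarrow> k \<in> \<Lambda> \<Longrightarrow> l \<noteq> k \<Longrightarrow> bform M (y l) (y k) = 0" for M
  proof -
    have "bform M l h = (\<Sum>s\<in>LL. \<Sum>t\<in>HH. bform M (y s) (y t))"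
      unfolding l_def h_def using sub y
      by (subst bform_vsum_left[OF that(1)]) (auto intro!: sum.cong bform_vsum_right[OF that(1)])
    also have "\<dots> = 0" using that(2) by (intro sum.neutral ballI) (auto simp: LL_def HH_def)
    finally show ?thesis .
  qed
  have diag: "bform M (vsum m y I) (vsum m y I) = (\<Sum>s\<in>I. bform M (y s) (y s))"
    if "M \<in> carrier_mat m m" "I \<subseteq> \<Lambda>"
    "\<And>l k. l \<in> \<Lambda> \<Longrightarrow> k \<in> \<Lambda> \<Longrightarrow> l \<noteq> k \<Longrightarrow> bform M (y l) (y k) = 0" for M I
  proof (rule bform_vsum_orthogonal[OF that(1)])
    show "finite I" using \<Lambda> that(2) by (rule finite_subset[rotated])
  qed (use that y in blast)+
  have dA: "bform MA (vsum m y I) (vsum m y I) = (\<Sum>s\<in>I. bform MA (y s) (y s))" if "I \<subseteq> \<Lambda>" for I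
    by (rule diag[OF Ac that oA])
  have dB: "bform MB (vsum m y I) (vsum m y I) = (\<Sum>s\<in>I. bform MB (y s) (y s))" if "I \<subseteq> \<Lambda>" for I
    by (rule diag[OF Bc that oB])
  have cA: "bform MA l h = 0" by (rule cross[OF Ac oA])
  have cB: "bform MB l h = 0" by (rule cross[OF Bc oB])
  have nn: "0 \<le> bform MB (y k) (y k)" if "k \<in> \<Lambda>" for k
    using psd_matD(3)[OF spd_imp_psd[OF MB]] y that by blast
  have "\<tau> * bform MB h h = (\<Sum>s\<in>HH. \<tau> * bform MB (y s) (y s))"
    unfolding h_def dB[OF sub(2)] by (simp add: sum_distrib_left)
  also have "\<dots> \<le> (\<Sum>s\<in>HH. bform MA (y s) (y s))"
    using ABy y nn by (intro sum_mono) (auto simp: HH_def intro!: mult_right_mono)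
  also have "\<dots> = bform MA h h" unfolding h_def dA[OF sub(2)] ..
  finally have hh: "\<tau> * bform MB h h \<le> bform MA h h" .
  have "bform MA l l = (\<Sum>s\<in>LL. bform MA (y s) (y s))" unfolding l_def dA[OF sub(1)] ..
  also have "\<dots> \<le> (\<Sum>s\<in>LL. \<tau> * bform MB (y s) (y s))"
    using ABy y nn by (intro sum_mono) (auto simp: LL_def intro!: mult_right_mono)
  also have "\<dots> = \<tau> * bform MB l l"
    unfolding l_def dB[OF sub(1)] by (simp add: sum_distrib_left)
  finally have ll: "bform MA l l \<le> \<tau> * bform MB l l" .
  show ?thesis
    by (rule that[OF lY hY _ _ xlh cA cB hh ll]) (simp_all add: l_def h_def)
qed

section \<open>Two-level Schwarz operators\<close>

text \<open>For a complex eigenvector with real part \<open>a\<close> and imaginary part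
  \<open>b\<close>, self-adjointness tested on the pair \<open>a\<close>, \<open>b\<close> gives
  \<open>Im k * (bform G a a + bform G b b) = 0\<close>. As \<open>G\<close> may be semidefinite,
  the second factor can vanish, and \<open>null\<close> takes care of this case. One of
  \<open>a\<close> and \<open>b\<close> is then a real eigenvector.\<close>

lemma selfadjoint_spectrum:
  assumes G: "psd_mat n G" and T: "T \<in> carrier_mat n n"
    and adj: "\<And>x y. x \<in> carrier_vec n \<Longrightarrow> y \<in> carrier_vec n \<Longrightarrow> bform G x (T *\<^sub>v y) = bform G (T *\<^sub>v x) y"
    and null: "\<And>x. x \<in> carrier_vec n \<Longrightarrow> bform G x x = 0 \<Longrightarrow> T *\<^sub>v x = 0\<^sub>v n"
    and k: "k \<in> spectrum_of T"
  obtains v where "k \<in> \<real>" "v \<in> carrier_vec n" "v \<noteq> 0\<^sub>v n" "T *\<^sub>v v = Re k \<cdot>\<^sub>v v"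
proof -
  let ?T = "map_mat complex_of_real T"
  note Gc = psd_matD(2)[OF G]
  obtain x where x: "x \<in> carrier_vec n" "x \<noteq> 0\<^sub>v n" "?T *\<^sub>v x = k \<cdot>\<^sub>v x"
    using k T by (auto simp: spectrum_of_def spectrum_def eigenvalue_def eigenvector_def)
  define a b where "a = vec n (\<lambda>i. Re (x $ i))" and "b = vec n (\<lambda>i. Im (x $ i))"
  have ab: "a \<in> carrier_vec n" "b \<in> carrier_vec n" by (simp_all add: a_def b_def)
  have row: "(?T *\<^sub>v x) $ i = (\<Sum>j<n. of_real (T $$ (i, j)) * x $ j)" if "i < n" for i
    using that T x(1) by (simp add: scalar_prod_def atLeast0LessThan)
  have Ti: "(T *\<^sub>v v) $ i = (\<Sum>j<n. T $$ (i, j) * v $ j)" if "i < n" "v \<in> carrier_vec n" for i v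
    using that T by (simp add: scalar_prod_def atLeast0LessThan)
  have Ta: "T *\<^sub>v a = Re k \<cdot>\<^sub>v a - Im k \<cdot>\<^sub>v b"
  proof (rule eq_vecI)
    fix i assume "i < dim_vec (Re k \<cdot>\<^sub>v a - Im k \<cdot>\<^sub>v b)"
    then have i: "i < n" using ab by simp
    have "(T *\<^sub>v a) $ i = Re ((?T *\<^sub>v x) $ i)" using i ab by (simp add: Ti row a_def)
    also have "\<dots> = Re (k * x $ i)" using x i by simp
    finally show "(T *\<^sub>v a) $ i = (Re k \<cdot>\<^sub>v a - Im k \<cdot>\<^sub>v b) $ i" using i by (simp add: a_def b_def)
  qed (use T ab in simp)
  have Tb: "T *\<^sub>v b = Im k \<cdot>\<^sub>v a + Re k \<cdot>\<^sub>v b"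
  proof (rule eq_vecI)
    fix i assume "i < dim_vec (Im k \<cdot>\<^sub>v a + Re k \<cdot>\<^sub>v b)"
    then have i: "i < n" using ab by simp
    have "(T *\<^sub>v b) $ i = Im ((?T *\<^sub>v x) $ i)" using i ab by (simp add: Ti row b_def)
    also have "\<dots> = Im (k * x $ i)" using x i by simp
    finally show "(T *\<^sub>v b) $ i = (Im k \<cdot>\<^sub>v a + Re k \<cdot>\<^sub>v b) $ i" using i by (simp add: a_def b_def)
  qed (use T ab in simp)
  have nz: "a \<noteq> 0\<^sub>v n \<or> b \<noteq> 0\<^sub>v n"
  proof (rule ccontr)
    assume "\<not> (a \<noteq> 0\<^sub>v n \<or> b \<noteq> 0\<^sub>v n)"
    then have "a $ i = 0" "b $ i = 0" if "i < n" for i using that by auto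
    then have "x $ i = 0" if "i < n" for i using that by (simp add: a_def b_def complex_eq_iff)
    then have "x = 0\<^sub>v n" using x by (intro eq_vecI) auto
    then show False using x by simp
  qed
  have "bform G a (T *\<^sub>v b) = bform G (T *\<^sub>v a) b" by (rule adj[OF ab])
  then have "Im k * (bform G a a + bform G b b) = 0"
    unfolding Ta Tb using ab Gc
    by (simp add: bform_add_right[where m = n and k = n] bform_minus_left[where m = n and k = n]
      bform_smult_left[where m = n and k = n] bform_smult_right[where m = n and k = n] algebra_simps)
  \<comment> \<open>The degenerate case: \<open>T\<close> annihilates \<open>a\<close> and
    \<open>b\<close>, hence \<open>k\<close> times every entry of the complex eigenvector is
    zero.\<close>
  moreover have "Im k = 0" if s: "bform G a a + bform G b b = 0"
  proof -
    have "bform G a a = 0" "bform G b b = 0"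
      using s psd_matD(3)[OF G ab(1)] psd_matD(3)[OF G ab(2)] by linarith+
    then have "T *\<^sub>v a = 0\<^sub>v n" "T *\<^sub>v b = 0\<^sub>v n" using null ab by auto
    then have 1: "Re k * a $ i - Im k * b $ i = 0" "Im k * a $ i + Re k * b $ i = 0" if "i < n" for i
      using arg_cong[OF Ta, of "\<lambda>v. v $ i"] arg_cong[OF Tb, of "\<lambda>v. v $ i"] that ab by auto
    have 2: "Im k * a $ i = 0 \<and> Im k * b $ i = 0" if "i < n" for i
    proof -
      have "Im k * (a $ i * a $ i + b $ i * b $ i) = a $ i * (Im k * a $ i + Re k * b $ i) - b $ i * (Re k * a $ i - Im k * b $ i)"
        by (simp add: algebra_simps)
      then have "Im k * (a $ i * a $ i + b $ i * b $ i) = 0" using 1[OF that] by simp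
      then show ?thesis by (auto simp: sum_squares_eq_zero_iff)
    qed
    show "Im k = 0"
    proof (rule ccontr)
      assume "Im k \<noteq> 0"
      then have "a = 0\<^sub>v n" "b = 0\<^sub>v n" using 2 ab by (auto intro!: eq_vecI)
      then show False using nz by blast
    qed
  qed
  ultimately have im: "Im k = 0" by auto
  have "T *\<^sub>v a = Re k \<cdot>\<^sub>v a" "T *\<^sub>v b = Re k \<cdot>\<^sub>v b"
    unfolding Ta Tb im using ab by (auto intro!: eq_vecI)
  moreover have "k \<in> \<real>" using im by (simp add: complex_is_Real_iff)
  ultimately show ?thesis using that ab nz by blast
qed

lemma mat_family_sum_carrier [simp]: "mat_family_sum nr nc F I \<in> carrier_mat nr nc"
  by (simp add: mat_family_sum_def)

lemma mat_family_sum_mult_vec: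
  assumes "\<And>s. s \<in> I \<Longrightarrow> F s \<in> carrier_mat nr nc" "x \<in> carrier_vec nc"
  shows "mat_family_sum nr nc F I *\<^sub>v x = vsum nr (\<lambda>s. F s *\<^sub>v x) I"
proof (rule eq_vecI)
  fix i assume "i < dim_vec (vsum nr (\<lambda>s. F s *\<^sub>v x) I)"
  then have i: "i < nr" by simp
  have "(mat_family_sum nr nc F I *\<^sub>v x) $ i = (\<Sum>j<nc. \<Sum>s\<in>I. F s $$ (i, j) * x $ j)"
    using i assms(2) by (simp add: mat_family_sum_def scalar_prod_def atLeast0LessThan sum_distrib_right)
  also have "\<dots> = (\<Sum>s\<in>I. \<Sum>j<nc. F s $$ (i, j) * x $ j)" by (rule sum.swap)
  also have "\<dots> = (\<Sum>s\<in>I. (F s *\<^sub>v x) $ i)"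
  proof (rule sum.cong[OF refl])
    fix s assume "s \<in> I"
    then have "F s \<in> carrier_mat nr nc" using assms by blast
    then show "(\<Sum>j<nc. F s $$ (i, j) * x $ j) = (F s *\<^sub>v x) $ i"
      using i assms(2) by (simp add: scalar_prod_def atLeast0LessThan)
  qed
  finally show "(mat_family_sum nr nc F I *\<^sub>v x) $ i = vsum nr (\<lambda>s. F s *\<^sub>v x) I $ i" using i by simp
qed (simp add: mat_family_sum_def)

text \<open>Each mixed term is at most the mean of the two squares; summing over all pairs counts
  every square \<open>card J\<close> times. Applied to the colors, this is where the factor
  \<open>Nc\<close> comes from.\<close>

lemma bform_triangle:
  assumes M: "psd_mat m M" and J: "finite J" and c: "\<And>j. j \<in> J \<Longrightarrow> c j \<in> carrier_vec m"
  shows "bform M (vsum m c J) (vsum m c J) \<le> card J * (\<Sum>j\<in>J. bform M (c j) (c j))"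
proof -
  note Mc = psd_matD(2)[OF M]
  have half: "2 * bform M (c i) (c j) \<le> bform M (c i) (c i) + bform M (c j) (c j)" if "i \<in> J" "j \<in> J" for i j
    using psd_matD(3)[OF M, of "c i + (-1) \<cdot>\<^sub>v c j"] bform_quadratic[OF psd_matD(1)[OF M] c c, of i j "-1"] that c
    by simp
  have "bform M (vsum m c J) (vsum m c J) = (\<Sum>i\<in>J. \<Sum>j\<in>J. bform M (c i) (c j))"
    using Mc c by (subst bform_vsum_left) (auto intro!: sum.cong bform_vsum_right)
  then have "2 * bform M (vsum m c J) (vsum m c J) = (\<Sum>i\<in>J. \<Sum>j\<in>J. 2 * bform M (c i) (c j))"
    by (simp add: sum_distrib_left)
  also have "\<dots> \<le> (\<Sum>i\<in>J. \<Sum>j\<in>J. bform M (c i) (c i) + bform M (c j) (c j))"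
    using half by (intro sum_mono) auto
  also have "\<dots> = 2 * (card J * (\<Sum>j\<in>J. bform M (c j) (c j)))"
    by (simp add: sum.distrib sum_distrib_left)
  finally show ?thesis by simp
qed

text \<open>The discriminant argument for the direct sum of the local spaces, whose dimensions
  \<open>m s\<close> may differ.\<close>

lemma sum_bform_Cauchy_Schwarz:
  assumes M: "\<And>s. s \<in> I \<Longrightarrow> psd_mat (m s) (M s)" and "finite I"
    and u: "\<And>s. s \<in> I \<Longrightarrow> u s \<in> carrier_vec (m s)" and z: "\<And>s. s \<in> I \<Longrightarrow> z s \<in> carrier_vec (m s)"
  shows "(\<Sum>s\<in>I. bform (M s) (u s) (z s))\<^sup>2 \<le> (\<Sum>s\<in>I. bform (M s) (u s) (u s)) * (\<Sum>s\<in>I. bform (M s) (z s) (z s))"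
proof (rule discriminant_le)
  fix t
  have "0 \<le> (\<Sum>s\<in>I. bform (M s) (u s + t \<cdot>\<^sub>v z s) (u s + t \<cdot>\<^sub>v z s))"
    using u z by (intro sum_nonneg psd_matD(3)[OF M]) auto
  also have "\<dots> = (\<Sum>s\<in>I. bform (M s) (u s) (u s) + 2 * t * bform (M s) (u s) (z s) + t\<^sup>2 * bform (M s) (z s) (z s))"
    using u z M by (intro sum.cong bform_quadratic) (auto dest: psd_matD)
  finally show "0 \<le> (\<Sum>s\<in>I. bform (M s) (u s) (u s)) + 2 * t * (\<Sum>s\<in>I. bform (M s) (u s) (z s)) + t\<^sup>2 * (\<Sum>s\<in>I. bform (M s) (z s) (z s))"
    by (simp add: sum.distrib sum_distrib_left)
next
  show "0 \<le> (\<Sum>s\<in>I. bform (M s) (z s) (z s))" using psd_matD(3)[OF M z] by (intro sum_nonneg) auto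
qed

text \<open>\<open>B s\<close> is any definite local solver and the independent rows of
  \<open>R0\<close> span any coarse space; spectral choices come in later. Each index carries a
  single color, although the classes behind \<open>coloring_constant\<close> may overlap.\<close>

locale two_level_schwarz =
  fixes n r Nc :: nat and I :: "nat set" and m color :: "nat \<Rightarrow> nat"
    and A R0 :: "real mat" and R B :: "nat \<Rightarrow> real mat"
  assumes A: "spd_mat n A" and fin: "finite I"
    and R: "\<And>s. s \<in> I \<Longrightarrow> R s \<in> carrier_mat (m s) n"
    and B: "\<And>s. s \<in> I \<Longrightarrow> spd_mat (m s) (B s)"
    and color: "\<And>s. s \<in> I \<Longrightarrow> color s \<in> {1..Nc}"
    and color_orth: "\<And>s t. s \<in> I \<Longrightarrow> t \<in> I \<Longrightarrow> s \<noteq> t \<Longrightarrow> color s = color t \<Longrightarrow>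
      R s * A * (R t)\<^sup>T = 0\<^sub>m (m s) (m t)"
    and R0: "R0 \<in> carrier_mat r n"
    and R0_inj: "\<And>c. c \<in> carrier_vec r \<Longrightarrow> R0\<^sup>T *\<^sub>v c = 0\<^sub>v n \<Longrightarrow> c = 0\<^sub>v r"
begin

definition V0 :: "real vec set" where
  "V0 = {R0\<^sup>T *\<^sub>v c | c. c \<in> carrier_vec r}"

text \<open>Extension from the product of the local spaces to the global one. Different families may
  have the same extension, and the freedom in choosing \<open>z\<close> is what the lower bounds
  exploit.\<close>

definition ext :: "(nat \<Rightarrow> real vec) \<Rightarrow> real vec" where
  "ext z = vsum n (\<lambda>s. (R s)\<^sup>T *\<^sub>v z s) I"

definition local_solution :: "real vec \<Rightarrow> nat \<Rightarrow> real vec" where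
  "local_solution w s = mat_inv (B s) *\<^sub>v (R s *\<^sub>v (A *\<^sub>v w))"

definition H :: "real mat" where
  "H = mat_family_sum n n (\<lambda>s. (R s)\<^sup>T * mat_inv (B s) * R s) I"

abbreviation Q :: "real mat" where "Q \<equiv> coarse_correction A R0"
abbreviation P :: "real mat" where "P \<equiv> coarse_projection A R0"
abbreviation a :: "real vec \<Rightarrow> real vec \<Rightarrow> real" where "a \<equiv> bform A"

lemmas Ac [simp] = spd_matD(2)[OF A]

lemma dimA [simp]: "dim_row A = n" "dim_col A = n" using carrier_matD[OF Ac] by auto

lemma Av [simp]: "x \<in> carrier_vec n \<Longrightarrow> A *\<^sub>v x \<in> carrier_vec n" by (rule mult_mat_vec_carrier[OF Ac])

abbreviation AR :: "nat \<Rightarrow> real mat" where "AR s \<equiv> R s * A * (R s)\<^sup>T"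

lemma a_sym: "x \<in> carrier_vec n \<Longrightarrow> y \<in> carrier_vec n \<Longrightarrow> a x y = a y x"
  by (rule bform_sym[OF spd_matD(1)[OF A]])

lemma a_nonneg: "x \<in> carrier_vec n \<Longrightarrow> 0 \<le> a x x"
  by (rule psd_matD(3)[OF spd_imp_psd[OF A]])

lemma a_pos: "x \<in> carrier_vec n \<Longrightarrow> x \<noteq> 0\<^sub>v n \<Longrightarrow> 0 < a x x"
  by (rule spd_matD(3)[OF A])

lemmas a_linear = bform_add_left[where m = n and k = n and M = A] bform_add_right[where m = n and k = n and M = A]
  bform_minus_left[where m = n and k = n and M = A] bform_minus_right[where m = n and k = n and M = A]
  bform_smult_left[where m = n and k = n and M = A] bform_smult_right[where m = n and k = n and M = A]

lemma Rt: "s \<in> I \<Longrightarrow> z \<in> carrier_vec (m s) \<Longrightarrow> (R s)\<^sup>T *\<^sub>v z \<in> carrier_vec n"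
  using R by (intro mult_mat_vec_carrier[of _ n "m s"]) auto

lemma ext_carrier [simp]: "ext z \<in> carrier_vec n"
  by (simp add: ext_def)

lemma RAv: "s \<in> I \<Longrightarrow> w \<in> carrier_vec n \<Longrightarrow> R s *\<^sub>v (A *\<^sub>v w) \<in> carrier_vec (m s)"
  by (rule mult_mat_vec_carrier[OF R Av])

lemma local_solution_carrier: "s \<in> I \<Longrightarrow> w \<in> carrier_vec n \<Longrightarrow> local_solution w s \<in> carrier_vec (m s)"
  unfolding local_solution_def by (rule mult_mat_vec_carrier[OF spd_mat_inv(1)[OF B B] RAv])

lemma B_local_solution:
  "s \<in> I \<Longrightarrow> w \<in> carrier_vec n \<Longrightarrow> B s *\<^sub>v local_solution w s = R s *\<^sub>v (A *\<^sub>v w)"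
  unfolding local_solution_def by (rule mat_inv_vec(1)[OF B RAv])

lemma bform_local:
  assumes "s \<in> I" "x \<in> carrier_vec (m s)" "y \<in> carrier_vec (m s)"
  shows "bform (AR s) x y = a ((R s)\<^sup>T *\<^sub>v x) ((R s)\<^sup>T *\<^sub>v y)"
  by (rule bform_congruence'[OF Ac R[OF assms(1)] assms(2,3)])

text \<open>Testing with an extension sees only the local residuals \<open>R s A w\<close>, which
  are \<open>B s\<close> applied to \<open>local_solution w s\<close>. Hence
  \<open>local_solution\<close> is the adjoint of \<open>ext\<close>, for the \<open>A\<close>-form
  on one side and the sum of the \<open>B s\<close>-forms on the other.\<close>

lemma a_ext:
  assumes w: "w \<in> carrier_vec n" and z: "\<And>s. s \<in> I \<Longrightarrow> z s \<in> carrier_vec (m s)"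
  shows "a w (ext z) = (\<Sum>s\<in>I. bform (B s) (local_solution w s) (z s))"
proof -
  have "a w (ext z) = (\<Sum>s\<in>I. a w ((R s)\<^sup>T *\<^sub>v z s))"
    unfolding ext_def by (rule bform_vsum_right[OF Ac w]) (use Rt z in auto)
  also have "\<dots> = (\<Sum>s\<in>I. bform (B s) (local_solution w s) (z s))"
  proof (rule sum.cong[OF refl])
    fix s assume s: "s \<in> I"
    have "a w ((R s)\<^sup>T *\<^sub>v z s) = a ((R s)\<^sup>T *\<^sub>v z s) w"
      by (rule a_sym[OF w Rt[OF s z[OF s]]])
    also have "\<dots> = z s \<bullet> (R s *\<^sub>v (A *\<^sub>v w))"
      unfolding bform_def by (rule transpose_move[OF R[OF s] z[OF s] Av[OF w]])
    also have "\<dots> = bform (B s) (z s) (local_solution w s)"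
      by (simp add: bform_def B_local_solution[OF s w])
    also have "\<dots> = bform (B s) (local_solution w s) (z s)"
      by (rule bform_sym[OF spd_matD(1)[OF B[OF s]] z[OF s] local_solution_carrier[OF s w]])
    finally show "a w ((R s)\<^sup>T *\<^sub>v z s) = bform (B s) (local_solution w s) (z s)" .
  qed
  finally show ?thesis .
qed

lemma Hc [simp]: "H \<in> carrier_mat n n"
  by (simp add: H_def)

lemma H_mult:
  assumes w: "w \<in> carrier_vec n"
  shows "H *\<^sub>v (A *\<^sub>v w) = ext (local_solution w)"
proof -
  have Fc: "(R s)\<^sup>T * mat_inv (B s) \<in> carrier_mat n (m s)" if "s \<in> I" for s
    using R[OF that] spd_mat_inv(1)[OF B[OF that] B[OF that]] by auto
  have "H *\<^sub>v (A *\<^sub>v w) = vsum n (\<lambda>s. ((R s)\<^sup>T * mat_inv (B s) * R s) *\<^sub>v (A *\<^sub>v w)) I"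
    unfolding H_def by (rule mat_family_sum_mult_vec[OF mult_carrier_mat[OF Fc R] Av[OF w]])
  also have "\<dots> = ext (local_solution w)"
    unfolding ext_def
  proof (rule vsum_cong)
    fix s assume s: "s \<in> I"
    have Rt: "(R s)\<^sup>T \<in> carrier_mat n (m s)" using R[OF s] by simp
    have v: "R s *\<^sub>v (A *\<^sub>v w) \<in> carrier_vec (m s)" using R[OF s] w by simp
    have "((R s)\<^sup>T * mat_inv (B s) * R s) *\<^sub>v (A *\<^sub>v w) = ((R s)\<^sup>T * mat_inv (B s)) *\<^sub>v (R s *\<^sub>v (A *\<^sub>v w))"
      by (rule assoc_mult_mat_vec[OF Fc[OF s] R[OF s] Av[OF w]])
    also have "\<dots> = (R s)\<^sup>T *\<^sub>v (mat_inv (B s) *\<^sub>v (R s *\<^sub>v (A *\<^sub>v w)))"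
      by (rule assoc_mult_mat_vec[OF Rt spd_mat_inv(1)[OF B[OF s] B[OF s]] v])
    finally show "((R s)\<^sup>T * mat_inv (B s) * R s) *\<^sub>v (A *\<^sub>v w) = (R s)\<^sup>T *\<^sub>v local_solution w s"
      by (simp add: local_solution_def)
  qed
  finally show ?thesis .
qed

definition energy :: "real vec \<Rightarrow> real" where
  "energy w = (\<Sum>s\<in>I. bform (B s) (local_solution w s) (local_solution w s))"

lemma a_H:
  assumes "x \<in> carrier_vec n" "y \<in> carrier_vec n"
  shows "a x (H *\<^sub>v (A *\<^sub>v y)) = (\<Sum>s\<in>I. bform (B s) (local_solution x s) (local_solution y s))"
  using a_ext[OF assms(1) local_solution_carrier] assms by (simp add: H_mult)

lemma a_H_sym:
  assumes "x \<in> carrier_vec n" "y \<in> carrier_vec n"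
  shows "a x (H *\<^sub>v (A *\<^sub>v y)) = a y (H *\<^sub>v (A *\<^sub>v x))"
  unfolding a_H[OF assms] a_H[OF assms(2,1)]
  using B local_solution_carrier assms
  by (intro sum.cong refl bform_sym[of "m s" for s]) (auto dest: spd_matD)

lemma energy_nonneg: "w \<in> carrier_vec n \<Longrightarrow> 0 \<le> energy w"
  unfolding energy_def
  by (intro sum_nonneg psd_matD(3)[OF spd_imp_psd[OF B]] local_solution_carrier)

text \<open>Pieces of one color extend to mutually \<open>A\<close>-orthogonal vectors, so their
  energies add up without loss; only the sum over the colors costs the factor
  \<open>Nc\<close>.\<close>

lemma a_ext_ext:
  assumes z: "\<And>s. s \<in> I \<Longrightarrow> z s \<in> carrier_vec (m s)"
  shows "a (ext z) (ext z) \<le> Nc * (\<Sum>s\<in>I. bform (AR s) (z s) (z s))"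
proof -
  define v where "v s = (R s)\<^sup>T *\<^sub>v z s" for s
  have v: "v s \<in> carrier_vec n" if "s \<in> I" for s unfolding v_def using Rt z that by blast
  define c where "c j = vsum n v {s \<in> I. color s = j}" for j
  have "ext z = vsum n c {1..Nc}"
  proof (rule eq_vecI)
    fix i assume "i < dim_vec (vsum n c {1..Nc})"
    then have i: "i < n" by simp
    have "ext z $ i = (\<Sum>s\<in>I. v s $ i)" using i by (simp add: ext_def v_def)
    also have "\<dots> = (\<Sum>j\<in>{1..Nc}. \<Sum>s\<in>{s \<in> I. color s = j}. v s $ i)"
      using color by (intro sum.group[symmetric] fin) auto
    finally show "ext z $ i = vsum n c {1..Nc} $ i" using i by (simp add: c_def)
  qed (simp add: ext_def)
  then have "a (ext z) (ext z) \<le> Nc * (\<Sum>j\<in>{1..Nc}. a (c j) (c j))"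
    using bform_triangle[OF spd_imp_psd[OF A], of "{1..Nc}" c] by (simp add: c_def)
  also have "(\<Sum>j\<in>{1..Nc}. a (c j) (c j)) = (\<Sum>j\<in>{1..Nc}. \<Sum>s\<in>{s \<in> I. color s = j}. a (v s) (v s))"
    unfolding c_def
  proof (intro sum.cong refl bform_vsum_orthogonal[OF Ac])
    fix j s t assume st: "s \<in> {s \<in> I. color s = j}" "t \<in> {s \<in> I. color s = j}" "s \<noteq> t"
    have sI: "s \<in> I" "t \<in> I" using st by auto
    have zc: "z s \<in> carrier_vec (m s)" "z t \<in> carrier_vec (m t)" using z sI by auto
    have Rts: "(R t)\<^sup>T \<in> carrier_mat n (m t)" using R sI by simp
    have RA: "R s * A \<in> carrier_mat (m s) n" using R[OF sI(1)] by auto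
    have "a (v s) (v t) = z s \<bullet> (R s *\<^sub>v (A *\<^sub>v v t))"
      unfolding bform_def v_def[of s] by (rule transpose_move[OF R[OF sI(1)] zc(1) Av[OF v[OF sI(2)]]])
    also have "R s *\<^sub>v (A *\<^sub>v v t) = (R s * A * (R t)\<^sup>T) *\<^sub>v z t"
      using assoc_mult_mat_vec[OF RA Rts zc(2)] assoc_mult_mat_vec[OF R[OF sI(1)] Ac v[OF sI(2)]]
      by (simp add: v_def)
    also have "R s * A * (R t)\<^sup>T = 0\<^sub>m (m s) (m t)"
      using color_orth[of s t] st sI by auto
    also have "0\<^sub>m (m s) (m t) *\<^sub>v z t = 0\<^sub>v (m s)" using zc by auto
    finally show "a (v s) (v t) = 0" using zc by simp
  qed (use fin v in auto)
  also have "\<dots> = (\<Sum>s\<in>I. a (v s) (v s))"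
    using color by (intro sum.group fin) auto
  also have "\<dots> = (\<Sum>s\<in>I. bform (AR s) (z s) (z s))"
    using z by (intro sum.cong refl) (simp add: v_def bform_local)
  finally show ?thesis .
qed

text \<open>\<open>energy w\<close> equals \<open>a w (ext u)\<close> for the local solutions
  \<open>u\<close>. Cauchy-Schwarz and the coloring bound its square by
  \<open>Nc / c * a w w * energy w\<close>, and one factor cancels. The constant \<open>c\<close> is
  later \<open>\<upsilon>\<close> or \<open>C_sharp\<close>.\<close>

lemma energy_upper:
  assumes w: "w \<in> carrier_vec n" and c: "0 < c"
    and loc: "\<And>s. s \<in> I \<Longrightarrow> c * bform (AR s) (local_solution w s) (local_solution w s)
      \<le> bform (B s) (local_solution w s) (local_solution w s)"
  shows "energy w \<le> Nc / c * a w w"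
proof (cases "energy w = 0")
  case True
  then show ?thesis using a_nonneg[OF w] c by simp
next
  case False
  then have pos: "0 < energy w" using energy_nonneg[OF w] by simp
  let ?u = "local_solution w"
  have "energy w = a w (ext ?u)" using a_ext[OF w local_solution_carrier[OF _ w]] by (simp add: energy_def)
  then have "(energy w)\<^sup>2 \<le> a w w * a (ext ?u) (ext ?u)"
    using bform_Cauchy_Schwarz[OF spd_imp_psd[OF A] w, of "ext ?u"] by simp
  also have "a (ext ?u) (ext ?u) \<le> Nc * (\<Sum>s\<in>I. bform (AR s) (?u s) (?u s))"
    by (rule a_ext_ext[OF local_solution_carrier[OF _ w]])
  also have "(\<Sum>s\<in>I. bform (AR s) (?u s) (?u s)) \<le> (\<Sum>s\<in>I. bform (B s) (?u s) (?u s) / c)"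
    using loc c by (intro sum_mono) (simp add: field_simps)
  also have "\<dots> = energy w / c" by (simp add: energy_def sum_divide_distrib)
  finally have "(energy w)\<^sup>2 \<le> a w w * (Nc * (energy w / c))"
    using a_nonneg[OF w] by (simp add: mult_left_mono)
  then have "energy w * energy w \<le> (Nc / c * a w w) * energy w" by (simp add: power2_eq_square field_simps)
  then show ?thesis using pos by (rule mult_right_le_imp_le)
qed

text \<open>Cauchy-Schwarz on the product of the local spaces, after passing to the adjoint of
  \<open>ext\<close>. It converts a cheap family \<open>z\<close> into a lower bound for the
  energy.\<close>

lemma energy_dual:
  assumes w: "w \<in> carrier_vec n" and z: "\<And>s. s \<in> I \<Longrightarrow> z s \<in> carrier_vec (m s)"
  shows "(a w (ext z))\<^sup>2 \<le> energy w * (\<Sum>s\<in>I. bform (B s) (z s) (z s))"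
proof -
  have "(\<Sum>s\<in>I. bform (B s) (local_solution w s) (z s))\<^sup>2 \<le> energy w * (\<Sum>s\<in>I. bform (B s) (z s) (z s))"
    unfolding energy_def
    by (rule sum_bform_Cauchy_Schwarz[where m = m]) (use spd_imp_psd[OF B] fin z local_solution_carrier w in auto)
  moreover have "a w (ext z) = (\<Sum>s\<in>I. bform (B s) (local_solution w s) (z s))" by (rule a_ext[OF w z])
  ultimately show ?thesis by simp
qed

section \<open>The coarse correction and the \<open>A\<close>-orthogonal projection with kernel
  \<open>V0\<close>\<close>

lemma coarse_spd: "spd_mat r (R0 * A * R0\<^sup>T)"
  using spd_mat_congruence[OF A, of "R0\<^sup>T" r] R0 R0_inj by simp

lemmas coarse_inv_carrier [simp] = spd_mat_inv(1)[OF coarse_spd coarse_spd]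

lemma Qc [simp]: "Q \<in> carrier_mat n n"
proof -
  have "R0\<^sup>T * mat_inv (R0 * A * R0\<^sup>T) \<in> carrier_mat n r"
    using R0 by (intro mult_carrier_mat[OF _ coarse_inv_carrier]) simp
  then show ?thesis unfolding coarse_correction_def using R0 by (rule mult_carrier_mat)
qed

lemma Pc [simp]: "P \<in> carrier_mat n n"
  unfolding coarse_projection_def by (intro minus_carrier_mat mult_carrier_mat[OF Qc Ac])

lemma Q_mult:
  assumes y: "y \<in> carrier_vec n"
  shows "Q *\<^sub>v y = R0\<^sup>T *\<^sub>v (mat_inv (R0 * A * R0\<^sup>T) *\<^sub>v (R0 *\<^sub>v y))"
proof -
  have Rt: "R0\<^sup>T \<in> carrier_mat n r" using R0 by simp
  have c: "R0\<^sup>T * mat_inv (R0 * A * R0\<^sup>T) \<in> carrier_mat n r"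
    by (rule mult_carrier_mat[OF Rt coarse_inv_carrier])
  have v: "R0 *\<^sub>v y \<in> carrier_vec r" using R0 y by simp
  show ?thesis
    unfolding coarse_correction_def assoc_mult_mat_vec[OF c R0 y]
    by (rule assoc_mult_mat_vec[OF Rt coarse_inv_carrier v])
qed

lemma V0_carrier: "v \<in> V0 \<Longrightarrow> v \<in> carrier_vec n"
  using R0 by (auto simp: V0_def)

lemma V0_add:
  assumes "u \<in> V0" "v \<in> V0"
  shows "u + v \<in> V0" "u - v \<in> V0"
proof -
  obtain c d where cd: "c \<in> carrier_vec r" "d \<in> carrier_vec r" "u = R0\<^sup>T *\<^sub>v c" "v = R0\<^sup>T *\<^sub>v d"
    using assms by (auto simp: V0_def)
  have Rt: "R0\<^sup>T \<in> carrier_mat n r" using R0 by simp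
  show "u + v \<in> V0" unfolding V0_def using cd mult_add_distrib_mat_vec[OF Rt cd(1,2)]
    by (intro CollectI exI[of _ "c + d"]) auto
  show "u - v \<in> V0" unfolding V0_def using cd mult_minus_distrib_mat_vec[OF Rt cd(1,2)]
    by (intro CollectI exI[of _ "c - d"]) auto
qed

lemma Q_V0: "y \<in> carrier_vec n \<Longrightarrow> Q *\<^sub>v y \<in> V0"
  using mult_mat_vec_carrier[OF coarse_inv_carrier mult_mat_vec_carrier[OF R0]]
  unfolding V0_def by (auto simp: Q_mult)

lemma P_mult:
  assumes "x \<in> carrier_vec n"
  shows "P *\<^sub>v x = x - Q *\<^sub>v (A *\<^sub>v x)"
proof -
  have "P *\<^sub>v x = 1\<^sub>m n *\<^sub>v x - (Q * A) *\<^sub>v x"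
    unfolding coarse_projection_def dimA
    by (rule minus_mult_distrib_mat_vec[OF one_carrier_mat mult_carrier_mat[OF Qc Ac] assms])
  then show ?thesis using assoc_mult_mat_vec[OF Qc Ac assms] assms by simp
qed

lemma Pv [simp]: "x \<in> carrier_vec n \<Longrightarrow> P *\<^sub>v x \<in> carrier_vec n"
  by (rule mult_mat_vec_carrier[OF Pc])

lemma Qv [simp]: "x \<in> carrier_vec n \<Longrightarrow> Q *\<^sub>v x \<in> carrier_vec n"
  by (rule mult_mat_vec_carrier[OF Qc])

lemma Hv [simp]: "x \<in> carrier_vec n \<Longrightarrow> H *\<^sub>v x \<in> carrier_vec n"
  by (rule mult_mat_vec_carrier[OF Hc])

lemma dim_Q [simp]: "dim_row Q = n"
  by (rule carrier_matD(1)[OF Qc])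

text \<open>The coarse correction solves the problem on \<open>V0\<close> exactly:
  \<open>R0 A Q A x = R0 A x\<close>, so the residual of the error \<open>P x\<close> vanishes on
  \<open>V0\<close>.\<close>

lemma a_V0_P:
  assumes v: "v \<in> V0" and x: "x \<in> carrier_vec n"
  shows "a v (P *\<^sub>v x) = 0"
proof -
  obtain c where c: "c \<in> carrier_vec r" and vc: "v = R0\<^sup>T *\<^sub>v c" using v by (auto simp: V0_def)
  have Rt: "R0\<^sup>T \<in> carrier_mat n r" using R0 by simp
  have RA: "R0 * A \<in> carrier_mat r n" using R0 by auto
  have av: "a v y = c \<bullet> (R0 *\<^sub>v (A *\<^sub>v y))" if "y \<in> carrier_vec n" for y
    unfolding bform_def vc by (rule transpose_move[OF R0 c Av[OF that]])
  define d where "d = mat_inv (R0 * A * R0\<^sup>T) *\<^sub>v (R0 *\<^sub>v (A *\<^sub>v x))"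
  have RAx: "R0 *\<^sub>v (A *\<^sub>v x) \<in> carrier_vec r" using R0 x by simp
  have d: "d \<in> carrier_vec r" unfolding d_def by (rule mult_mat_vec_carrier[OF coarse_inv_carrier RAx])
  have Rd: "R0\<^sup>T *\<^sub>v d \<in> carrier_vec n" using Rt d by simp
  have "R0 *\<^sub>v (A *\<^sub>v (R0\<^sup>T *\<^sub>v d)) = (R0 * A * R0\<^sup>T) *\<^sub>v d"
    using assoc_mult_mat_vec[OF RA Rt d] assoc_mult_mat_vec[OF R0 Ac Rd] by simp
  also have "\<dots> = R0 *\<^sub>v (A *\<^sub>v x)"
    unfolding d_def by (rule mat_inv_vec(1)[OF coarse_spd RAx])
  finally have "a v (Q *\<^sub>v (A *\<^sub>v x)) = a v x"
    using Q_mult[OF Av[OF x]] av[OF x] av[OF Rd] by (simp add: d_def)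
  then show ?thesis unfolding P_mult[OF x] using x V0_carrier[OF v] by (simp add: a_linear)
qed

lemma P_decomp:
  assumes "x \<in> carrier_vec n"
  shows "x = P *\<^sub>v x + Q *\<^sub>v (A *\<^sub>v x)"
proof -
  have "Q *\<^sub>v (A *\<^sub>v x) \<in> carrier_vec n" using assms by simp
  then show ?thesis unfolding P_mult[OF assms] using assms by (intro eq_vecI) auto
qed

lemma a_P_left:
  assumes "x \<in> carrier_vec n" "y \<in> carrier_vec n"
  shows "a (P *\<^sub>v x) y = a (P *\<^sub>v x) (P *\<^sub>v y)"
proof -
  have "a (P *\<^sub>v x) (Q *\<^sub>v (A *\<^sub>v y)) = 0"
    using a_V0_P[OF Q_V0[OF Av[OF assms(2)]] assms(1)] a_sym assms by simp
  then show ?thesis using assms by (subst P_decomp[OF assms(2)]) (simp add: a_linear)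
qed

lemma a_P_right:
  assumes "x \<in> carrier_vec n" "y \<in> carrier_vec n"
  shows "a x (P *\<^sub>v y) = a (P *\<^sub>v x) y"
  using a_P_left[OF assms] a_P_left[OF assms(2,1)] a_sym[of x "P *\<^sub>v y"] a_sym[of "P *\<^sub>v x" "P *\<^sub>v y"] assms by simp

lemma a_Q:
  assumes "x \<in> carrier_vec n" "y \<in> carrier_vec n"
  shows "a x (Q *\<^sub>v (A *\<^sub>v y)) = a (Q *\<^sub>v (A *\<^sub>v x)) (Q *\<^sub>v (A *\<^sub>v y))"
proof -
  have "a (P *\<^sub>v x) (Q *\<^sub>v (A *\<^sub>v y)) = 0"
    using a_V0_P[OF Q_V0[OF Av[OF assms(2)]] assms(1)] a_sym assms by simp
  then show ?thesis using assms by (subst P_decomp[OF assms(1)]) (simp add: a_linear)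
qed

lemma a_Pythagoras:
  assumes "x \<in> carrier_vec n"
  shows "a x x = a (P *\<^sub>v x) (P *\<^sub>v x) + a (Q *\<^sub>v (A *\<^sub>v x)) (Q *\<^sub>v (A *\<^sub>v x))"
proof -
  have "a x x = a x (P *\<^sub>v x) + a x (Q *\<^sub>v (A *\<^sub>v x))"
    using assms by (subst (2) P_decomp[OF assms]) (simp add: a_linear)
  then show ?thesis using a_P_right[OF assms assms] a_P_left[OF assms assms] a_Q[OF assms assms] by simp
qed

end

lemma vec_eq_scalar_prodI:
  fixes u v :: "real vec"
  assumes "u \<in> carrier_vec n" "v \<in> carrier_vec n" "\<And>y. y \<in> carrier_vec n \<Longrightarrow> u \<bullet> y = v \<bullet> y"
  shows "u = v"
proof (rule eq_vecI)
  fix i assume "i < dim_vec v"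
  then have i: "i < n" using assms by simp
  then show "u $ i = v $ i" using assms(3)[of "unit_vec n i"] assms(1,2) by simp
qed (use assms in simp)

lemma Cauchy_Schwarz_two:
  fixes p q r s :: real
  shows "(p * r + q * s)\<^sup>2 \<le> (p\<^sup>2 + q\<^sup>2) * (r\<^sup>2 + s\<^sup>2)"
proof -
  have "(p\<^sup>2 + q\<^sup>2) * (r\<^sup>2 + s\<^sup>2) - (p * r + q * s)\<^sup>2 = (p * s - q * r)\<^sup>2"
    by (simp add: power2_eq_square algebra_simps)
  then show ?thesis by (metis diff_ge_0_iff_ge zero_le_power2)
qed

text \<open>The inputs about the coarse space, satisfied by both constructions of \<open>V0\<close>.
  \<open>local_upper\<close> is claimed only for vectors that are \<open>A\<close>-orthogonal to
  \<open>V0\<close>. In \<open>stable_splitting\<close> the \<open>\<tau>\<close> bound yields the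
  lower bounds, and the last clause controls the coarse remainder in the additive one.\<close>

locale geneo = two_level_schwarz +
  fixes \<tau> \<upsilon> C_sharp :: real
  assumes \<tau>: "1 < \<tau>" and \<upsilon>: "0 < \<upsilon>" "\<upsilon> < real Nc" and C_sharp: "0 < C_sharp"
    and C_sharp_bound: "\<And>s x. s \<in> I \<Longrightarrow> x \<in> carrier_vec (m s) \<Longrightarrow>
      bform (AR s) x x \<le> inverse C_sharp * bform (B s) x x"
    and local_upper: "\<And>w s. w \<in> carrier_vec n \<Longrightarrow> (\<And>v. v \<in> V0 \<Longrightarrow> a v w = 0) \<Longrightarrow> s \<in> I \<Longrightarrow>
      \<upsilon> * bform (AR s) (local_solution w s) (local_solution w s)
        \<le> bform (B s) (local_solution w s) (local_solution w s)"
    and stable_splitting: "\<And>x. x \<in> carrier_vec n \<Longrightarrow> \<exists>z. (\<forall>s\<in>I. z s \<in> carrier_vec (m s)) \<and> x - ext z \<in> V0 \<and>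
      (\<Sum>s\<in>I. bform (B s) (z s) (z s)) \<le> \<tau> * a x x \<and>
      (\<forall>s\<in>I. \<upsilon> * bform (AR s) (z s) (z s) \<le> bform (B s) (z s) (z s))"
begin

lemma energy_P_upper:
  assumes "x \<in> carrier_vec n"
  shows "energy (P *\<^sub>v x) \<le> Nc / \<upsilon> * a (P *\<^sub>v x) (P *\<^sub>v x)"
  using assms by (intro energy_upper \<upsilon> local_upper) (auto intro: a_V0_P)

text \<open>\<open>w = P x\<close> is orthogonal to the coarse remainder of its splitting, so
  \<open>a w w\<close> equals \<open>a w (ext z)\<close>; by \<open>energy_dual\<close> and the
  \<open>\<tau>\<close> bound its square is at most
  \<open>\<tau> * energy w * a w w\<close>.\<close>

lemma energy_P_lower:
  assumes "x \<in> carrier_vec n"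
  shows "a (P *\<^sub>v x) (P *\<^sub>v x) \<le> \<tau> * energy (P *\<^sub>v x)"
proof -
  define w where "w = P *\<^sub>v x"
  have w: "w \<in> carrier_vec n" using assms by (simp add: w_def)
  obtain z where z: "\<And>s. s \<in> I \<Longrightarrow> z s \<in> carrier_vec (m s)" and v: "w - ext z \<in> V0"
    and bound: "(\<Sum>s\<in>I. bform (B s) (z s) (z s)) \<le> \<tau> * a w w"
    using stable_splitting[OF w] by blast
  have "a (w - ext z) w = 0" using a_V0_P[OF v assms] by (simp add: w_def)
  then have "a w w = a w (ext z)" using w a_sym[of w "ext z"] by (simp add: a_linear)
  then have "(a w w)\<^sup>2 \<le> energy w * (\<Sum>s\<in>I. bform (B s) (z s) (z s))"
    using energy_dual[OF w z] by simp
  also have "\<dots> \<le> energy w * (\<tau> * a w w)" by (rule mult_left_mono[OF bound energy_nonneg[OF w]])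
  finally have sq: "a w w * a w w \<le> (\<tau> * energy w) * a w w" by (simp add: power2_eq_square algebra_simps)
  show ?thesis
  proof (cases "a w w = 0")
    case True
    then show ?thesis using energy_nonneg[OF w] \<tau> by (simp add: w_def)
  next
    case False
    then have "0 < a w w" using a_nonneg[OF w] by simp
    then show ?thesis using sq unfolding w_def by (rule mult_right_le_imp_le[rotated])
  qed
qed

text \<open>Here \<open>x\<close> may have a coarse component, for which \<open>local_upper\<close>
  says nothing; the bound by \<open>C_sharp\<close> holds for all local vectors.\<close>

lemma energy_global_upper:
  assumes "x \<in> carrier_vec n"
  shows "energy x \<le> Nc / C_sharp * a x x"
proof (rule energy_upper[OF assms C_sharp])
  fix s assume "s \<in> I"
  then show "C_sharp * bform (AR s) (local_solution x s) (local_solution x s)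
    \<le> bform (B s) (local_solution x s) (local_solution x s)"
    using C_sharp_bound[of s "local_solution x s"] local_solution_carrier[of s x] assms C_sharp
    by (simp add: field_simps)
qed

text \<open>Only the projected part \<open>w\<close> of \<open>x\<close> is split. Since \<open>w\<close> is orthogonal to the coarse part \<open>v0\<close>
  of its splitting, no additive constant enters the bound.\<close>

lemma additive_lower:
  assumes x: "x \<in> carrier_vec n"
  shows "a x x \<le> ((1 + 2 * real Nc / \<upsilon>) * \<tau>) * (energy x + a (Q *\<^sub>v (A *\<^sub>v x)) (Q *\<^sub>v (A *\<^sub>v x)))"
proof -
  define w q where "w = P *\<^sub>v x" and "q = Q *\<^sub>v (A *\<^sub>v x)"
  have w: "w \<in> carrier_vec n" and q: "q \<in> carrier_vec n" using x by (simp_all add: w_def q_def)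
  have qV: "q \<in> V0" using x by (simp add: q_def Q_V0)
  obtain z where z: "\<And>s. s \<in> I \<Longrightarrow> z s \<in> carrier_vec (m s)" and v: "w - ext z \<in> V0"
    and bound: "(\<Sum>s\<in>I. bform (B s) (z s) (z s)) \<le> \<tau> * a w w"
    and ups: "\<And>s. s \<in> I \<Longrightarrow> \<upsilon> * bform (AR s) (z s) (z s) \<le> bform (B s) (z s) (z s)"
    using stable_splitting[OF w] by blast
  define v0 S where "v0 = w - ext z" and "S = (\<Sum>s\<in>I. bform (B s) (z s) (z s))"
  have v0: "v0 \<in> carrier_vec n" "v0 \<in> V0" using v w by (simp_all add: v0_def)
  have orth: "a v w = 0" if "v \<in> V0" for v using a_V0_P[OF that x] by (simp add: w_def)
  have xwq: "x = w + q" using P_decomp[OF x] by (simp add: w_def q_def)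
  have ez: "ext z = w - v0" using w by (intro eq_vecI) (auto simp: v0_def)
  \<comment> \<open>Pythagoras for \<open>ext z = w - v0\<close> with \<open>w\<close> orthogonal to
    \<open>v0\<close>. The summand \<open>a w w\<close> on the left is kept, since it sharpens the
    bound on \<open>a v0 v0\<close>.\<close>
  have "a w w + a v0 v0 = a (ext z) (ext z)"
    unfolding ez using w v0 orth[OF v0(2)] a_sym[OF w v0(1)] by (simp add: a_linear)
  also have "\<dots> \<le> Nc * (\<Sum>s\<in>I. bform (AR s) (z s) (z s))"
    by (rule a_ext_ext[OF z])
  finally have "a w w + a v0 v0 \<le> Nc * (\<Sum>s\<in>I. bform (AR s) (z s) (z s))" .
  also have "\<dots> \<le> Nc * (\<Sum>s\<in>I. bform (B s) (z s) (z s) / \<upsilon>)"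
    using ups \<upsilon> by (intro mult_left_mono sum_mono) (auto simp: field_simps)
  also have "\<dots> = Nc / \<upsilon> * S" by (simp add: S_def sum_divide_distrib[symmetric])
  also have "\<dots> \<le> Nc / \<upsilon> * (\<tau> * a w w)" using bound \<upsilon> by (intro mult_left_mono) (auto simp: S_def)
  finally have v0_bound: "a v0 v0 \<le> Nc / \<upsilon> * \<tau> * a w w - a w w" by simp
  define c where "c = q + v0"
  have c: "c \<in> carrier_vec n" using q v0 by (simp add: c_def)
  \<comment> \<open>The parallelogram inequality; its factor is the 2 in
    \<open>1 + 2 * Nc / \<upsilon>\<close>.\<close>
  have "0 \<le> a (q - v0) (q - v0)" using q v0 by (intro a_nonneg) simp
  then have c_bound: "a c c \<le> 2 * a q q + 2 * a v0 v0"
    using q v0 a_sym[OF q v0(1)] by (simp add: c_def a_linear)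
  have "x = c + ext z" unfolding xwq c_def ez using w q v0 by (intro eq_vecI) auto
  then have "a x x = a x c + a x (ext z)" using x c by (metis a_linear(2) ext_carrier Ac)
  \<comment> \<open>\<open>c\<close> lies in \<open>V0\<close>, so pairing it with
    \<open>x = w + q\<close> leaves only \<open>q\<close>, whose energy is what the coarse term of
    the additive operator measures.\<close>
  moreover have "a x c = a q c"
    unfolding xwq using w q c orth[OF V0_add(1)[OF qV v0(2)]] a_sym[OF w c] by (simp add: a_linear c_def)
  ultimately have axx: "a x x = a q c + a x (ext z)" by simp
  define K where "K = (1 + 2 * real Nc / \<upsilon>) * \<tau>"
  have nn: "0 \<le> a q q" "0 \<le> a c c" "0 \<le> S" "0 \<le> energy x" "0 \<le> a w w" "0 \<le> a x x"
    using a_nonneg q c w x energy_nonneg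
    by (auto simp: S_def intro!: sum_nonneg psd_matD(3)[OF spd_imp_psd[OF B]] z)
  have cs1: "(a q c)\<^sup>2 \<le> a q q * a c c"
    by (rule bform_Cauchy_Schwarz[OF spd_imp_psd[OF A] q c])
  have cs2: "(a x (ext z))\<^sup>2 \<le> energy x * S" using energy_dual[OF x z] by (simp add: S_def)
  have "(a x x)\<^sup>2 \<le> (a q q + energy x) * (a c c + S)"
  proof -
    have "\<bar>a q c\<bar> \<le> sqrt (a q q) * sqrt (a c c)"
      using real_sqrt_le_mono[OF cs1] by (simp add: real_sqrt_mult)
    moreover have "\<bar>a x (ext z)\<bar> \<le> sqrt (energy x) * sqrt S"
      using real_sqrt_le_mono[OF cs2] by (simp add: real_sqrt_mult)
    ultimately have "\<bar>a x x\<bar> \<le> sqrt (a q q) * sqrt (a c c) + sqrt (energy x) * sqrt S"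
      unfolding axx by linarith
    then have "(a x x)\<^sup>2 \<le> (sqrt (a q q) * sqrt (a c c) + sqrt (energy x) * sqrt S)\<^sup>2"
      using nn(6) by (intro power_mono) auto
    also have "\<dots> \<le> ((sqrt (a q q))\<^sup>2 + (sqrt (energy x))\<^sup>2) * ((sqrt (a c c))\<^sup>2 + (sqrt S)\<^sup>2)"
      by (rule Cauchy_Schwarz_two)
    finally show ?thesis using nn by simp
  qed
  also have "a c c + S \<le> K * a x x"
  proof -
    have ax: "a x x = a w w + a q q" using a_Pythagoras[OF x] by (simp add: w_def q_def)
    \<comment> \<open>The assumptions \<open>\<upsilon> < Nc\<close> and \<open>1 < \<tau>\<close>
      make \<open>K\<close> at least 2, which absorbs \<open>2 * a q q\<close> into
      \<open>K * a q q\<close>.\<close>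
    have "1 < real Nc / \<upsilon>" using \<upsilon> by simp
    then have "1 * 1 \<le> real Nc / \<upsilon> * \<tau>" using \<tau> by (intro mult_mono) auto
    moreover have "K = \<tau> + 2 * (real Nc / \<upsilon> * \<tau>)" by (simp add: K_def algebra_simps)
    ultimately have K2: "2 \<le> K" using \<tau> by linarith
    have "a c c + S \<le> 2 * a q q + 2 * (Nc / \<upsilon> * \<tau> * a w w - a w w) + \<tau> * a w w"
      using c_bound v0_bound bound by (simp add: S_def)
    also have "\<dots> = 2 * a q q + K * a w w - 2 * a w w" by (simp add: K_def algebra_simps)
    also have "\<dots> \<le> K * a q q + K * a w w" using mult_right_mono[OF K2 nn(1)] nn(5) by linarith
    finally show ?thesis by (simp add: ax algebra_simps)
  qed
  finally have "(a x x)\<^sup>2 \<le> (a q q + energy x) * (K * a x x)"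
    using nn by (simp add: mult_left_mono)
  then have sq: "a x x * a x x \<le> (K * (energy x + a q q)) * a x x" by (simp add: power2_eq_square algebra_simps)
  have "0 \<le> K" using \<tau> \<upsilon> by (simp add: K_def)
  then show ?thesis
    unfolding q_def[symmetric] K_def[symmetric]
    using sq nn by (cases "a x x = 0") (auto simp: mult_le_cancel_right)
qed

section \<open>Spectra of the projected, hybrid and additive operators\<close>

lemma transpose_P_A:
  assumes x: "x \<in> carrier_vec n"
  shows "P\<^sup>T *\<^sub>v (A *\<^sub>v x) = A *\<^sub>v (P *\<^sub>v x)"
proof (rule vec_eq_scalar_prodI)
  have "P\<^sup>T \<in> carrier_mat n n" by simp
  then show "P\<^sup>T *\<^sub>v (A *\<^sub>v x) \<in> carrier_vec n" using x by (intro mult_mat_vec_carrier) auto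
  show "A *\<^sub>v (P *\<^sub>v x) \<in> carrier_vec n" using x by simp
  fix y :: "real vec" assume y: "y \<in> carrier_vec n"
  have "(P\<^sup>T *\<^sub>v (A *\<^sub>v x)) \<bullet> y = (A *\<^sub>v x) \<bullet> (P *\<^sub>v y)"
    by (rule transpose_move[OF Pc Av[OF x] y])
  also have "\<dots> = a (P *\<^sub>v y) x" unfolding bform_def by (rule comm_scalar_prod[OF Av[OF x] Pv[OF y]])
  also have "\<dots> = a y (P *\<^sub>v x)" by (rule a_P_right[OF y x, symmetric])
  also have "\<dots> = (A *\<^sub>v (P *\<^sub>v x)) \<bullet> y"
    unfolding bform_def by (rule comm_scalar_prod[OF y Av[OF Pv[OF x]]])
  finally show "(P\<^sup>T *\<^sub>v (A *\<^sub>v x)) \<bullet> y = (A *\<^sub>v (P *\<^sub>v x)) \<bullet> y" .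
qed

lemma null_zero: "x \<in> carrier_vec n \<Longrightarrow> a x x = 0 \<Longrightarrow> x = 0\<^sub>v n"
  using a_pos by force

lemma quotient_between:
  assumes "k \<in> \<real>" "0 < p" "Re k * p = e" "l * p \<le> e" "e \<le> u * p"
  shows "real_between l k u"
  using assms by (auto simp: real_between_def mult_le_cancel_right)

lemma zero_mult_vec: "M \<in> carrier_mat n n \<Longrightarrow> M *\<^sub>v 0\<^sub>v n = (0\<^sub>v n :: real vec)"
  by (intro eq_vecI) auto

lemma A_selfadjoint_eigenvector:
  assumes T: "T \<in> carrier_mat n n"
    and sym: "\<And>x y. x \<in> carrier_vec n \<Longrightarrow> y \<in> carrier_vec n \<Longrightarrow> a x (T *\<^sub>v y) = a y (T *\<^sub>v x)"
    and k: "k \<in> spectrum_of T"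
  obtains x where "k \<in> \<real>" "x \<in> carrier_vec n" "x \<noteq> 0\<^sub>v n" "T *\<^sub>v x = Re k \<cdot>\<^sub>v x"
proof -
  have adj: "a x (T *\<^sub>v y) = a (T *\<^sub>v x) y" if xy: "x \<in> carrier_vec n" "y \<in> carrier_vec n" for x y
    using sym[OF xy] a_sym[OF xy(2) mult_mat_vec_carrier[OF T xy(1)]] by simp
  have null: "T *\<^sub>v x = 0\<^sub>v n" if "x \<in> carrier_vec n" "a x x = 0" for x
    using null_zero[OF that] zero_mult_vec[OF T] by simp
  show ?thesis using selfadjoint_spectrum[OF spd_imp_psd[OF A] T adj null k] that by blast
qed

text \<open>\<open>H A P\<close> need not be self-adjoint for \<open>A\<close>, but it is for
  \<open>P^T A P\<close>, whose null vectors satisfy \<open>P x = 0\<close> and are mapped to zero.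
  An eigenvector with nonzero eigenvalue thus has \<open>w = P x\<close> nonzero, and the eigenvalue
  is the quotient of \<open>energy w\<close> and \<open>a w w\<close>.\<close>

theorem projected_bounds:
  assumes k: "k \<in> spectrum_of (H * A * P)" and "k \<noteq> 0"
  shows "real_between (1 / \<tau>) k (real Nc / \<upsilon>)"
proof -
  let ?T = "H * A * P" and ?G = "P\<^sup>T * A * P"
  have HA: "H * A \<in> carrier_mat n n" by (rule mult_carrier_mat[OF Hc Ac])
  have T: "?T \<in> carrier_mat n n" by (rule mult_carrier_mat[OF HA Pc])
  have Tx: "?T *\<^sub>v x = H *\<^sub>v (A *\<^sub>v (P *\<^sub>v x))" if x: "x \<in> carrier_vec n" for x
    using assoc_mult_mat_vec[OF HA Pc x] assoc_mult_mat_vec[OF Hc Ac Pv[OF x]] by simp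
  have Gxy: "bform ?G x y = a (P *\<^sub>v x) (P *\<^sub>v y)" if "x \<in> carrier_vec n" "y \<in> carrier_vec n" for x y
    by (rule bform_congruence[OF Ac Pc that])
  have GT: "bform ?G x (?T *\<^sub>v y) = a (P *\<^sub>v x) (H *\<^sub>v (A *\<^sub>v (P *\<^sub>v y)))" if xy: "x \<in> carrier_vec n" "y \<in> carrier_vec n" for x y
    using Gxy[of x "?T *\<^sub>v y"] a_P_left[of x "?T *\<^sub>v y"] Tx xy by simp
  have Gs: "psd_mat n ?G" by (rule psd_mat_congruence[OF spd_imp_psd[OF A] Pc])
  have adj: "bform ?G x (?T *\<^sub>v y) = bform ?G (?T *\<^sub>v x) y" if xy: "x \<in> carrier_vec n" "y \<in> carrier_vec n" for x y
    using GT[OF xy] GT[OF xy(2,1)] a_H_sym[of "P *\<^sub>v x" "P *\<^sub>v y"] xy bform_sym[OF psd_matD(1)[OF Gs], of "?T *\<^sub>v x" y] Tx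
    by simp
  have null: "?T *\<^sub>v x = 0\<^sub>v n" if x: "x \<in> carrier_vec n" and "bform ?G x x = 0" for x
    using null_zero[of "P *\<^sub>v x"] Gxy[OF x x] that Tx zero_mult_vec[OF Ac] zero_mult_vec[OF Hc] by simp
  obtain x where kr: "k \<in> \<real>" and x: "x \<in> carrier_vec n" "x \<noteq> 0\<^sub>v n" and ev: "?T *\<^sub>v x = Re k \<cdot>\<^sub>v x"
    using selfadjoint_spectrum[OF Gs T adj null k] by blast
  define w where "w = P *\<^sub>v x"
  have w: "w \<in> carrier_vec n" using x by (simp add: w_def)
  have "w \<noteq> 0\<^sub>v n"
  proof
    assume "w = 0\<^sub>v n"
    then have "Re k \<cdot>\<^sub>v x = 0\<^sub>v n"
      using ev Tx[OF x(1)] zero_mult_vec[OF Ac] zero_mult_vec[OF Hc] by (simp add: w_def)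
    then have "Re k * x $ i = 0" if "i < n" for i
      using arg_cong[of _ _ "\<lambda>v. v $ i"] that x(1) by (metis carrier_vecD index_smult_vec(1) index_zero_vec(1))
    moreover have "Re k \<noteq> 0" using kr \<open>k \<noteq> 0\<close> by (auto simp: complex_is_Real_iff complex_eq_iff)
    ultimately have "x = 0\<^sub>v n" using x(1) by (intro eq_vecI) auto
    then show False using x by simp
  qed
  then have pos: "0 < a w w" using a_pos w by simp
  have "Re k * a w w = energy w"
    using GT[OF x(1) x(1)] ev Gxy[OF x(1) x(1)] a_H[OF w w] x psd_matD(2)[OF Gs]
    by (simp add: w_def energy_def bform_smult_right[where m = n and k = n])
  then show ?thesis
    using energy_P_lower[OF x(1)] energy_P_upper[OF x(1)] \<tau> pos kr
    by (intro quotient_between[of k "a w w" "energy w"]) (auto simp: w_def field_simps)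
qed

text \<open>Testing the eigenvalue equation with the coarse part \<open>q\<close> of
  \<open>x\<close> gives \<open>a q q = Re k * a q q\<close>. Either the eigenvalue is 1, which lies
  between the bounds because \<open>1 < \<tau>\<close> and \<open>\<upsilon> < Nc\<close>, or
  \<open>x = P x\<close> and the bounds on the energy of projected vectors apply.\<close>

theorem hybrid_bounds:
  assumes k: "k \<in> spectrum_of (hybrid_preconditioner A H R0 * A)"
  shows "real_between (1 / \<tau>) k (real Nc / \<upsilon>)"
proof -
  let ?T = "hybrid_preconditioner A H R0 * A"
  have Pt: "P\<^sup>T \<in> carrier_mat n n" by simp
  have PH: "P * H \<in> carrier_mat n n" by (rule mult_carrier_mat[OF Pc Hc])
  have PHP: "P * H * P\<^sup>T \<in> carrier_mat n n" by (rule mult_carrier_mat[OF PH Pt])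
  have hc: "hybrid_preconditioner A H R0 \<in> carrier_mat n n"
    unfolding hybrid_preconditioner_def by (intro add_carrier_mat Qc)
  have T: "?T \<in> carrier_mat n n" by (rule mult_carrier_mat[OF hc Ac])
  have Tx: "?T *\<^sub>v x = P *\<^sub>v (H *\<^sub>v (A *\<^sub>v (P *\<^sub>v x))) + Q *\<^sub>v (A *\<^sub>v x)" if x: "x \<in> carrier_vec n" for x
  proof -
    have "?T *\<^sub>v x = (P * H * P\<^sup>T + Q) *\<^sub>v (A *\<^sub>v x)"
      using assoc_mult_mat_vec[OF hc Ac x] by (simp add: hybrid_preconditioner_def)
    also have "\<dots> = (P * H * P\<^sup>T) *\<^sub>v (A *\<^sub>v x) + Q *\<^sub>v (A *\<^sub>v x)"
      by (rule add_mult_distrib_mat_vec[OF PHP Qc Av[OF x]])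
    also have "(P * H * P\<^sup>T) *\<^sub>v (A *\<^sub>v x) = (P * H) *\<^sub>v (A *\<^sub>v (P *\<^sub>v x))"
      unfolding assoc_mult_mat_vec[OF PH Pt Av[OF x]] transpose_P_A[OF x] ..
    also have "\<dots> = P *\<^sub>v (H *\<^sub>v (A *\<^sub>v (P *\<^sub>v x)))"
      using x by (intro assoc_mult_mat_vec[OF Pc Hc]) simp
    finally show ?thesis .
  qed
  have aT: "a x (?T *\<^sub>v y) = a (P *\<^sub>v x) (H *\<^sub>v (A *\<^sub>v (P *\<^sub>v y))) + a (Q *\<^sub>v (A *\<^sub>v x)) (Q *\<^sub>v (A *\<^sub>v y))"
    if xy: "x \<in> carrier_vec n" "y \<in> carrier_vec n" for x y
    unfolding Tx[OF xy(2)] using xy a_Q[OF xy] a_P_right[of x "H *\<^sub>v (A *\<^sub>v (P *\<^sub>v y))"] by (simp add: a_linear)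
  have sym: "a x (?T *\<^sub>v y) = a y (?T *\<^sub>v x)" if xy: "x \<in> carrier_vec n" "y \<in> carrier_vec n" for x y
    unfolding aT[OF xy] aT[OF xy(2,1)]
    using a_H_sym[of "P *\<^sub>v x" "P *\<^sub>v y"] a_sym[of "Q *\<^sub>v (A *\<^sub>v x)" "Q *\<^sub>v (A *\<^sub>v y)"] xy by simp
  obtain x where kr: "k \<in> \<real>" and x: "x \<in> carrier_vec n" "x \<noteq> 0\<^sub>v n" and ev: "?T *\<^sub>v x = Re k \<cdot>\<^sub>v x"
    using A_selfadjoint_eigenvector[OF T sym k] by blast
  define q where "q = Q *\<^sub>v (A *\<^sub>v x)"
  have q: "q \<in> carrier_vec n" "q \<in> V0" using x by (auto simp: q_def intro: Q_V0)
  have aqP: "a q (P *\<^sub>v y) = 0" if "y \<in> carrier_vec n" for y by (rule a_V0_P[OF q(2) that])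
  have aqx: "a q x = a q q"
    using a_sym[OF q(1) x(1)] a_Q[OF x(1) x(1)] by (simp add: q_def)
  have "a q (?T *\<^sub>v x) = a q q"
    unfolding Tx[OF x(1)] using x q aqP[of "H *\<^sub>v (A *\<^sub>v (P *\<^sub>v x))"] by (simp add: a_linear q_def)
  then have "a q q = Re k * a q q" using ev q x aqx by (simp add: a_linear)
  then consider "Re k = 1" | "a q q = 0" by auto
  then show ?thesis
  proof cases
    case 1
    then show ?thesis using kr \<tau> \<upsilon> by (simp add: real_between_def)
  next
    case 2
    then have q0: "q = 0\<^sub>v n" using null_zero q by blast
    then have Px: "P *\<^sub>v x = x" using P_decomp[OF x(1)] x by (simp add: q_def)
    have "Re k * a x x = a x (?T *\<^sub>v x)" using ev x by (simp add: a_linear)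
    also have "\<dots> = energy x"
      unfolding aT[OF x(1) x(1)] Px a_H[OF x(1) x(1)] q_def[symmetric] 2 by (simp add: energy_def)
    finally show ?thesis
      using energy_P_lower[OF x(1)] energy_P_upper[OF x(1)] \<tau> a_pos[OF x] kr
      by (intro quotient_between[of k "a x x" "energy x"]) (auto simp: Px field_simps)
  qed
qed

text \<open>The eigenvalue times \<open>a x x\<close> is \<open>energy x + a q q\<close> with
  \<open>q\<close> the coarse part of \<open>x\<close>. The lower bound is
  \<open>additive_lower\<close>; in the upper bound, the 1 accounts for \<open>a q q\<close>, which
  is at most \<open>a x x\<close> by Pythagoras.\<close>

theorem additive_bounds:
  assumes k: "k \<in> spectrum_of (additive_preconditioner A H R0 * A)"
  shows "real_between (inverse ((1 + 2 * real Nc / \<upsilon>) * \<tau>)) k (real Nc / C_sharp + 1)"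
proof -
  let ?T = "additive_preconditioner A H R0 * A"
  have hc: "additive_preconditioner A H R0 \<in> carrier_mat n n"
    unfolding additive_preconditioner_def by (intro add_carrier_mat Qc)
  have T: "?T \<in> carrier_mat n n" by (rule mult_carrier_mat[OF hc Ac])
  have Tx: "?T *\<^sub>v x = H *\<^sub>v (A *\<^sub>v x) + Q *\<^sub>v (A *\<^sub>v x)" if x: "x \<in> carrier_vec n" for x
    using assoc_mult_mat_vec[OF hc Ac x] add_mult_distrib_mat_vec[OF Hc Qc Av[OF x]]
    by (simp add: additive_preconditioner_def)
  have aT: "a x (?T *\<^sub>v y) = a x (H *\<^sub>v (A *\<^sub>v y)) + a (Q *\<^sub>v (A *\<^sub>v x)) (Q *\<^sub>v (A *\<^sub>v y))"
    if xy: "x \<in> carrier_vec n" "y \<in> carrier_vec n" for x y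
    unfolding Tx[OF xy(2)] using xy a_Q[OF xy] by (simp add: a_linear)
  have sym: "a x (?T *\<^sub>v y) = a y (?T *\<^sub>v x)" if xy: "x \<in> carrier_vec n" "y \<in> carrier_vec n" for x y
    unfolding aT[OF xy] aT[OF xy(2,1)]
    using a_H_sym[OF xy] a_sym[of "Q *\<^sub>v (A *\<^sub>v x)" "Q *\<^sub>v (A *\<^sub>v y)"] xy by simp
  obtain x where kr: "k \<in> \<real>" and x: "x \<in> carrier_vec n" "x \<noteq> 0\<^sub>v n" and ev: "?T *\<^sub>v x = Re k \<cdot>\<^sub>v x"
    using A_selfadjoint_eigenvector[OF T sym k] by blast
  define q where "q = Q *\<^sub>v (A *\<^sub>v x)"
  have eq: "Re k * a x x = energy x + a q q"
    using aT[OF x(1) x(1)] ev x a_H[OF x(1) x(1)] by (simp add: a_linear q_def energy_def)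
  define K where "K = (1 + 2 * real Nc / \<upsilon>) * \<tau>"
  have K: "0 < K" unfolding K_def using \<tau> \<upsilon> by (intro mult_pos_pos add_pos_pos) auto
  have "a x x \<le> K * (energy x + a q q)" using additive_lower[OF x(1)] by (simp add: q_def K_def)
  then have lower: "inverse K * a x x \<le> energy x + a q q" using K by (simp add: field_simps)
  have "a q q \<le> a x x" using a_Pythagoras[OF x(1)] a_nonneg[OF Pv[OF x(1)]] by (simp add: q_def)
  then have upper: "energy x + a q q \<le> (real Nc / C_sharp + 1) * a x x"
    using energy_global_upper[OF x(1)] by (simp add: algebra_simps)
  show ?thesis
    unfolding K_def[symmetric] by (rule quotient_between[OF kr a_pos[OF x] eq lower upper])
qed

end

section \<open>Coarse spaces\<close>

lemma Y_L_carrier: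
  assumes "MA \<in> carrier_mat m m"
  shows "Y_L \<tau> MA MB \<subseteq> carrier_vec m"
proof -
  have "(\<Union>l\<in>{..<\<tau>}. generalized_eigenvectors l MA MB) \<subseteq> carrier_vec m"
    using assms by (auto simp: generalized_eigenvectors_def)
  from vec_span_carrier[OF this] show ?thesis using assms by (simp add: Y_L_def)
qed

lemma Y_H_carrier:
  assumes "MA \<in> carrier_mat m m"
  shows "Y_H \<tau> MA MB \<subseteq> carrier_vec m"
proof -
  have "(\<Union>l\<in>{\<tau>..}. generalized_eigenvectors l MA MB) \<subseteq> carrier_vec m"
    using assms by (auto simp: generalized_eigenvectors_def)
  from vec_span_carrier[OF this] show ?thesis using assms by (simp add: Y_H_def)
qed

lemma Y_L_zero: "MA \<in> carrier_mat m m \<Longrightarrow> 0\<^sub>v m \<in> Y_L \<tau> MA MB"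
  by (auto simp: Y_L_def vec_span_zero)

lemma Y_H_zero: "MA \<in> carrier_mat m m \<Longrightarrow> 0\<^sub>v m \<in> Y_H \<tau> MA MB"
  by (auto simp: Y_H_def vec_span_zero)

text \<open>In the splitting \<open>u = l + h\<close>, the low part satisfies
  \<open>bform MA l l = bform MA l u = 0\<close> and therefore vanishes; the high part obeys the
  inequality.\<close>

lemma orthogonal_to_Y_L:
  assumes MA: "spd_mat m MA" and MB: "spd_mat m MB" and u: "u \<in> carrier_vec m"
    and orth: "\<And>y. y \<in> Y_L \<tau> MA MB \<Longrightarrow> bform MA y u = 0"
  shows "\<tau> * bform MB u u \<le> bform MA u u"
proof -
  note c = spd_matD(2)[OF MA]
  obtain l h where l: "l \<in> Y_L \<tau> MA MB" "l \<in> carrier_vec m" and h: "h \<in> carrier_vec m" "u = l + h"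
    "bform MA l h = 0" and le: "\<tau> * bform MB h h \<le> bform MA h h"
    by (rule pencil_splitting[OF spd_matD(1)[OF MA] MB u, of \<tau>])
  have "bform MA l l = bform MA l u"
    using l h c by (simp add: bform_add_right[where m = m and k = m])
  then have "bform MA l l = 0" using orth[OF l(1)] by simp
  then have "l = 0\<^sub>v m" using spd_matD(3)[OF MA l(2)] by force
  then have "u = h" using h by simp
  then show ?thesis using le by simp
qed

text \<open>Two nested splittings. Modes of \<open>M\<close> against \<open>B\<close> below
  \<open>inverse \<tau>\<close> are given to the coarse space; on the rest, \<open>B\<close> is at
  most \<open>\<tau>\<close> times \<open>M\<close>. The modes of \<open>B\<close> against
  \<open>AL\<close> below \<open>\<upsilon>\<close> are then removed as well, and since this second
  splitting is \<open>B\<close>-orthogonal, the remaining piece is no more expensive.\<close>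

lemma stable_component_1:
  assumes B: "spd_mat m B" and AL: "spd_mat m AL" and M: "psd_mat m M" and d: "d \<in> carrier_vec m" and \<tau>: "0 < \<tau>"
  obtains z where "z \<in> carrier_vec m" "d - z \<in> Y_L \<upsilon> B AL + Y_L (inverse \<tau>) M B"
    "bform B z z \<le> \<tau> * bform M d d" "\<upsilon> * bform AL z z \<le> bform B z z"
proof -
  note Bc = spd_matD(2)[OF B] and Mc = psd_matD(2)[OF M]
  obtain l h where l: "l \<in> Y_L (inverse \<tau>) M B" "l \<in> carrier_vec m" and h: "h \<in> carrier_vec m" "d = l + h"
    "bform M l h = 0" and le: "inverse \<tau> * bform B h h \<le> bform M h h"
    by (rule pencil_splitting[OF psd_matD(1)[OF M] B d, of "inverse \<tau>"])
  obtain l2 z where l2: "l2 \<in> Y_L \<upsilon> B AL" "l2 \<in> carrier_vec m" and z: "z \<in> carrier_vec m" "h = l2 + z"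
    "bform B l2 z = 0" and le2: "\<upsilon> * bform AL z z \<le> bform B z z"
    by (rule pencil_splitting[OF spd_matD(1)[OF B] AL h(1), of \<upsilon>])
  have "bform M d d = bform M l l + bform M h h"
    using l h Mc bform_sym[OF psd_matD(1)[OF M] l(2) h(1)]
    by (simp add: bform_add_right[where m = m and k = m] bform_add_left[where m = m and k = m])
  then have Md: "bform M h h \<le> bform M d d" using psd_matD(3)[OF M l(2)] by simp
  have "bform B h h = bform B l2 l2 + bform B z z"
    using l2 z Bc bform_sym[OF spd_matD(1)[OF B] l2(2) z(1)]
    by (simp add: bform_add_right[where m = m and k = m] bform_add_left[where m = m and k = m])
  then have "bform B z z \<le> bform B h h" using psd_matD(3)[OF spd_imp_psd[OF B] l2(2)] by simp
  also have "\<dots> \<le> \<tau> * bform M h h" using le \<tau> by (simp add: field_simps)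
  also have "\<dots> \<le> \<tau> * bform M d d" using Md \<tau> by simp
  finally have 1: "bform B z z \<le> \<tau> * bform M d d" .
  have "d - z = l2 + l" unfolding h(2) z(2) using l l2 z by (intro eq_vecI) auto
  then have "d - z \<in> Y_L \<upsilon> B AL + Y_L (inverse \<tau>) M B" using l l2 by (auto intro: set_plus_intro)
  then show ?thesis using that z 1 le2 by blast
qed

text \<open>The range of a symmetric matrix is the orthogonal complement of its kernel. So a kernel
  vector in the range is zero, which makes \<open>W^T M W\<close> definite, and
  \<open>W W^T d\<close> differs from \<open>d\<close> by a kernel vector.\<close>

lemma range_kernel_split:
  assumes M: "psd_mat m M" and W: "orthonormal_basis_of_range W M" and r: "dim_col W = r"
  shows "spd_mat r (W\<^sup>T * M * W)"
    and "d \<in> carrier_vec m \<Longrightarrow> \<exists>k y. k \<in> mat_kernel M \<and> y \<in> carrier_vec r \<and> d = k + W *\<^sub>v y"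
proof -
  note Mc = psd_matD(2)[OF M]
  let ?Wt = "W\<^sup>T"
  have Wc: "W \<in> carrier_mat m r" and WW: "?Wt * W = 1\<^sub>m r" and span: "vec_span m (set (cols W)) = mat_range M"
    using W Mc r by (auto simp: orthonormal_basis_of_range_def)
  have Wt: "?Wt \<in> carrier_mat r m" using Wc by simp
  have range: "{W *\<^sub>v c | c. c \<in> carrier_vec r} = {M *\<^sub>v x | x. x \<in> carrier_vec m}"
    using span vec_span_cols[OF Wc] Mc by (simp add: mat_range_def)
  have WtW: "?Wt *\<^sub>v (W *\<^sub>v y) = y" if "y \<in> carrier_vec r" for y
    using assoc_mult_mat_vec[OF Wt Wc that] WW that by simp
  have ker: "M *\<^sub>v k = 0\<^sub>v m" if k: "k \<in> carrier_vec m" "?Wt *\<^sub>v k = 0\<^sub>v r" for k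
  proof (rule psd_mat_null[OF M k(1)])
    obtain c where c: "c \<in> carrier_vec r" "M *\<^sub>v k = W *\<^sub>v c" using range k(1) by blast
    have "bform M k k = k \<bullet> (W *\<^sub>v c)" by (simp add: bform_def c)
    also have "\<dots> = (?Wt *\<^sub>v k) \<bullet> c" by (rule transpose_move[OF Wc k(1) c(1), symmetric])
    also have "\<dots> = 0" using k c by simp
    finally show "bform M k k = 0" .
  qed
  have inj: "y = 0\<^sub>v r" if y: "y \<in> carrier_vec r" "M *\<^sub>v (W *\<^sub>v y) = 0\<^sub>v m" for y
  proof -
    obtain x where x: "x \<in> carrier_vec m" "W *\<^sub>v y = M *\<^sub>v x" using range y(1) by blast
    have Wy: "W *\<^sub>v y \<in> carrier_vec m" using Wc y by simp
    have "(W *\<^sub>v y) \<bullet> (W *\<^sub>v y) = bform M (W *\<^sub>v y) x" by (simp add: bform_def x)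
    also have "\<dots> = bform M x (W *\<^sub>v y)" by (rule bform_sym[OF psd_matD(1)[OF M] Wy x(1)])
    also have "\<dots> = 0" using y x by (simp add: bform_def)
    finally have "(W *\<^sub>v y) \<bullet> (W *\<^sub>v y) = 0" .
    then have "(?Wt *\<^sub>v (W *\<^sub>v y)) \<bullet> y = 0" using transpose_move[OF Wc Wy y(1)] by simp
    then have "y \<bullet> y = 0" using WtW[OF y(1)] by simp
    then have "(\<Sum>i<r. (y $ i)\<^sup>2) = 0" using y by (simp add: scalar_prod_def atLeast0LessThan power2_eq_square)
    then have "\<forall>i<r. y $ i = 0" by (subst (asm) sum_nonneg_eq_0_iff) auto
    then show ?thesis using y by (intro eq_vecI) auto
  qed
  have pos: "0 < bform (?Wt * M * W) y y" if y: "y \<in> carrier_vec r" "y \<noteq> 0\<^sub>v r" for y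
  proof -
    have Wy: "W *\<^sub>v y \<in> carrier_vec m" using Wc y by simp
    have "bform M (W *\<^sub>v y) (W *\<^sub>v y) \<noteq> 0" using psd_mat_null[OF M Wy] inj y by blast
    then show ?thesis using psd_matD(3)[OF M Wy] bform_congruence[OF Mc Wc y(1) y(1)] by simp
  qed
  show "spd_mat r (?Wt * M * W)"
    using sym_mat_congruence[OF psd_matD(1)[OF M] Wc] pos by (simp add: spd_mat_def)
  assume d: "d \<in> carrier_vec m"
  define y where "y = ?Wt *\<^sub>v d"
  have y: "y \<in> carrier_vec r" unfolding y_def by (rule mult_mat_vec_carrier[OF Wt d])
  have Wy: "W *\<^sub>v y \<in> carrier_vec m" using Wc y by simp
  have "?Wt *\<^sub>v (d - W *\<^sub>v y) = ?Wt *\<^sub>v d - ?Wt *\<^sub>v (W *\<^sub>v y)" by (rule mult_minus_distrib_mat_vec[OF Wt d Wy])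
  also have "\<dots> = 0\<^sub>v r" using WtW[OF y] y by (simp add: y_def)
  finally have "M *\<^sub>v (d - W *\<^sub>v y) = 0\<^sub>v m" using d Wy by (intro ker) auto
  then have "d - W *\<^sub>v y \<in> mat_kernel M" using d Wy Mc by (auto simp: mat_kernel_def)
  moreover have "d = (d - W *\<^sub>v y) + W *\<^sub>v y" using d Wy Wc by (intro eq_vecI) auto
  ultimately show "\<exists>k y. k \<in> mat_kernel M \<and> y \<in> carrier_vec r \<and> d = k + W *\<^sub>v y" using y by blast
qed

text \<open>The roles in the pencil are exchanged: \<open>B\<close> is measured against
  \<open>M\<close> on the range of \<open>M\<close>, where \<open>M\<close> is definite. Modes above
  \<open>\<tau>\<close> are the expensive ones and go to the coarse space, together with the kernel
  of \<open>M\<close>, on which the Neumann energy controls nothing. The low part is split once more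
  at \<open>\<upsilon>\<close>, orthogonally in \<open>B\<close>.\<close>

lemma stable_component_2:
  assumes B: "spd_mat m B" and AL: "spd_mat m AL" and M: "psd_mat m M" and d: "d \<in> carrier_vec m" and \<tau>: "0 < \<tau>"
    and W: "orthonormal_basis_of_range W M"
  obtains z where "z \<in> carrier_vec m"
    "d - z \<in> mat_kernel M + Y_L \<upsilon> B AL + (\<lambda>y. W *\<^sub>v y) ` Y_H \<tau> (W\<^sup>T * B * W) (W\<^sup>T * M * W)"
    "bform B z z \<le> \<tau> * bform M d d" "\<upsilon> * bform AL z z \<le> bform B z z"
proof -
  note Bc = spd_matD(2)[OF B] and Mc = psd_matD(2)[OF M]
  obtain r where r: "dim_col W = r" by simp
  have Wc: "W \<in> carrier_mat m r" using W Mc r by (auto simp: orthonormal_basis_of_range_def)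
  obtain k y where k: "k \<in> mat_kernel M" and y: "y \<in> carrier_vec r" and d_eq: "d = k + W *\<^sub>v y"
    using range_kernel_split(2)[OF M W r d] by blast
  have kc: "k \<in> carrier_vec m" and Mk: "M *\<^sub>v k = 0\<^sub>v m" using k Mc by (auto simp: mat_kernel_def)
  obtain yl yh where yl: "yl \<in> carrier_vec r"
    and yh: "yh \<in> Y_H \<tau> (W\<^sup>T * B * W) (W\<^sup>T * M * W)" "yh \<in> carrier_vec r"
    and yy: "y = yl + yh" and orth: "bform (W\<^sup>T * M * W) yl yh = 0"
    and le: "bform (W\<^sup>T * B * W) yl yl \<le> \<tau> * bform (W\<^sup>T * M * W) yl yl"
    by (rule pencil_splitting[OF sym_mat_congruence[OF spd_matD(1)[OF B] Wc] range_kernel_split(1)[OF M W r] y, of \<tau>])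
  define l h where "l = W *\<^sub>v yl" and "h = W *\<^sub>v yh"
  have lh: "l \<in> carrier_vec m" "h \<in> carrier_vec m" unfolding l_def h_def using Wc yl yh by auto
  have d2: "d = k + (l + h)"
    unfolding d_eq yy l_def h_def by (simp add: mult_add_distrib_mat_vec[OF Wc yl yh(2)])
  have Mlh: "bform M l h = 0" using orth bform_congruence[OF Mc Wc yl yh(2)] by (simp add: l_def h_def)
  have Bl: "bform B l l \<le> \<tau> * bform M l l"
    using le by (simp add: l_def bform_congruence[OF Mc Wc yl yl] bform_congruence[OF Bc Wc yl yl])
  have Mkx: "bform M x k = 0" if "x \<in> carrier_vec m" for x using that by (simp add: bform_def Mk)
  have Mkx': "bform M k x = 0" if "x \<in> carrier_vec m" for x
    using Mkx[OF that] bform_sym[OF psd_matD(1)[OF M] kc that] by simp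
  have "bform M d d = bform M l l + bform M h h"
    unfolding d2 using lh kc Mc Mkx Mkx' Mlh bform_sym[OF psd_matD(1)[OF M] lh(2,1)]
    by (simp add: bform_add_right[where m = m and k = m] bform_add_left[where m = m and k = m])
  then have Md: "bform M l l \<le> bform M d d" using psd_matD(3)[OF M lh(2)] by simp
  obtain l2 z where l2: "l2 \<in> Y_L \<upsilon> B AL" "l2 \<in> carrier_vec m" and z: "z \<in> carrier_vec m" "l = l2 + z"
    "bform B l2 z = 0" and le2: "\<upsilon> * bform AL z z \<le> bform B z z"
    by (rule pencil_splitting[OF spd_matD(1)[OF B] AL lh(1), of \<upsilon>])
  have "bform B l l = bform B l2 l2 + bform B z z"
    using l2 z Bc bform_sym[OF spd_matD(1)[OF B] l2(2) z(1)]
    by (simp add: bform_add_right[where m = m and k = m] bform_add_left[where m = m and k = m])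
  then have "bform B z z \<le> bform B l l" using psd_matD(3)[OF spd_imp_psd[OF B] l2(2)] by simp
  also have "\<dots> \<le> \<tau> * bform M d d" using order_trans[OF Bl mult_left_mono[OF Md, of \<tau>]] \<tau> by simp
  finally have 1: "bform B z z \<le> \<tau> * bform M d d" .
  have "d - z = k + l2 + W *\<^sub>v yh" unfolding d2 z(2) h_def[symmetric] using kc lh l2 z by (intro eq_vecI) auto
  then have "d - z \<in> mat_kernel M + Y_L \<upsilon> B AL + (\<lambda>y. W *\<^sub>v y) ` Y_H \<tau> (W\<^sup>T * B * W) (W\<^sup>T * M * W)"
    using k l2 yh by (auto intro!: set_plus_intro)
  then show ?thesis using that z 1 le2 by blast
qed

section \<open>Coarse spaces as sums of local contributions\<close>

lemma finsum_vec_eq_vsum: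
  assumes "finite I" "\<And>s. s \<in> I \<Longrightarrow> y s \<in> carrier_vec n"
  shows "finsum_vec TYPE(real) n y I = vsum n y I"
proof (rule eq_vecI)
  fix i assume "i < dim_vec (vsum n y I)"
  then show "finsum_vec TYPE(real) n y I $ i = vsum n y I $ i"
    using index_finsum_vec[OF assms(1), of i n y] assms(2) by auto
next
  have "finsum_vec TYPE(real) n y I \<in> carrier_vec n" using assms by (intro finsum_vec_closed) auto
  then show "dim_vec (finsum_vec TYPE(real) n y I) = dim_vec (vsum n y I)" by simp
qed

lemma vsum_in_sum_of_subspaces:
  assumes "finite I" "\<And>s. s \<in> I \<Longrightarrow> y s \<in> X s" "\<And>s. s \<in> I \<Longrightarrow> y s \<in> carrier_vec n"
  shows "vsum n y I \<in> sum_of_subspaces n X I"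
  unfolding sum_of_subspaces_def
  using finsum_vec_eq_vsum[OF assms(1,3)] assms(2) by (intro CollectI exI[of _ y]) auto

lemma sum_of_subspaces_superset:
  assumes I: "finite I" "s \<in> I" and v: "v \<in> X s" "v \<in> carrier_vec n" and zero: "\<And>t. t \<in> I \<Longrightarrow> 0\<^sub>v n \<in> X t"
  shows "v \<in> sum_of_subspaces n X I"
proof -
  define y where "y t = (if t = s then v else 0\<^sub>v n)" for t
  have "v = vsum n y I"
  proof (rule eq_vecI)
    fix i assume "i < dim_vec (vsum n y I)"
    then have i: "i < n" by simp
    have "(\<Sum>t\<in>I. y t $ i) = (\<Sum>t\<in>I. if t = s then v $ i else 0)" using i by (intro sum.cong) (auto simp: y_def)
    then show "v $ i = vsum n y I $ i" using i I by simp
  qed (use v in simp)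
  moreover have "vsum n y I \<in> sum_of_subspaces n X I"
    using I v zero by (intro vsum_in_sum_of_subspaces) (auto simp: y_def)
  ultimately show ?thesis by simp
qed

text \<open>What the finite element problem has to provide is collected as hypotheses on matrices.
  Two of them carry the lower bounds: by \<open>partition_of_unity\<close> the weighted restrictions
  extend back to \<open>x\<close>, and by \<open>energy\<close> their \<open>M s\<close>-energies
  sum to at most that of \<open>x\<close>.\<close>

theorem geneo_bounds:
  fixes R L M D W :: "nat \<Rightarrow> real mat" and A R0 :: "real mat"
  assumes A: "spd_mat n A"
    and R: "\<And>s. s \<in> {1..8} \<Longrightarrow> R s \<in> carrier_mat (m s) n"
    and R_inj: "\<And>s x. s \<in> {1..8} \<Longrightarrow> x \<in> carrier_vec (m s) \<Longrightarrow> (R s)\<^sup>T *\<^sub>v x = 0\<^sub>v n \<Longrightarrow> x = 0\<^sub>v (m s)"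
    and L: "\<And>s. s \<in> {1..8} \<Longrightarrow> spd_mat (m s) (L s * (L s)\<^sup>T)"
    and M: "\<And>s. s \<in> {1..8} \<Longrightarrow> psd_mat (m s) (M s)"
    and D: "\<And>s. s \<in> {1..8} \<Longrightarrow> D s \<in> carrier_mat (m s) (m s)"
    and partition_of_unity: "\<And>x. x \<in> carrier_vec n \<Longrightarrow>
      vsum n (\<lambda>s. (R s)\<^sup>T *\<^sub>v (D s *\<^sub>v (R s *\<^sub>v x))) {1..8} = x"
    and energy: "\<And>x. x \<in> carrier_vec n \<Longrightarrow>
      (\<Sum>s\<in>{1..8}. bform (M s) (D s *\<^sub>v (R s *\<^sub>v x)) (D s *\<^sub>v (R s *\<^sub>v x))) \<le> bform A x x"
    and Nc: "coloring_constant A R Nc"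
    and \<tau>: "1 < \<tau>" and \<upsilon>: "0 < \<upsilon>" "\<upsilon> < real Nc"
    and V0: "V0 = coarse_space_1 n A R L M \<tau> \<upsilon> \<or>
             ((\<forall>s\<in>{1..8}. orthonormal_basis_of_range (W s) (M s)) \<and> V0 = coarse_space_2 n A R L M W \<tau> \<upsilon>)"
    and R0: "rows_form_basis R0 n V0"
    and C_sharp: "0 < C_sharp"
      "\<And>s x. s \<in> {1..8} \<Longrightarrow> x \<in> carrier_vec (m s) \<Longrightarrow>
        bform (R s * A * (R s)\<^sup>T) x x \<le> inverse C_sharp * bform (L s * (L s)\<^sup>T) x x"
  shows "k \<in> spectrum_of (one_level_schwarz n R L * A * coarse_projection A R0) \<Longrightarrow> k \<noteq> 0 \<Longrightarrow>
      real_between (1 / \<tau>) k (real Nc / \<upsilon>)"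
    and "k \<in> spectrum_of (hybrid_preconditioner A (one_level_schwarz n R L) R0 * A) \<Longrightarrow>
      real_between (1 / \<tau>) k (real Nc / \<upsilon>)"
    and "k \<in> spectrum_of (additive_preconditioner A (one_level_schwarz n R L) R0 * A) \<Longrightarrow>
      real_between (inverse ((1 + 2 * real Nc / \<upsilon>) * \<tau>)) k (real Nc / C_sharp + 1)"
proof -
  let ?I = "{1..8::nat}"
  let ?B = "\<lambda>s. L s * (L s)\<^sup>T" and ?AL = "\<lambda>s. R s * A * (R s)\<^sup>T"
  note Bc = spd_matD(2)[OF L] and Mc = psd_matD(2)[OF M]
  have AL: "spd_mat (m s) (?AL s)" if s: "s \<in> ?I" for s
    using spd_mat_congruence[OF A, of "(R s)\<^sup>T" "m s"] R[OF s] R_inj[OF s] by simp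
  obtain r where r: "dim_row R0 = r" by simp
  have R0c: "R0 \<in> carrier_mat r n" and dist: "distinct (rows R0)"
    and li: "vec_lin_indpt n (set (rows R0))" and span: "vec_span n (set (rows R0)) = V0"
    using R0 r by (auto simp: rows_form_basis_def)
  have R0t: "R0\<^sup>T \<in> carrier_mat n r" using R0c by simp
  obtain C where C: "(\<Union>j\<in>{1..Nc}. C j) = ?I"
    "\<And>j s t. j \<in> {1..Nc} \<Longrightarrow> s \<in> C j \<Longrightarrow> t \<in> C j \<Longrightarrow> s \<noteq> t \<Longrightarrow>
      R s * A * (R t)\<^sup>T = 0\<^sub>m (dim_row (R s)) (dim_row (R t))"
    using that Nc unfolding coloring_constant_def by (elim exE conjE) metis
  \<comment> \<open>The color classes may overlap, so one class is picked for each
    subdomain.\<close>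
  define color where "color s = (SOME j. j \<in> {1..Nc} \<and> s \<in> C j)" for s
  have color: "color s \<in> {1..Nc} \<and> s \<in> C (color s)" if "s \<in> ?I" for s
    unfolding color_def by (rule someI_ex) (use that C(1) in blast)
  interpret two_level_schwarz n r Nc ?I m color A R0 R ?B
  proof
    show "color s \<in> {1..Nc}" if "s \<in> ?I" for s using color[OF that] by simp
    show "R s * A * (R t)\<^sup>T = 0\<^sub>m (m s) (m t)"
      if "s \<in> ?I" "t \<in> ?I" "s \<noteq> t" "color s = color t" for s t
    proof -
      have "dim_row (R s) = m s" "dim_row (R t) = m t" using R that carrier_matD by blast+
      then show ?thesis using C(2)[of "color s" s t] color that by metis
    qed
    show "c = 0\<^sub>v r" if "c \<in> carrier_vec r" "R0\<^sup>T *\<^sub>v c = 0\<^sub>v n" for c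
      using vec_lin_indpt_cols_inj[OF R0t _ _ that] dist li by simp
  qed (use A R L R0c in auto)
  have V0_eq: "V0 = local.V0"
    using vec_span_cols[OF R0t] span by (simp add: V0_def)
  have \<tau>0: "0 < \<tau>" using \<tau> by simp
  have H_eq: "one_level_schwarz n R L = H"
    unfolding one_level_schwarz_def H_def ..
  text \<open>Both coarse spaces are handled through their local contributions \<open>Z s\<close>.\<close>
  obtain Z where Z_V0: "V0 = sum_of_subspaces n (\<lambda>s. (\<lambda>x. (R s)\<^sup>T *\<^sub>v x) ` Z s) ?I"
    and Zc: "\<And>s. s \<in> ?I \<Longrightarrow> Z s \<subseteq> carrier_vec (m s)"
    and Z0: "\<And>s. s \<in> ?I \<Longrightarrow> 0\<^sub>v (m s) \<in> Z s"
    and ZY: "\<And>s. s \<in> ?I \<Longrightarrow> Y_L \<upsilon> (?B s) (?AL s) \<subseteq> Z s"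
    and Zs: "\<And>s d. s \<in> ?I \<Longrightarrow> d \<in> carrier_vec (m s) \<Longrightarrow> \<exists>z. z \<in> carrier_vec (m s) \<and> d - z \<in> Z s \<and>
      bform (?B s) z z \<le> \<tau> * bform (M s) d d \<and> \<upsilon> * bform (?AL s) z z \<le> bform (?B s) z z"
    using V0
  proof (elim disjE conjE)
    let ?Z = "\<lambda>s. Y_L \<upsilon> (?B s) (?AL s) + Y_L (inverse \<tau>) (M s) (?B s)"
    assume V: "V0 = coarse_space_1 n A R L M \<tau> \<upsilon>"
    show thesis
    proof (rule that[of ?Z])
      fix s assume s: "s \<in> ?I"
      note Yc = Y_L_carrier[OF Bc[OF s], of \<upsilon> "?AL s"] Y_L_carrier[OF Mc[OF s], of "inverse \<tau>" "?B s"]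
      note Y0 = Y_L_zero[OF Bc[OF s], of \<upsilon> "?AL s"] Y_L_zero[OF Mc[OF s], of "inverse \<tau>" "?B s"]
      show "?Z s \<subseteq> carrier_vec (m s)" using Yc by (blast elim!: set_plus_elim intro: add_carrier_vec)
      show "0\<^sub>v (m s) \<in> ?Z s" using set_plus_intro[OF Y0] by simp
      show "Y_L \<upsilon> (?B s) (?AL s) \<subseteq> ?Z s"
      proof
        fix y assume y: "y \<in> Y_L \<upsilon> (?B s) (?AL s)"
        then have "y = y + 0\<^sub>v (m s)" using Yc by auto
        then show "y \<in> ?Z s" using set_plus_intro[OF y Y0(2)] by simp
      qed
      fix d :: "real vec" assume d: "d \<in> carrier_vec (m s)"
      show "\<exists>z. z \<in> carrier_vec (m s) \<and> d - z \<in> ?Z s \<and>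
        bform (?B s) z z \<le> \<tau> * bform (M s) d d \<and> \<upsilon> * bform (?AL s) z z \<le> bform (?B s) z z"
        by (rule stable_component_1[OF L[OF s] AL[OF s] M[OF s] d \<tau>0, of \<upsilon>]) blast
    qed (simp add: V coarse_space_1_def)
  next
    let ?Y = "\<lambda>s. Y_H \<tau> ((W s)\<^sup>T * ?B s * W s) ((W s)\<^sup>T * M s * W s)"
    let ?Z = "\<lambda>s. mat_kernel (M s) + Y_L \<upsilon> (?B s) (?AL s) + (\<lambda>y. W s *\<^sub>v y) ` ?Y s"
    assume W: "\<forall>s\<in>?I. orthonormal_basis_of_range (W s) (M s)" and V: "V0 = coarse_space_2 n A R L M W \<tau> \<upsilon>"
    show thesis
    proof (rule that[of ?Z])
      fix s assume s: "s \<in> ?I"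
      obtain r where r: "dim_col (W s) = r" by simp
      have Wc: "W s \<in> carrier_mat (m s) r"
        using W s Mc[OF s] r by (auto simp: orthonormal_basis_of_range_def)
      have WBW: "(W s)\<^sup>T * ?B s * W s \<in> carrier_mat r r"
        using sym_matD[OF sym_mat_congruence[OF spd_matD(1)[OF L[OF s]] Wc]] .
      note Yc = Y_L_carrier[OF Bc[OF s], of \<upsilon> "?AL s"] Y_H_carrier[OF WBW, of \<tau> "(W s)\<^sup>T * M s * W s"]
        mat_kernel_carrier[OF Mc[OF s]]
      have WYc: "(\<lambda>y. W s *\<^sub>v y) ` ?Y s \<subseteq> carrier_vec (m s)" using Yc Wc by auto
      have k0: "0\<^sub>v (m s) \<in> mat_kernel (M s)" using Mc[OF s] by (auto simp: mat_kernel_def intro!: eq_vecI)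
      have Y0: "0\<^sub>v (m s) \<in> Y_L \<upsilon> (?B s) (?AL s)" by (rule Y_L_zero[OF Bc[OF s]])
      have "W s *\<^sub>v 0\<^sub>v r = 0\<^sub>v (m s)" using Wc by (auto intro!: eq_vecI)
      then have W0: "0\<^sub>v (m s) \<in> (\<lambda>y. W s *\<^sub>v y) ` ?Y s" using Y_H_zero[OF WBW] by (metis imageI)
      show "?Z s \<subseteq> carrier_vec (m s)"
      proof
        fix x assume "x \<in> ?Z s"
        then obtain u v w where "x = u + v + w" "u \<in> mat_kernel (M s)" "v \<in> Y_L \<upsilon> (?B s) (?AL s)" "w \<in> (\<lambda>y. W s *\<^sub>v y) ` ?Y s"
          by (elim set_plus_elim) blast
        then show "x \<in> carrier_vec (m s)" using Yc WYc by (blast intro: add_carrier_vec)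
      qed
      show "0\<^sub>v (m s) \<in> ?Z s" using set_plus_intro[OF set_plus_intro[OF k0 Y0] W0] by simp
      show "Y_L \<upsilon> (?B s) (?AL s) \<subseteq> ?Z s"
      proof
        fix y assume y: "y \<in> Y_L \<upsilon> (?B s) (?AL s)"
        then have "y = 0\<^sub>v (m s) + y + 0\<^sub>v (m s)" using Yc by auto
        then show "y \<in> ?Z s" using set_plus_intro[OF set_plus_intro[OF k0 y] W0] by metis
      qed
      fix d :: "real vec" assume d: "d \<in> carrier_vec (m s)"
      show "\<exists>z. z \<in> carrier_vec (m s) \<and> d - z \<in> ?Z s \<and>
        bform (?B s) z z \<le> \<tau> * bform (M s) d d \<and> \<upsilon> * bform (?AL s) z z \<le> bform (?B s) z z"
        by (rule stable_component_2[OF L[OF s] AL[OF s] M[OF s] d \<tau>0 bspec[OF W s], of \<upsilon>]) blast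
    qed (simp add: V coarse_space_2_def)
  qed
  have Rt0: "0\<^sub>v n \<in> (\<lambda>x. (R s)\<^sup>T *\<^sub>v x) ` Z s" if s: "s \<in> ?I" for s
  proof -
    have "(R s)\<^sup>T *\<^sub>v 0\<^sub>v (m s) = 0\<^sub>v n" using R[OF s] by (auto intro!: eq_vecI)
    then show ?thesis using Z0[OF s] by (metis imageI)
  qed
  have Z_in_V0: "(R s)\<^sup>T *\<^sub>v z \<in> V0" if s: "s \<in> ?I" and z: "z \<in> Z s" for s z
    unfolding Z_V0 using s z Rt0 Zc[OF s] Rt[OF s]
    by (intro sum_of_subspaces_superset[of _ s]) auto
  interpret geneo n r Nc ?I m color A R0 R ?B \<tau> \<upsilon> C_sharp
  proof
    fix w s assume w: "w \<in> carrier_vec n" and orth: "\<And>v. v \<in> local.V0 \<Longrightarrow> a v w = 0" and s: "s \<in> ?I"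
    show "\<upsilon> * bform (?AL s) (local_solution w s) (local_solution w s) \<le> bform (?B s) (local_solution w s) (local_solution w s)"
    proof (rule orthogonal_to_Y_L[OF L[OF s] AL[OF s] local_solution_carrier[OF s w]])
      fix y assume y: "y \<in> Y_L \<upsilon> (?B s) (?AL s)"
      then have yc: "y \<in> carrier_vec (m s)" using Y_L_carrier[OF Bc[OF s]] by blast
      \<comment> \<open>\<open>B s\<close> turns the local solution back into the local residual, so
        that \<open>A\<close>-orthogonality of \<open>w\<close> to the extended low modes is
        \<open>B s\<close>-orthogonality of the local solution to the modes themselves.\<close>
      have "bform (?B s) y (local_solution w s) = y \<bullet> (R s *\<^sub>v (A *\<^sub>v w))"
        by (simp add: bform_def B_local_solution[OF s w])
      also have "\<dots> = a ((R s)\<^sup>T *\<^sub>v y) w"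
        unfolding bform_def by (rule transpose_move[OF R[OF s] yc Av[OF w], symmetric])
      also have "\<dots> = 0" using orth Z_in_V0[OF s] ZY[OF s] y V0_eq by blast
      finally show "bform (?B s) y (local_solution w s) = 0" .
    qed
  next
    fix x :: "real vec" assume x: "x \<in> carrier_vec n"
    define d where "d s = D s *\<^sub>v (R s *\<^sub>v x)" for s
    have d: "d s \<in> carrier_vec (m s)" if "s \<in> ?I" for s
      unfolding d_def by (rule mult_mat_vec_carrier[OF D[OF that] mult_mat_vec_carrier[OF R[OF that] x]])
    have "\<forall>s\<in>?I. \<exists>z. z \<in> carrier_vec (m s) \<and> d s - z \<in> Z s \<and>
      bform (?B s) z z \<le> \<tau> * bform (M s) (d s) (d s) \<and> \<upsilon> * bform (?AL s) z z \<le> bform (?B s) z z"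
      using Zs d by blast
    then obtain z where z: "\<And>s. s \<in> ?I \<Longrightarrow> z s \<in> carrier_vec (m s)" "\<And>s. s \<in> ?I \<Longrightarrow> d s - z s \<in> Z s"
      "\<And>s. s \<in> ?I \<Longrightarrow> bform (?B s) (z s) (z s) \<le> \<tau> * bform (M s) (d s) (d s)"
      "\<And>s. s \<in> ?I \<Longrightarrow> \<upsilon> * bform (?AL s) (z s) (z s) \<le> bform (?B s) (z s) (z s)"
      by metis
    \<comment> \<open>By the partition of unity, \<open>x\<close> is the extension of the family
      \<open>d\<close>; the difference is therefore the extension of \<open>d s - z s\<close>, which
      lies in \<open>Z s\<close> for each \<open>s\<close>.\<close>
    have "x - ext z = vsum n (\<lambda>s. (R s)\<^sup>T *\<^sub>v (d s - z s)) ?I"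
    proof (rule eq_vecI)
      fix i assume "i < dim_vec (vsum n (\<lambda>s. (R s)\<^sup>T *\<^sub>v (d s - z s)) ?I)"
      then have i: "i < n" by simp
      have "((R s)\<^sup>T *\<^sub>v (d s - z s)) $ i = ((R s)\<^sup>T *\<^sub>v d s) $ i - ((R s)\<^sup>T *\<^sub>v z s) $ i"
        if s: "s \<in> ?I" for s
      proof -
        have Rts: "(R s)\<^sup>T \<in> carrier_mat n (m s)" using R[OF s] by simp
        have "dim_vec ((R s)\<^sup>T *\<^sub>v z s) = n" using Rts by simp
        then show ?thesis
          unfolding mult_minus_distrib_mat_vec[OF Rts d[OF s] z(1)[OF s]] using i by simp
      qed
      then have "vsum n (\<lambda>s. (R s)\<^sup>T *\<^sub>v (d s - z s)) ?I $ i =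
          vsum n (\<lambda>s. (R s)\<^sup>T *\<^sub>v d s) ?I $ i - ext z $ i"
        using i by (simp add: ext_def sum_subtractf del: One_nat_def)
      then show "(x - ext z) $ i = vsum n (\<lambda>s. (R s)\<^sup>T *\<^sub>v (d s - z s)) ?I $ i"
        using partition_of_unity[OF x] i by (simp add: d_def ext_def del: One_nat_def)
    qed (simp add: ext_def del: One_nat_def)
    also have "\<dots> \<in> V0"
      unfolding Z_V0 using z d Rt by (intro vsum_in_sum_of_subspaces) auto
    finally have 1: "x - ext z \<in> local.V0" using V0_eq by simp
    have "(\<Sum>s\<in>?I. bform (?B s) (z s) (z s)) \<le> (\<Sum>s\<in>?I. \<tau> * bform (M s) (d s) (d s))"
      by (rule sum_mono[OF z(3)])
    also have "\<dots> = \<tau> * (\<Sum>s\<in>?I. bform (M s) (d s) (d s))" by (rule sum_distrib_left[symmetric])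
    also have "\<dots> \<le> \<tau> * a x x" using energy[OF x] \<tau> by (intro mult_left_mono) (auto simp: d_def)
    finally have 2: "(\<Sum>s\<in>?I. bform (?B s) (z s) (z s)) \<le> \<tau> * a x x" .
    show "\<exists>z. (\<forall>s\<in>?I. z s \<in> carrier_vec (m s)) \<and> x - ext z \<in> local.V0 \<and>
      (\<Sum>s\<in>?I. bform (?B s) (z s) (z s)) \<le> \<tau> * a x x \<and>
      (\<forall>s\<in>?I. \<upsilon> * bform (?AL s) (z s) (z s) \<le> bform (?B s) (z s) (z s))"
      using z 1 2 by blast
  qed (use \<tau> \<upsilon> C_sharp in auto)
  show "k \<in> spectrum_of (one_level_schwarz n R L * A * coarse_projection A R0) \<Longrightarrow> k \<noteq> 0 \<Longrightarrow>
      real_between (1 / \<tau>) k (real Nc / \<upsilon>)"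
    using projected_bounds H_eq by simp
  show "k \<in> spectrum_of (hybrid_preconditioner A (one_level_schwarz n R L) R0 * A) \<Longrightarrow>
      real_between (1 / \<tau>) k (real Nc / \<upsilon>)"
    using hybrid_bounds H_eq by simp
  show "k \<in> spectrum_of (additive_preconditioner A (one_level_schwarz n R L) R0 * A) \<Longrightarrow>
      real_between (inverse ((1 + 2 * real Nc / \<upsilon>) * \<tau>)) k (real Nc / C_sharp + 1)"
    using additive_bounds H_eq by simp
qed

section \<open>The mesh\<close>

text \<open>Cramer's rule for the barycentric coordinates with respect to the two edges at the base
  point; the determinant is twice the signed area.\<close>

lemma convex_hull_triangle:
  fixes x0 y0 a1 a2 b1 b2 :: real
  assumes "a1 * b2 - a2 * b1 \<noteq> 0"
  shows "convex hull {(x0, y0), (x0 + a1, y0 + a2), (x0 + b1, y0 + b2)} =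
    {(x, y). 0 \<le> (b2 * (x - x0) - b1 * (y - y0)) / (a1 * b2 - a2 * b1) \<and>
      0 \<le> (a1 * (y - y0) - a2 * (x - x0)) / (a1 * b2 - a2 * b1) \<and>
      (b2 * (x - x0) - b1 * (y - y0)) / (a1 * b2 - a2 * b1) + (a1 * (y - y0) - a2 * (x - x0)) / (a1 * b2 - a2 * b1) \<le> 1}"
proof -
  let ?d = "a1 * b2 - a2 * b1"
  have *: "(x, y) = (x0, y0) + u *\<^sub>R ((x0 + a1, y0 + a2) - (x0, y0)) + v *\<^sub>R ((x0 + b1, y0 + b2) - (x0, y0)) \<longleftrightarrow>
      u = (b2 * (x - x0) - b1 * (y - y0)) / ?d \<and> v = (a1 * (y - y0) - a2 * (x - x0)) / ?d" (is "?L \<longleftrightarrow> ?R") for x y u v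
  proof
    assume ?L
    then have e: "x - x0 = u * a1 + v * b1" "y - y0 = u * a2 + v * b2" by simp_all
    have "u * ?d = b2 * (x - x0) - b1 * (y - y0)" "v * ?d = a1 * (y - y0) - a2 * (x - x0)"
      unfolding e by (simp_all add: algebra_simps)
    then show ?R using nonzero_eq_divide_eq[OF assms] by blast
  next
    assume ?R
    then have e: "u * ?d = b2 * (x - x0) - b1 * (y - y0)" "v * ?d = a1 * (y - y0) - a2 * (x - x0)"
      using nonzero_eq_divide_eq[OF assms] by blast+
    have "?d * (u * a1 + v * b1) = a1 * (u * ?d) + b1 * (v * ?d)" "?d * (u * a2 + v * b2) = a2 * (u * ?d) + b2 * (v * ?d)"
      by (simp_all add: algebra_simps)
    then have "?d * (u * a1 + v * b1) = ?d * (x - x0)" "?d * (u * a2 + v * b2) = ?d * (y - y0)"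
      unfolding e by (simp_all add: algebra_simps)
    then have "u * a1 + v * b1 = x - x0" "u * a2 + v * b2 = y - y0" using assms mult_left_cancel by blast+
    then show ?L by (simp add: algebra_simps)
  qed
  show ?thesis (is "?H = ?S")
  proof (rule Set.set_eqI)
    fix z :: "real \<times> real"
    obtain x y where z: "z = (x, y)" by (cases z)
    show "z \<in> ?H \<longleftrightarrow> z \<in> ?S" unfolding z convex_hull_3_alt mem_Collect_eq * by auto
  qed
qed

lemma cell_triangles_eq:
  "cell_triangles True i j =
    {{(x, y). real j / 42 \<le> y \<and> x \<le> real i / 42 + 1 / 42 \<and> y - real j / 42 \<le> x - real i / 42},
     {(x, y). real i / 42 \<le> x \<and> y \<le> real j / 42 + 1 / 42 \<and> x - real i / 42 \<le> y - real j / 42}}"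
  "cell_triangles False i j =
    {{(x, y). real i / 42 \<le> x \<and> real j / 42 \<le> y \<and> (x - real i / 42) + (y - real j / 42) \<le> 1 / 42},
     {(x, y). x \<le> real i / 42 + 1 / 42 \<and> y \<le> real j / 42 + 1 / 42 \<and> 1 / 42 \<le> (x - real i / 42) + (y - real j / 42)}}"
proof -
  define x0 y0 where "x0 = real i / 42" and "y0 = real j / 42"
  have g: "grid_point i j = (x0, y0)" "grid_point (i+1) j = (x0 + 1/42, y0)" "grid_point i (j+1) = (x0, y0 + 1/42)"
    "grid_point (i+1) (j+1) = (x0 + 1/42, y0 + 1/42)"
    by (simp_all add: grid_point_def x0_def y0_def add_divide_distrib)
  \<comment> \<open>The positional arguments follow the determinant in the hypothesis:
    \<open>a1\<close>, \<open>b2\<close>, \<open>a2\<close>, \<open>b1\<close>, and the base point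
    last.\<close>
  have "convex hull {(x0, y0), (x0 + 1/42, y0), (x0 + 1/42, y0 + 1/42)} = {(x, y). y0 \<le> y \<and> x \<le> x0 + 1/42 \<and> y - y0 \<le> x - x0}"
    using convex_hull_triangle[of "1/42" "1/42" 0 "1/42" x0 y0] by (auto simp: field_simps)
  moreover have "convex hull {(x0, y0), (x0, y0 + 1/42), (x0 + 1/42, y0 + 1/42)} = {(x, y). x0 \<le> x \<and> y \<le> y0 + 1/42 \<and> x - x0 \<le> y - y0}"
    using convex_hull_triangle[of 0 "1/42" "1/42" "1/42" x0 y0] by (auto simp: field_simps)
  ultimately show "cell_triangles True i j =
    {{(x, y). real j / 42 \<le> y \<and> x \<le> real i / 42 + 1 / 42 \<and> y - real j / 42 \<le> x - real i / 42},
     {(x, y). real i / 42 \<le> x \<and> y \<le> real j / 42 + 1 / 42 \<and> x - real i / 42 \<le> y - real j / 42}}"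
    unfolding cell_triangles_def if_True g by (simp only: x0_def y0_def)
  have "convex hull {(x0, y0), (x0 + 1/42, y0), (x0, y0 + 1/42)} = {(x, y). x0 \<le> x \<and> y0 \<le> y \<and> (x - x0) + (y - y0) \<le> 1/42}"
    using convex_hull_triangle[of "1/42" "1/42" 0 0 x0 y0] by (auto simp: field_simps)
  moreover have "convex hull {(x0 + 1/42, y0), (x0, y0 + 1/42), (x0 + 1/42, y0 + 1/42)} = {(x, y). x \<le> x0 + 1/42 \<and> y \<le> y0 + 1/42 \<and> 1/42 \<le> (x - x0) + (y - y0)}"
    using convex_hull_triangle[of "-1/42" "1/42" "1/42" 0 "x0 + 1/42" y0] by (auto simp: field_simps)
  ultimately show "cell_triangles False i j =
    {{(x, y). real i / 42 \<le> x \<and> real j / 42 \<le> y \<and> (x - real i / 42) + (y - real j / 42) \<le> 1 / 42},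
     {(x, y). x \<le> real i / 42 + 1 / 42 \<and> y \<le> real j / 42 + 1 / 42 \<and> 1 / 42 \<le> (x - real i / 42) + (y - real j / 42)}}"
    unfolding cell_triangles_def if_False g by (simp only: x0_def y0_def)
qed

lemma finite_mesh: "finite (mesh asc)"
  unfolding mesh_def cell_triangles_def by auto

lemma mesh_cell:
  assumes "T \<in> mesh asc"
  obtains i j where "i < 84" "j < 42" "T \<in> cell_triangles asc i j"
  using assms unfolding mesh_def by blast

lemma grid_point_in_mesh_nodes: "i \<le> 84 \<Longrightarrow> j \<le> 42 \<Longrightarrow> grid_point i j \<in> mesh_nodes"
  by (auto simp: mesh_nodes_def)

lemma mesh_triangle:
  assumes "T \<in> mesh asc"
  obtains p q r where "T = convex hull {p, q, r}" "p \<in> mesh_nodes" "q \<in> mesh_nodes" "r \<in> mesh_nodes"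
    "p \<noteq> q" "q \<noteq> r" "p \<noteq> r"
proof -
  obtain i j where ij: "i < 84" "j < 42" "T \<in> cell_triangles asc i j" using assms by (rule mesh_cell)
  have nodes: "grid_point i j \<in> mesh_nodes" "grid_point (i+1) j \<in> mesh_nodes" "grid_point i (j+1) \<in> mesh_nodes"
    "grid_point (i+1) (j+1) \<in> mesh_nodes"
    using ij(1,2) by (auto intro!: grid_point_in_mesh_nodes)
  have dist: "grid_point i j \<noteq> grid_point (i+1) j" "grid_point i j \<noteq> grid_point i (j+1)" "grid_point i j \<noteq> grid_point (i+1) (j+1)"
    "grid_point (i+1) j \<noteq> grid_point i (j+1)" "grid_point (i+1) j \<noteq> grid_point (i+1) (j+1)" "grid_point i (j+1) \<noteq> grid_point (i+1) (j+1)"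
    by (auto simp: grid_point_def)
  show ?thesis
    using ij(3) that nodes dist unfolding cell_triangles_def by (cases asc) (simp_all, metis+)
qed

lemma compact_convex_triangle:
  assumes "T \<in> mesh asc"
  shows "compact T" "convex T"
proof -
  obtain p q r where T: "T = convex hull {p, q, r}" using assms by (rule mesh_triangle)
  show "compact T" unfolding T by (intro finite_imp_compact_convex_hull) simp
  show "convex T" unfolding T by (rule convex_convex_hull)
qed

text \<open>The strict versions of the three defining inequalities cut out an open subset that
  contains the centroid, which is the origin of \<open>126 = 3 * 42\<close>. Interior points
  determine the linear part of a field on \<open>T\<close>, and they make the area of
  \<open>T\<close> positive.\<close>

lemma interior_triangle:
  assumes "T \<in> mesh asc"
  shows "interior T \<noteq> {}"
proof -
  obtain i j where ij: "i < 84" "j < 42" "T \<in> cell_triangles asc i j" using assms by (rule mesh_cell)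
  define x0 y0 where "x0 = real i / 42" and "y0 = real j / 42"
  have *: "interior T \<noteq> {}" if "U \<subseteq> T" "open U" "z \<in> U" for U z
    using that interior_maximal by blast
  let ?o = "\<lambda>f g h. {z :: pt. f z < 0 \<and> g z < 0 \<and> h z < (0::real)}"
  have op: "open (?o f g h)" if "continuous_on UNIV f" "continuous_on UNIV g" "continuous_on UNIV h" for f g h :: "pt \<Rightarrow> real"
    using that by (intro open_Collect_conj open_Collect_less continuous_intros)
  show ?thesis
  proof (cases asc)
    case True
    then consider "T = {(x, y). y0 \<le> y \<and> x \<le> x0 + 1 / 42 \<and> y - y0 \<le> x - x0}"
      | "T = {(x, y). x0 \<le> x \<and> y \<le> y0 + 1 / 42 \<and> x - x0 \<le> y - y0}"
      using ij(3) by (auto simp: cell_triangles_eq x0_def y0_def)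
    then show ?thesis
    proof cases
      case 1
      then show ?thesis
        by (intro *[of "?o (\<lambda>z. y0 - snd z) (\<lambda>z. fst z - x0 - 1/42) (\<lambda>z. snd z - y0 - (fst z - x0))" "(x0 + 2/126, y0 + 1/126)"] op)
          (auto intro!: continuous_intros)
    next
      case 2
      then show ?thesis
        by (intro *[of "?o (\<lambda>z. x0 - fst z) (\<lambda>z. snd z - y0 - 1/42) (\<lambda>z. fst z - x0 - (snd z - y0))" "(x0 + 1/126, y0 + 2/126)"] op)
          (auto intro!: continuous_intros)
    qed
  next
    case False
    then consider "T = {(x, y). x0 \<le> x \<and> y0 \<le> y \<and> (x - x0) + (y - y0) \<le> 1 / 42}"
      | "T = {(x, y). x \<le> x0 + 1 / 42 \<and> y \<le> y0 + 1 / 42 \<and> 1 / 42 \<le> (x - x0) + (y - y0)}"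
      using ij(3) by (auto simp: cell_triangles_eq x0_def y0_def)
    then show ?thesis
    proof cases
      case 1
      then show ?thesis
        by (intro *[of "?o (\<lambda>z. x0 - fst z) (\<lambda>z. y0 - snd z) (\<lambda>z. fst z - x0 + (snd z - y0) - 1/42)" "(x0 + 1/126, y0 + 1/126)"] op)
          (auto intro!: continuous_intros)
    next
      case 2
      then show ?thesis
        by (intro *[of "?o (\<lambda>z. fst z - x0 - 1/42) (\<lambda>z. snd z - y0 - 1/42) (\<lambda>z. 1/42 - (fst z - x0 + (snd z - y0)))" "(x0 + 2/126, y0 + 2/126)"] op)
          (auto intro!: continuous_intros)
    qed
  qed
qed

lemma triangle_in_cell:
  assumes "T \<in> cell_triangles asc i j" "z \<in> T"
  shows "real i / 42 \<le> fst z" "fst z \<le> real i / 42 + 1 / 42" "real j / 42 \<le> snd z" "snd z \<le> real j / 42 + 1 / 42"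
  using assms by (cases asc; auto simp: cell_triangles_eq)+

lemma negligible_line:
  fixes c1 c2 b :: real
  assumes "c1 \<noteq> 0 \<or> c2 \<noteq> 0"
  shows "negligible {z :: pt. c1 * fst z + c2 * snd z = b}"
proof -
  have "negligible {z :: pt. inner (c1, c2) z = b}"
    using assms by (intro negligible_hyperplane) (auto simp: zero_prod_def)
  then show ?thesis by (simp add: inner_prod_def)
qed

lemma cell_triangles_overlap:
  assumes "T \<in> cell_triangles asc i j" "T' \<in> cell_triangles asc i j" "T \<noteq> T'"
  shows "negligible (T \<inter> T')"
proof (cases asc)
  case True
  then have "T \<inter> T' \<subseteq> {z. 1 * fst z + (- 1) * snd z = real i / 42 - real j / 42}"
    using assms by (auto simp: cell_triangles_eq)
  then show ?thesis by (rule negligible_subset[rotated]) (rule negligible_line, simp)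
next
  case False
  then have "T \<inter> T' \<subseteq> {z. 1 * fst z + 1 * snd z = real i / 42 + real j / 42 + 1 / 42}"
    using assms by (auto simp: cell_triangles_eq)
  then show ?thesis by (rule negligible_subset[rotated]) (rule negligible_line, simp)
qed

text \<open>Triangles of different cells can meet only on a grid line between the cells, triangles
  of the same cell only on its diagonal. This makes integrals over the mesh additive.\<close>

lemma mesh_overlap:
  assumes T: "T \<in> mesh asc" and T': "T' \<in> mesh asc" and "T \<noteq> T'"
  shows "negligible (T \<inter> T')"
proof -
  obtain i j where ij: "T \<in> cell_triangles asc i j" using T by (rule mesh_cell)
  obtain k l where kl: "T' \<in> cell_triangles asc k l" using T' by (rule mesh_cell)
  note b = triangle_in_cell[OF ij] triangle_in_cell[OF kl]
  have le: "real (Suc m) / 42 \<le> real n / 42" if "m < n" for m n using that by (intro divide_right_mono) auto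
  consider "i < k" | "k < i" | "j < l" | "l < j" | "i = k" "j = l" by linarith
  then show ?thesis
  proof cases
    case 1
    have "T \<inter> T' \<subseteq> {z. 1 * fst z + 0 * snd z = real k / 42}"
      using b(2,5) le[OF 1] by (force simp: add_divide_distrib)
    then show ?thesis by (rule negligible_subset[rotated]) (rule negligible_line, simp)
  next
    case 2
    have "T \<inter> T' \<subseteq> {z. 1 * fst z + 0 * snd z = real i / 42}"
      using b(1,6) le[OF 2] by (force simp: add_divide_distrib)
    then show ?thesis by (rule negligible_subset[rotated]) (rule negligible_line, simp)
  next
    case 3
    have "T \<inter> T' \<subseteq> {z. 0 * fst z + 1 * snd z = real l / 42}"
      using b(4,7) le[OF 3] by (force simp: add_divide_distrib)
    then show ?thesis by (rule negligible_subset[rotated]) (rule negligible_line, simp)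
  next
    case 4
    have "T \<inter> T' \<subseteq> {z. 0 * fst z + 1 * snd z = real j / 42}"
      using b(3,8) le[OF 4] by (force simp: add_divide_distrib)
    then show ?thesis by (rule negligible_subset[rotated]) (rule negligible_line, simp)
  next
    case 5
    then show ?thesis using cell_triangles_overlap ij kl assms(3) by blast
  qed
qed

lemma grid_index:
  fixes x :: real
  assumes "0 \<le> x" "x \<le> real N / 42" "0 < N"
  obtains i where "i < N" "real i / 42 \<le> x" "x \<le> real i / 42 + 1 / 42"
proof (cases "x = real N / 42")
  \<comment> \<open>At the right end the floor would give \<open>N\<close>, one past the last cell,
    so the last cell is chosen by hand.\<close>
  case True
  have "real (N - 1) / 42 + 1 / 42 = real N / 42" using assms(3) by (simp add: of_nat_diff field_simps)
  then show ?thesis using that[of "N - 1"] assms True by (simp add: of_nat_diff field_simps)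
next
  case False
  define i where "i = nat \<lfloor>42 * x\<rfloor>"
  have i: "real i = of_int \<lfloor>42 * x\<rfloor>" using assms by (simp add: i_def)
  have "real i \<le> 42 * x" "42 * x < real i + 1" unfolding i by linarith+
  moreover have "x < real N / 42" using assms False by simp
  then have "real i < real N" using \<open>real i \<le> 42 * x\<close> by simp
  ultimately show ?thesis using that[of i] by (simp add: field_simps)
qed

lemma Union_mesh: "\<Union>(mesh asc) = Omega"
proof (intro subset_antisym subsetI)
  fix z assume "z \<in> \<Union>(mesh asc)"
  then obtain T where T: "T \<in> mesh asc" "z \<in> T" by blast
  obtain i j where ij: "i < 84" "j < 42" "T \<in> cell_triangles asc i j" using T(1) by (rule mesh_cell)
  have "0 \<le> real i / 42" "0 \<le> real j / 42" "real i / 42 + 1 / 42 \<le> 2" "real j / 42 + 1 / 42 \<le> 1"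
    using ij(1,2) by (auto simp: field_simps)
  then show "z \<in> Omega" using triangle_in_cell[OF ij(3) T(2)] by (cases z) (auto simp: Omega_def)
next
  fix z assume z: "z \<in> Omega"
  have b: "0 \<le> fst z" "fst z \<le> real 84 / 42" "0 \<le> snd z" "snd z \<le> real 42 / 42"
    using z by (auto simp: Omega_def)
  obtain i where i: "i < 84" "real i / 42 \<le> fst z" "fst z \<le> real i / 42 + 1 / 42"
    by (rule grid_index[OF b(1,2)]) auto
  obtain j where j: "j < 42" "real j / 42 \<le> snd z" "snd z \<le> real j / 42 + 1 / 42"
    by (rule grid_index[OF b(3,4)]) auto
  have "z \<in> \<Union>(cell_triangles asc i j)"
    using i j by (cases asc; cases z) (auto simp: cell_triangles_eq)
  then show "z \<in> \<Union>(mesh asc)" using i(1) j(1) unfolding mesh_def by blast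
qed

section \<open>Piecewise linear fields\<close>

definition linear_part :: "(pt \<Rightarrow> pt) \<Rightarrow> pt set \<Rightarrow> pt \<Rightarrow> pt" where
  "linear_part v T = (SOME f. linear f \<and> (\<exists>c. \<forall>x\<in>T. v x = f x + c))"

lemma linear_part:
  assumes "v \<in> P1_space asc" "T \<in> mesh asc"
  shows "linear (linear_part v T)" "\<exists>c. \<forall>x\<in>T. v x = linear_part v T x + c"
proof -
  have "\<exists>f. linear f \<and> (\<exists>c. \<forall>x\<in>T. v x = f x + c)" using assms by (auto simp: P1_space_def)
  then have "linear (linear_part v T) \<and> (\<exists>c. \<forall>x\<in>T. v x = linear_part v T x + c)"
    unfolding linear_part_def by (rule someI_ex)
  then show "linear (linear_part v T)" "\<exists>c. \<forall>x\<in>T. v x = linear_part v T x + c" by auto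
qed

lemma frechet_derivative_affine_on:
  fixes f v :: "pt \<Rightarrow> pt"
  assumes "linear f" "\<forall>x\<in>T. v x = f x + c" "x \<in> interior T"
  shows "frechet_derivative v (at x) = f"
proof -
  have "bounded_linear f" using assms(1) by (simp add: linear_conv_bounded_linear)
  then have "((\<lambda>x. f x + c) has_derivative f) (at x)"
    using bounded_linear_imp_has_derivative by (auto intro: has_derivative_add_const)
  then have "(v has_derivative f) (at x)"
    by (rule has_derivative_transform_within_open[OF _ open_interior assms(3)])
      (use assms(2) interior_subset[of T] in auto)
  then show ?thesis by (rule frechet_derivative_at[symmetric])
qed

text \<open>An affine representation on \<open>T\<close> has its linear map as the derivative at any
  interior point, so any two representations share it. This makes the choice in
  \<open>linear_part\<close> immaterial.\<close>

lemma linear_part_unique: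
  assumes v: "v \<in> P1_space asc" and T: "T \<in> mesh asc" and "linear f" "\<forall>x\<in>T. v x = f x + c"
  shows "linear_part v T = f"
proof -
  obtain x where x: "x \<in> interior T" using interior_triangle[OF T] by blast
  obtain d where d: "\<forall>x\<in>T. v x = linear_part v T x + d" using linear_part(2)[OF v T] by blast
  show ?thesis
    using frechet_derivative_affine_on[OF linear_part(1)[OF v T] d x] frechet_derivative_affine_on[OF assms(3,4) x] by simp
qed

lemma affine_zero_on_hull:
  fixes f :: "pt \<Rightarrow> pt"
  assumes f: "linear f" and z: "f p + c = 0" "f q + c = 0" "f r + c = 0" and x: "x \<in> convex hull {p, q, r}"
  shows "f x + c = 0"
proof -
  obtain u v w where uvw: "u + v + w = 1" "x = u *\<^sub>R p + v *\<^sub>R q + w *\<^sub>R r"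
    using x by (auto simp: convex_hull_3)
  have "f x + c = u *\<^sub>R f p + v *\<^sub>R f q + w *\<^sub>R f r + (u + v + w) *\<^sub>R c"
    using uvw by (simp add: linear_add[OF f] linear_scale[OF f])
  also have "\<dots> = u *\<^sub>R (f p + c) + v *\<^sub>R (f q + c) + w *\<^sub>R (f r + c)"
    by (simp add: scaleR_add_right scaleR_add_left)
  finally show ?thesis using z by simp
qed

section \<open>The elasticity energy of a linear map\<close>

definition strain_of :: "(pt \<Rightarrow> pt) \<Rightarrow> pt \<Rightarrow> pt \<Rightarrow> real" where
  "strain_of f i j = (inner (f j) i + inner (f i) j) / 2"

definition divergence_of :: "(pt \<Rightarrow> pt) \<Rightarrow> real" where
  "divergence_of f = (\<Sum>i\<in>Basis. inner (f i) i)"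

text \<open>Both Lame parameters are proportional to Young's modulus, so the integrand inside a
  triangle is \<open>E x\<close> times this constant, with the parameters taken at modulus
  1.\<close>

definition energy_density :: "(pt \<Rightarrow> pt) \<Rightarrow> (pt \<Rightarrow> pt) \<Rightarrow> real" where
  "energy_density f g = 2 * lame_mu 1 * (\<Sum>i\<in>Basis. \<Sum>j\<in>Basis. strain_of f i j * strain_of g i j) +
    lame_L 1 * divergence_of f * divergence_of g"

lemma lame_pos: "0 < lame_mu 1" "0 < lame_L 1"
  by (simp_all add: lame_mu_def lame_L_def poisson_ratio_def)

lemma lame_scale: "lame_mu e = e * lame_mu 1" "lame_L e = e * lame_L 1"
  by (simp_all add: lame_mu_def lame_L_def)

lemma energy_density_sym: "energy_density f g = energy_density g f"
  by (simp add: energy_density_def mult.commute mult.left_commute)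

lemma strain_of_sum:
  "strain_of (\<lambda>y. \<Sum>k\<in>I. x k *\<^sub>R F k y) i j = (\<Sum>k\<in>I. x k * strain_of (F k) i j)"
  unfolding strain_of_def inner_sum_left sum.distrib[symmetric] sum_divide_distrib
  by (intro sum.cong refl) (simp add: field_simps)

lemma divergence_of_sum:
  "divergence_of (\<lambda>y. \<Sum>k\<in>I. x k *\<^sub>R F k y) = (\<Sum>k\<in>I. x k * divergence_of (F k))"
  unfolding divergence_of_def by (simp add: inner_sum_left sum_distrib_left) (rule sum.swap)

lemma energy_density_sum_left:
  "energy_density (\<lambda>y. \<Sum>k\<in>I. x k *\<^sub>R F k y) g = (\<Sum>k\<in>I. x k * energy_density (F k) g)"
proof -
  have "(\<Sum>i\<in>Basis. \<Sum>j\<in>Basis. (\<Sum>k\<in>I. x k * strain_of (F k) i j) * strain_of g i j) =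
      (\<Sum>k\<in>I. x k * (\<Sum>i\<in>Basis. \<Sum>j\<in>Basis. strain_of (F k) i j * strain_of g i j))"
    unfolding sum_distrib_right sum_distrib_left mult.assoc
    by (subst sum.swap[where A = Basis and B = I], subst sum.swap[where A = Basis and B = I]) (rule refl)
  then show ?thesis
    unfolding energy_density_def strain_of_sum divergence_of_sum
    by (simp add: sum_distrib_left sum_distrib_right sum.distrib algebra_simps)
qed

lemma energy_density_sum_right:
  "energy_density g (\<lambda>y. \<Sum>k\<in>I. x k *\<^sub>R F k y) = (\<Sum>k\<in>I. x k * energy_density g (F k))"
  using energy_density_sum_left[of x F I g] by (simp add: energy_density_sym)

lemma energy_density_terms_nonneg:
  "0 \<le> 2 * lame_mu 1 * (\<Sum>i\<in>Basis. \<Sum>j\<in>Basis. strain_of f i j * strain_of f i j)"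
  "0 \<le> lame_L 1 * divergence_of f * divergence_of f"
proof -
  have "0 \<le> (\<Sum>i\<in>Basis. \<Sum>j\<in>Basis. strain_of f i j * strain_of f i j)"
    by (intro sum_nonneg zero_le_square)
  then show "0 \<le> 2 * lame_mu 1 * (\<Sum>i\<in>Basis. \<Sum>j\<in>Basis. strain_of f i j * strain_of f i j)"
    using lame_pos(1) by simp
  show "0 \<le> lame_L 1 * divergence_of f * divergence_of f" using lame_pos(2) by (simp add: mult.assoc)
qed

lemma energy_density_nonneg: "0 \<le> energy_density f f"
  unfolding energy_density_def by (intro add_nonneg_nonneg energy_density_terms_nonneg)

lemma energy_density_zero:
  assumes "energy_density f f = 0" "i \<in> Basis" "j \<in> Basis"
  shows "inner (f j) i + inner (f i) j = 0"
proof -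
  have nn: "0 \<le> strain_of f i j * strain_of f i j" for i j by simp
  have "2 * lame_mu 1 * (\<Sum>i\<in>Basis. \<Sum>j\<in>Basis. strain_of f i j * strain_of f i j) = 0"
    using assms(1) energy_density_terms_nonneg[of f] unfolding energy_density_def by linarith
  then have "(\<Sum>i\<in>Basis. \<Sum>j\<in>Basis. strain_of f i j * strain_of f i j) = 0" using lame_pos by simp
  then have "\<forall>i\<in>Basis. (\<Sum>j\<in>Basis. strain_of f i j * strain_of f i j) = 0"
    using nn by (subst (asm) sum_nonneg_eq_0_iff) (auto intro: sum_nonneg)
  then have "(\<Sum>j\<in>Basis. strain_of f i j * strain_of f i j) = 0" using assms by blast
  then have "\<forall>j\<in>Basis. strain_of f i j * strain_of f i j = 0"
    using nn by (subst (asm) sum_nonneg_eq_0_iff) auto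
  then show ?thesis using assms by (simp add: strain_of_def)
qed

text \<open>Zero strain makes \<open>f\<close> skew-symmetric, in the plane a multiple of the
  rotation by a right angle; such a map has a nonzero kernel vector only if the multiple is
  zero.\<close>

lemma energy_density_zero_rigid:
  assumes f: "linear f" and "energy_density f f = 0" and z: "f z = 0" "z \<noteq> 0"
  shows "f x = 0"
proof -
  note e = energy_density_zero[OF assms(2)]
  have B: "(1, 0) \<in> (Basis :: pt set)" "(0, 1) \<in> (Basis :: pt set)" by (auto simp: Basis_prod_def)
  obtain a b c d where fab: "f (1, 0) = (a, b)" "f (0, 1) = (c, d)" by (metis surj_pair)
  have "a = 0" "d = 0" "c = - b"
    using e[OF B(1) B(1)] e[OF B(2) B(2)] e[OF B(1) B(2)] by (simp_all add: fab)
  moreover have fx: "f (x1, x2) = x1 *\<^sub>R f (1, 0) + x2 *\<^sub>R f (0, 1)" for x1 x2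
  proof -
    have "f (x1, x2) = f (x1 *\<^sub>R (1, 0) + x2 *\<^sub>R (0, 1))" by simp
    then show ?thesis by (simp only: linear_add[OF f] linear_scale[OF f])
  qed
  ultimately have fx': "f (x1, x2) = (- x2 * b, x1 * b)" for x1 x2 by (simp add: fab)
  obtain z1 z2 where zz: "z = (z1, z2)" by (cases z)
  have "b = 0" using z fx' zz by (auto simp: zero_prod_def)
  then show ?thesis using fx' by (cases x) (simp add: zero_prod_def)
qed

section \<open>Integrals over unions of triangles\<close>

definition mass :: "(pt \<Rightarrow> real) \<Rightarrow> pt set \<Rightarrow> real" where
  "mass E T = (LINT x:T|lebesgue. E x)"

locale bounded_coefficient =
  fixes E :: "pt \<Rightarrow> real" and K e0 :: real
  assumes E_borel: "E \<in> borel_measurable borel" and E_upper: "\<And>x. E x \<le> K"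
    and E_lower: "\<And>x. e0 \<le> E x" and e0: "0 < e0"
begin

lemma triangle_lmeasurable: "T \<in> mesh asc \<Longrightarrow> T \<in> lmeasurable"
  using compact_convex_triangle(1) by (rule lmeasurable_compact)

lemma E_integrable:
  assumes "T \<in> mesh asc"
  shows "E absolutely_integrable_on T"
proof (rule measurable_bounded_by_integrable_imp_absolutely_integrable)
  show "E \<in> borel_measurable (lebesgue_on T)"
    using E_borel by (intro measurable_restrict_space1 measurable_completion) simp
  show "T \<in> sets lebesgue" using triangle_lmeasurable[OF assms] by (rule fmeasurableD)
  show "(\<lambda>x. K) integrable_on T" using triangle_lmeasurable[OF assms] by (rule integrable_on_const)
  show "norm (E x) \<le> K" for x using E_upper[of x] E_lower[of x] e0 by simp
qed

lemma mass_pos: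
  assumes T: "T \<in> mesh asc"
  shows "0 < mass E T"
proof -
  note Tm = triangle_lmeasurable[OF T]
  have "\<not> negligible T"
    using interior_triangle[OF T] negligible_convex_interior[OF compact_convex_triangle(2)[OF T]] by simp
  then have "0 < measure lebesgue T"
    using negligible_iff_measure0[OF Tm] by (simp add: zero_less_measure_iff)
  then have "0 < e0 * integral T (\<lambda>x. 1)" using lmeasure_integral[OF Tm] e0 by simp
  also have "\<dots> = integral T (\<lambda>x. e0)" using integral_mult_right[of T e0 "\<lambda>x. 1"] by simp
  also have "\<dots> \<le> integral T E"
    using E_lower Tm set_lebesgue_integral_eq_integral(1)[OF E_integrable[OF T]]
    by (intro integral_le integrable_on_const) auto
  also have "\<dots> = mass E T"
    unfolding mass_def by (rule set_lebesgue_integral_eq_integral(2)[OF E_integrable[OF T], symmetric])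
  finally show ?thesis .
qed

text \<open>Inside a triangle the derivatives are constant, so the integrand is \<open>E x\<close>
  times a number; frontiers and overlaps of triangles are null sets. What remains of the coefficient
  is its integral over each triangle.\<close>

lemma elasticity_form_Union:
  assumes C: "C \<subseteq> mesh asc" and u: "u \<in> P1_space asc" and v: "v \<in> P1_space asc"
  shows "elasticity_form E (\<Union>C) u v =
    (\<Sum>T\<in>C. mass E T * energy_density (linear_part u T) (linear_part v T))"
proof -
  define g where "g x = 2 * lame_mu (E x) * (\<Sum>i\<in>Basis. \<Sum>j\<in>Basis. strain u i j x * strain v i j x) +
    lame_L (E x) * divergence u x * divergence v x" for x
  define d where "d T = energy_density (linear_part u T) (linear_part v T)" for T
  have fin: "finite C" using C finite_mesh finite_subset by blast
  have spike: "g x = E x * d T" if T: "T \<in> C" and x: "x \<in> T - frontier T" for T x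
  proof -
    have Tm: "T \<in> mesh asc" using T C by blast
    have xi: "x \<in> interior T" using x closure_subset by (auto simp: frontier_def)
    obtain c where c: "\<forall>x\<in>T. u x = linear_part u T x + c" using linear_part(2)[OF u Tm] by blast
    obtain c' where c': "\<forall>x\<in>T. v x = linear_part v T x + c'" using linear_part(2)[OF v Tm] by blast
    have fu: "frechet_derivative u (at x) = linear_part u T"
      by (rule frechet_derivative_affine_on[OF linear_part(1)[OF u Tm] c xi])
    have fv: "frechet_derivative v (at x) = linear_part v T"
      by (rule frechet_derivative_affine_on[OF linear_part(1)[OF v Tm] c' xi])
    have su: "strain u i j x = strain_of (linear_part u T) i j" for i j
      by (simp add: strain_def strain_of_def partial_deriv_def fu)
    have sv: "strain v i j x = strain_of (linear_part v T) i j" for i j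
      by (simp add: strain_def strain_of_def partial_deriv_def fv)
    have du: "divergence u x = divergence_of (linear_part u T)" "divergence v x = divergence_of (linear_part v T)"
      by (simp_all add: divergence_def divergence_of_def partial_deriv_def fu fv)
    show ?thesis
      unfolding g_def d_def energy_density_def su sv du lame_scale[of "E x"]
      by (simp add: algebra_simps)
  qed
  have neg: "negligible (frontier T)" if "T \<in> C" for T
    using that C compact_convex_triangle(2) by (intro negligible_convex_frontier) blast
  have abs_T: "(\<lambda>x. E x * d T) absolutely_integrable_on T" if "T \<in> C" for T
    using E_integrable[of T asc] that C by (intro set_integrable_mult_left) auto
  have g_T: "g absolutely_integrable_on T" if T: "T \<in> C" for T
    using absolutely_integrable_spike[OF abs_T[OF T] neg[OF T] spike[OF T]] .
  have "(g has_integral (mass E T * d T)) T" if T: "T \<in> C" for T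
  proof (rule has_integral_spike[OF neg[OF T] spike[OF T]])
    have "T \<in> mesh asc" using T C by blast
    note Ei = set_lebesgue_integral_eq_integral[OF E_integrable[OF this]]
    have "(E has_integral mass E T) T" using Ei by (simp add: mass_def integrable_integral)
    then show "((\<lambda>x. E x * d T) has_integral (mass E T * d T)) T" by (rule has_integral_mult_left)
  qed
  moreover have "pairwise (\<lambda>S S'. negligible (S \<inter> S')) C"
    unfolding pairwise_def using mesh_overlap C by blast
  ultimately have int: "(g has_integral (\<Sum>T\<in>C. mass E T * d T)) (\<Union>C)"
    by (intro has_integral_Union fin) auto
  \<comment> \<open>Additivity was shown for the gauge integral, whereas the form is a Lebesgue
    integral; absolute integrability identifies the two.\<close>
  have "set_integrable lebesgue (\<Union>T\<in>C. T) g"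
    using g_T fin C triangle_lmeasurable by (intro set_integrable_UN) auto
  then have "(LINT x:(\<Union>C)|lebesgue. g x) = integral (\<Union>C) g"
    using set_lebesgue_integral_eq_integral(2)[of "\<Union>C" g] by simp
  also have "\<dots> = (\<Sum>T\<in>C. mass E T * d T)" using int by (rule integral_unique)
  finally show ?thesis by (simp add: elasticity_form_def g_def d_def)
qed

end

text \<open>A subdomain is a finite union of compact triangles and hence closed, and the layers are
  closed strips, so the modulus is Borel. The bounds are the largest and the smallest sum of the
  prescribed values.\<close>

lemma young_modulus_bounded_coefficient:
  assumes "mesh_partition asc cells"
  shows "bounded_coefficient (young_modulus cells layered) (10^8 + 10^9) (10^5)"
proof
  have closed: "closed (subdomain cells s)" if "s \<in> {1..8}" for s
  proof -
    have "cells s \<subseteq> mesh asc" using assms that by (auto simp: mesh_partition_def)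
    then show ?thesis
      unfolding subdomain_def using finite_mesh finite_subset compact_convex_triangle(1) compact_imp_closed
      by (intro closed_Union) blast+
  qed
  have "{x. \<exists>s\<in>{1..8}. odd s \<and> x \<in> subdomain cells s} = (\<Union>s\<in>{s\<in>{1..8}. odd s}. subdomain cells s)" by blast
  also have "\<dots> \<in> sets borel" using closed by (intro borel_closed closed_UN) auto
  finally have 1: "{x. \<exists>s\<in>{1..8}. odd s \<and> x \<in> subdomain cells s} \<in> sets borel" .
  have "{x :: pt. layered \<and> snd x \<in> {1/7..2/7} \<union> {3/7..4/7} \<union> {5/7..6/7}} =
    (if layered then snd -` ({1/7..2/7} \<union> {3/7..4/7} \<union> {5/7..6/7}) else {})" by auto
  also have "\<dots> \<in> sets borel" by (auto intro!: borel_closed continuous_closed_vimage continuous_intros)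
  finally have 2: "{x :: pt. layered \<and> snd x \<in> {1/7..2/7} \<union> {3/7..4/7} \<union> {5/7..6/7}} \<in> sets borel" .
  show "young_modulus cells layered \<in> borel_measurable borel"
    unfolding young_modulus_def
    by (intro borel_measurable_add measurable_If borel_measurable_const) (use 1 2 in auto)
  show "young_modulus cells layered x \<le> 10^8 + 10^9" "10^5 \<le> young_modulus cells layered x" for x
    by (auto simp: young_modulus_def)
qed simp

section \<open>The discretized elasticity problem\<close>

lemma sum_nth_distinct:
  fixes g :: "nat \<Rightarrow> 'a::comm_monoid_add"
  assumes "distinct xs"
  shows "(\<Sum>i<length xs. g (xs ! i)) = (\<Sum>k\<in>set xs. g k)"
  by (rule sum.reindex_bij_betw) (rule bij_betw_nth[OF assms refl refl])

lemma sum_delta_mult: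
  fixes f :: "nat \<Rightarrow> real"
  shows "(\<Sum>j<n. (if j = a then c else 0) * f j) = (if a < n then c * f a else 0)"
    and "(\<Sum>j<n. (if a = j then c else 0) * f j) = (if a < n then c * f a else 0)"
proof -
  have "(\<Sum>j<n. (if j = a then c else 0) * f j) = (\<Sum>j<n. if j = a then c * f a else 0)"
    by (intro sum.cong) auto
  then show "(\<Sum>j<n. (if j = a then c else 0) * f j) = (if a < n then c * f a else 0)" by simp
  then show "(\<Sum>j<n. (if a = j then c else 0) * f j) = (if a < n then c * f a else 0)"
    by (simp only: eq_commute[of a])
qed

text \<open>Bilinearity of \<open>energy_density\<close> turns a matrix assembled triangle by
  triangle into a weighted sum of energies of single linear maps, from which signs can be read
  off.\<close>

lemma gram_bform:
  assumes M: "M = mat k k (\<lambda>(i, j). \<Sum>T\<in>C. w T * energy_density (G i T) (G j T))"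
    and x: "x \<in> carrier_vec k" and y: "y \<in> carrier_vec k"
  shows "bform M x y = (\<Sum>T\<in>C. w T * energy_density (\<lambda>z. \<Sum>i<k. x $ i *\<^sub>R G i T z) (\<lambda>z. \<Sum>i<k. y $ i *\<^sub>R G i T z))"
proof -
  have "bform M x y = (\<Sum>i<k. x $ i * (\<Sum>j<k. (\<Sum>T\<in>C. w T * energy_density (G i T) (G j T)) * y $ j))"
    using x y by (simp add: bform_def M scalar_prod_def atLeast0LessThan)
  also have "\<dots> = (\<Sum>i<k. \<Sum>T\<in>C. x $ i * (w T * (\<Sum>j<k. y $ j * energy_density (G i T) (G j T))))"
    unfolding sum_distrib_left sum_distrib_right
    by (intro sum.cong refl, subst sum.swap) (simp add: mult_ac)
  also have "\<dots> = (\<Sum>T\<in>C. w T * (\<Sum>i<k. x $ i * (\<Sum>j<k. y $ j * energy_density (G i T) (G j T))))"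
    by (subst sum.swap) (simp add: sum_distrib_left mult_ac)
  finally show ?thesis by (simp add: energy_density_sum_left energy_density_sum_right)
qed

lemma restriction_matrix_carrier [simp]: "restriction_matrix n xs \<in> carrier_mat (length xs) n"
  by (simp add: restriction_matrix_def)

lemma restriction_matrix_mult_vec:
  assumes "x \<in> carrier_vec n" "i < length xs" "set xs \<subseteq> {..<n}"
  shows "(restriction_matrix n xs *\<^sub>v x) $ i = x $ (xs ! i)"
proof -
  have "xs ! i < n" using assms by (meson lessThan_iff nth_mem subsetD)
  then show ?thesis
    using assms by (simp add: restriction_matrix_def scalar_prod_def atLeast0LessThan sum_delta_mult)
qed

lemma transpose_restriction_matrix_mult_vec:
  assumes "y \<in> carrier_vec (length xs)" "k < n"
  shows "((restriction_matrix n xs)\<^sup>T *\<^sub>v y) $ k = (\<Sum>i<length xs. if k = xs ! i then y $ i else 0)"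
  using assms by (auto simp: restriction_matrix_def scalar_prod_def atLeast0LessThan intro!: sum.cong)

lemma transpose_restriction_matrix_inj:
  assumes xs: "distinct xs" "set xs \<subseteq> {..<n}" and y: "y \<in> carrier_vec (length xs)"
    and z: "(restriction_matrix n xs)\<^sup>T *\<^sub>v y = 0\<^sub>v n"
  shows "y = 0\<^sub>v (length xs)"
proof (rule eq_vecI)
  fix i assume "i < dim_vec (0\<^sub>v (length xs) :: real vec)"
  then have i: "i < length xs" by simp
  then have k: "xs ! i < n" using xs(2) by (meson lessThan_iff nth_mem subsetD)
  have "((restriction_matrix n xs)\<^sup>T *\<^sub>v y) $ (xs ! i) = (\<Sum>j<length xs. if j = i then y $ i else 0)"
    unfolding transpose_restriction_matrix_mult_vec[OF y k]
    using i xs(1) by (intro sum.cong) (auto simp: nth_eq_iff_index_eq)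
  then show "y $ i = 0\<^sub>v (length xs) $ i" using z i k by simp
qed (use y in simp)

lemma restriction_sandwich:
  assumes B: "B \<in> carrier_mat n n" and xs: "set xs \<subseteq> {..<n}" and ij: "i < length xs" "j < length xs"
  shows "(restriction_matrix n xs * B * (restriction_matrix n xs)\<^sup>T) $$ (i, j) = B $$ (xs ! i, xs ! j)"
proof -
  let ?R = "restriction_matrix n xs"
  have k: "xs ! i < n" "xs ! j < n" using xs ij by (meson lessThan_iff nth_mem subsetD)+
  have RB: "(?R * B) $$ (i, l) = B $$ (xs ! i, l)" if "l < n" for l
    using ij B that k by (simp add: restriction_matrix_def scalar_prod_def atLeast0LessThan sum_delta_mult)
  have Rj: "?R $$ (j, l) = (if l = xs ! j then 1 else 0)" if "l < n" for l
    using ij that by (simp add: restriction_matrix_def)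
  have RBc: "?R * B \<in> carrier_mat (length xs) n" using B by (intro mult_carrier_mat[of _ _ n]) auto
  have "(?R * B * ?R\<^sup>T) $$ (i, j) = (\<Sum>l<n. (?R * B) $$ (i, l) * ?R $$ (j, l))"
    using ij carrier_matD[OF RBc] carrier_matD[OF restriction_matrix_carrier[of n xs]]
    by (simp add: scalar_prod_def atLeast0LessThan del: index_mult_mat(2,3))
  also have "\<dots> = (\<Sum>l<n. if l = xs ! j then B $$ (xs ! i, xs ! j) else 0)"
    by (intro sum.cong) (auto simp: RB Rj)
  finally show ?thesis using k by simp
qed

lemma diagonal_mult_vec:
  assumes "v \<in> carrier_vec m" "i < m"
  shows "(mat m m (\<lambda>(i, j). if i = j then d i else 0) *\<^sub>v v) $ i = d i * (v $ i :: real)"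
  using assms by (simp add: scalar_prod_def atLeast0LessThan sum_delta_mult)

locale elasticity_problem =
  fixes asc layered :: bool and cells :: "nat \<Rightarrow> pt set set" and dofs :: "(pt \<times> pt) list"
    and \<phi> :: "nat \<Rightarrow> pt \<Rightarrow> pt" and S :: "nat \<Rightarrow> nat list"
  assumes partition: "mesh_partition asc cells"
    and dofs: "dof_numbering dofs"
    and basis: "nodal_basis asc dofs \<phi>"
    and local_dofs: "local_dof_numbering dofs cells S"
begin

abbreviation n :: nat where "n \<equiv> length dofs"
abbreviation E :: "pt \<Rightarrow> real" where "E \<equiv> young_modulus cells layered"
abbreviation F :: "nat \<Rightarrow> pt set \<Rightarrow> pt \<Rightarrow> pt" where "F k T \<equiv> linear_part (\<phi> k) T"
abbreviation A :: "real mat" where "A \<equiv> stiffness_matrix E n \<phi>"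
abbreviation AN :: "nat \<Rightarrow> real mat" where "AN s \<equiv> neumann_matrix E (subdomain cells s) \<phi> (S s)"
abbreviation R :: "nat \<Rightarrow> real mat" where "R s \<equiv> restriction_matrix n (S s)"

text \<open>On a mesh triangle \<open>T\<close>, this is the derivative of the finite element
  function with coefficient vector \<open>x\<close>.\<close>

definition comb :: "real vec \<Rightarrow> pt set \<Rightarrow> pt \<Rightarrow> pt" where
  "comb x T = (\<lambda>z. \<Sum>k<n. x $ k *\<^sub>R F k T z)"

sublocale bounded_coefficient E "10^8 + 10^9" "10^5"
  by (rule young_modulus_bounded_coefficient[OF partition])

lemma cells_mesh: "s \<in> {1..8} \<Longrightarrow> cells s \<subseteq> mesh asc"
  using partition by (auto simp: mesh_partition_def)

lemma cells_Union: "(\<Union>s\<in>{1..8}. cells s) = mesh asc"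
  using partition by (simp add: mesh_partition_def)

lemma cells_disjoint: "s \<in> {1..8} \<Longrightarrow> t \<in> {1..8} \<Longrightarrow> s \<noteq> t \<Longrightarrow> cells s \<inter> cells t = {}"
  using partition unfolding mesh_partition_def by blast

lemma sum_cells: "(\<Sum>s\<in>{1..8}. \<Sum>T\<in>cells s. f T) = (\<Sum>T\<in>mesh asc. f T)"
  unfolding cells_Union[symmetric]
proof (rule sum.UNION_disjoint[symmetric])
  show "\<forall>s\<in>{1..8}. finite (cells s)" using cells_mesh finite_mesh finite_subset by metis
  show "\<forall>s\<in>{1..8}. \<forall>t\<in>{1..8}. s \<noteq> t \<longrightarrow> cells s \<inter> cells t = {}" using cells_disjoint by simp
qed simp

lemma S_distinct: "s \<in> {1..8} \<Longrightarrow> distinct (S s)"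
  and S_set: "s \<in> {1..8} \<Longrightarrow> set (S s) = {k. k < n \<and> fst (dofs ! k) \<in> subdomain cells s}"
  using local_dofs by (auto simp: local_dof_numbering_def)

lemma S_bound: "s \<in> {1..8} \<Longrightarrow> set (S s) \<subseteq> {..<n}"
  by (auto simp: S_set)

lemma phi_P1: "k < n \<Longrightarrow> \<phi> k \<in> P1_space asc"
  using basis by (simp add: nodal_basis_def)

lemma phi_dof: "k < n \<Longrightarrow> l < n \<Longrightarrow> inner (\<phi> k (fst (dofs ! l))) (snd (dofs ! l)) = (if l = k then 1 else 0)"
  using basis by (simp add: nodal_basis_def)

lemma dof_node: "k < n \<Longrightarrow> fst (dofs ! k) \<in> mesh_nodes"
  using dofs nth_mem[of k dofs] by (auto simp: dof_numbering_def)

text \<open>A node on the Dirichlet boundary carries no degree of freedom, so the value there is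
  zero by membership in \<open>P1_space\<close>; at every other node both components are degrees of
  freedom.\<close>

lemma phi_other_node:
  assumes k: "k < n" and p: "p \<in> mesh_nodes" "p \<noteq> fst (dofs ! k)"
  shows "\<phi> k p = 0"
proof (cases "p \<in> dirichlet_boundary")
  case True
  then show ?thesis using phi_P1[OF k] by (simp add: P1_space_def)
next
  case False
  show ?thesis
  proof (rule euclidean_eqI)
    fix e :: pt assume "e \<in> Basis"
    then have "(p, e) \<in> set dofs" using False p dofs by (auto simp: dof_numbering_def)
    then obtain l where l: "l < n" "dofs ! l = (p, e)" by (meson in_set_conv_nth)
    then have "l \<noteq> k" using p by auto
    then show "inner (\<phi> k p) e = inner 0 e" using phi_dof[OF k l(1)] l by simp
  qed
qed

lemma phi_zero_on_triangle:
  assumes k: "k < n" and T: "T \<in> mesh asc" and v: "T = convex hull {p, q, r}"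
    and z: "\<phi> k p = 0" "\<phi> k q = 0" "\<phi> k r = 0" and x: "x \<in> T"
  shows "\<phi> k x = 0"
proof -
  obtain c where c: "\<forall>x\<in>T. \<phi> k x = F k T x + c" using linear_part(2)[OF phi_P1[OF k] T] by blast
  have "p \<in> T" "q \<in> T" "r \<in> T" unfolding v by (auto intro: hull_inc)
  then have "F k T p + c = 0" "F k T q + c = 0" "F k T r + c = 0" using c z by auto
  then have "F k T x + c = 0"
    using x unfolding v by (rule affine_zero_on_hull[OF linear_part(1)[OF phi_P1[OF k] T, unfolded v]])
  then show ?thesis using c x by simp
qed

text \<open>No vertex of \<open>T\<close> is the node of \<open>k\<close>, so the affine function
  \<open>\<phi> k\<close> vanishes at all three vertices. This locality is what makes restriction to
  the degrees of freedom of a subdomain lossless.\<close>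

lemma F_zero:
  assumes k: "k < n" and T: "T \<in> mesh asc" and notin: "fst (dofs ! k) \<notin> T"
  shows "F k T = (\<lambda>_. 0)"
proof -
  obtain p q r where v: "T = convex hull {p, q, r}" and nodes: "p \<in> mesh_nodes" "q \<in> mesh_nodes" "r \<in> mesh_nodes"
    using T by (rule mesh_triangle)
  have "p \<in> T" "q \<in> T" "r \<in> T" unfolding v by (auto intro: hull_inc)
  then have "p \<noteq> fst (dofs ! k)" "q \<noteq> fst (dofs ! k)" "r \<noteq> fst (dofs ! k)" using notin by auto
  then have "\<phi> k x = 0" if "x \<in> T" for x
    using phi_zero_on_triangle[OF k T v _ _ _ that] phi_other_node[OF k] nodes by blast
  then show ?thesis
    by (intro linear_part_unique[OF phi_P1[OF k] T, where c = 0]) (auto simp: linear_iff)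
qed

text \<open>Two of the three vertices differ from the node of \<open>k\<close>, and
  \<open>\<phi> k\<close> vanishes there. With zero energy it would be a rigid motion with two
  zeros, hence zero on \<open>T\<close>, although one component at its own node is 1. This
  positivity makes the weights of the \<open>k\<close>-scaling invertible.\<close>

lemma F_energy_pos:
  assumes k: "k < n" and T: "T \<in> mesh asc" and inT: "fst (dofs ! k) \<in> T"
  shows "0 < energy_density (F k T) (F k T)"
proof (rule ccontr)
  assume "\<not> 0 < energy_density (F k T) (F k T)"
  then have e0: "energy_density (F k T) (F k T) = 0" using energy_density_nonneg[of "F k T"] by simp
  note lin = linear_part(1)[OF phi_P1[OF k] T]
  obtain c where c: "\<forall>x\<in>T. \<phi> k x = F k T x + c" using linear_part(2)[OF phi_P1[OF k] T] by blast
  obtain p q r where v: "T = convex hull {p, q, r}" and nodes: "p \<in> mesh_nodes" "q \<in> mesh_nodes" "r \<in> mesh_nodes"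
    and dist: "p \<noteq> q" "q \<noteq> r" "p \<noteq> r" using T by (rule mesh_triangle)
  have inc: "p \<in> T" "q \<in> T" "r \<in> T" unfolding v by (auto intro: hull_inc)
  obtain a b where ab: "a \<in> T" "b \<in> T" "a \<noteq> b" "\<phi> k a = 0" "\<phi> k b = 0"
    using dist inc nodes phi_other_node[OF k] by metis
  have "F k T (a - b) = 0" using c ab by (simp add: linear_diff[OF lin]) (metis add_right_cancel)
  then have "F k T x = 0" for x using energy_density_zero_rigid[OF lin e0, of "a - b"] ab(3) by simp
  then have "\<phi> k (fst (dofs ! k)) = 0" using c ab inT by metis
  then show False using phi_dof[OF k k] by simp
qed

section \<open>Stiffness and Neumann matrices as sums over triangles\<close>

lemma stiffness_entry:
  assumes "i < n" "j < n"
  shows "elasticity_form E Omega (\<phi> i) (\<phi> j) = (\<Sum>T\<in>mesh asc. mass E T * energy_density (F i T) (F j T))"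
  using elasticity_form_Union[OF subset_refl phi_P1[OF assms(1)] phi_P1[OF assms(2)]] by (simp add: Union_mesh)

lemma neumann_entry:
  assumes "s \<in> {1..8}" "i < n" "j < n"
  shows "elasticity_form E (subdomain cells s) (\<phi> i) (\<phi> j) = (\<Sum>T\<in>cells s. mass E T * energy_density (F i T) (F j T))"
  unfolding subdomain_def by (rule elasticity_form_Union[OF cells_mesh[OF assms(1)] phi_P1[OF assms(2)] phi_P1[OF assms(3)]])

lemma bform_A:
  assumes "x \<in> carrier_vec n" "y \<in> carrier_vec n"
  shows "bform A x y = (\<Sum>T\<in>mesh asc. mass E T * energy_density (comb x T) (comb y T))"
  unfolding comb_def
proof (rule gram_bform[OF _ assms])
  show "A = mat n n (\<lambda>(i, j). \<Sum>T\<in>mesh asc. mass E T * energy_density (F i T) (F j T))"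
    unfolding stiffness_matrix_def by (rule cong_mat) (auto simp: stiffness_entry)
qed

lemma A_carrier: "A \<in> carrier_mat n n"
  by (simp add: stiffness_matrix_def)

lemma A_sym: "sym_mat n A"
  unfolding sym_mat_def using A_carrier
  by (auto intro!: eq_matI simp: stiffness_matrix_def stiffness_entry energy_density_sym)

lemma comb_rigid:
  assumes T: "T \<in> mesh asc" and e0: "energy_density (comb x T) (comb x T) = 0"
    and ab: "a \<in> T" "b \<in> T" "a \<noteq> b" "(\<Sum>k<n. x $ k *\<^sub>R \<phi> k a) = 0" "(\<Sum>k<n. x $ k *\<^sub>R \<phi> k b) = 0" and z: "z \<in> T"
  shows "(\<Sum>k<n. x $ k *\<^sub>R \<phi> k z) = 0"
proof -
  have "\<forall>k. \<exists>c. k < n \<longrightarrow> (\<forall>z\<in>T. \<phi> k z = F k T z + c)"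
    using linear_part(2)[OF phi_P1 T] by blast
  then obtain c where c: "\<And>k z. k < n \<Longrightarrow> z \<in> T \<Longrightarrow> \<phi> k z = F k T z + c k" by metis
  have lin: "linear (comb x T)"
    unfolding comb_def using linear_part(1)[OF phi_P1 T]
    by (intro linear_compose_sum ballI linear_compose_scale_right) auto
  have val: "(\<Sum>k<n. x $ k *\<^sub>R \<phi> k z) = comb x T z + (\<Sum>k<n. x $ k *\<^sub>R c k)" if "z \<in> T" for z
    unfolding comb_def sum.distrib[symmetric] using c that
    by (intro sum.cong) (auto simp: scaleR_add_right)
  have "comb x T (a - b) = 0" using val[OF ab(1)] val[OF ab(2)] ab by (simp add: linear_diff[OF lin]) (metis add_right_cancel)
  then have zero: "comb x T z = 0" for z using energy_density_zero_rigid[OF lin e0, of "a - b"] ab(3) by simp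
  show ?thesis using val[OF z] val[OF ab(1)] ab(4) zero by simp
qed

lemma A_spd: "spd_mat n A"
  unfolding spd_mat_def
proof (intro conjI ballI impI A_sym)
  fix x :: "real vec" assume x: "x \<in> carrier_vec n" and "x \<noteq> 0\<^sub>v n"
  have nn: "0 \<le> mass E T * energy_density (comb x T) (comb x T)" if "T \<in> mesh asc" for T
    using mass_pos[OF that] energy_density_nonneg by simp
  have "x = 0\<^sub>v n" if "bform A x x = 0"
  proof -
    have "\<forall>T\<in>mesh asc. mass E T * energy_density (comb x T) (comb x T) = 0"
      using that nn finite_mesh unfolding bform_A[OF x x] by (subst (asm) sum_nonneg_eq_0_iff) auto
    then have e0: "energy_density (comb x T) (comb x T) = 0" if "T \<in> mesh asc" for T
      using mass_pos[OF that] that by fastforce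
    define v where "v z = (\<Sum>k<n. x $ k *\<^sub>R \<phi> k z)" for z
    have rigid: "v z = 0" if "convex hull {a, b, z} \<in> mesh asc" "a \<noteq> b" "v a = 0" "v b = 0" for a b z
      using comb_rigid[OF that(1) e0[OF that(1)], of a b z] that by (auto simp: v_def hull_inc)
    have cell: "T \<in> mesh asc" if "T \<in> cell_triangles asc i j" "i < 84" "j < 42" for T i j
      using that unfolding mesh_def by blast
    have column: "\<forall>j\<le>42. v (grid_point i j) = 0" if "i \<le> 84" for i
      using that
    proof (induction i)
      case 0
      have "grid_point 0 j \<in> dirichlet_boundary" if "j \<le> 42" for j
        using that by (auto simp: grid_point_def dirichlet_boundary_def Omega_def)
      then show ?case using phi_P1 by (auto simp: v_def P1_space_def)
    next
      case (Suc i)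
      have IH: "v (grid_point i j) = 0" if "j \<le> 42" for j using Suc that by simp
      have step: "v (grid_point (i+1) j) = 0 \<and> v (grid_point (i+1) (j+1)) = 0" if j: "j < 42" for j
      proof -
        let ?a = "grid_point i j" and ?b = "grid_point (i+1) j" and ?c = "grid_point i (j+1)" and ?d = "grid_point (i+1) (j+1)"
        have i: "i < 84" using Suc.prems by simp
        have va: "v ?a = 0" "v ?c = 0" using IH j by auto
        have dist: "?a \<noteq> ?c" "?a \<noteq> ?d" "?b \<noteq> ?c" by (auto simp: grid_point_def)
        show ?thesis
        \<comment> \<open>The order depends on the diagonal: the triangle containing both left nodes
          has its third vertex at \<open>?d\<close> for the ascending diagonal and at
          \<open>?b\<close> for the descending one; the other triangle yields the remaining
          node.\<close>
        proof (cases asc)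
          case True
          have "convex hull {?a, ?c, ?d} \<in> mesh asc"
            using True by (intro cell[OF _ i j]) (simp add: cell_triangles_def)
          then have d: "v ?d = 0" by (rule rigid[OF _ dist(1) va])
          have "convex hull {?a, ?d, ?b} \<in> mesh asc"
            using True by (intro cell[OF _ i j]) (simp add: cell_triangles_def insert_commute)
          then have "v ?b = 0" by (rule rigid[OF _ dist(2) va(1) d])
          then show ?thesis using d by simp
        next
          case False
          have "convex hull {?a, ?c, ?b} \<in> mesh asc"
            using False by (intro cell[OF _ i j]) (simp add: cell_triangles_def insert_commute)
          then have b: "v ?b = 0" by (rule rigid[OF _ dist(1) va])
          have "convex hull {?b, ?c, ?d} \<in> mesh asc"
            using False by (intro cell[OF _ i j]) (simp add: cell_triangles_def)
          then have "v ?d = 0" by (rule rigid[OF _ dist(3) b va(2)])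
          then show ?thesis using b by simp
        qed
      qed
      show ?case
      proof (intro allI impI)
        fix j :: nat assume "j \<le> 42"
        \<comment> \<open>The top node has no cell above it; it is reached as the upper corner of
          cell 41.\<close>
        then consider "j < 42" | "j = 41 + 1" by linarith
        then show "v (grid_point (Suc i) j) = 0"
        proof cases
          case 1
          then show ?thesis using step by simp
        next
          case 2
          then show ?thesis using step[of 41] by simp
        qed
      qed
    qed
    show ?thesis
    proof (rule eq_vecI)
      fix l assume "l < dim_vec (0\<^sub>v n :: real vec)"
      then have l: "l < n" by simp
      obtain i j where "fst (dofs ! l) = grid_point i j" "i \<le> 84" "j \<le> 42"
        using dof_node[OF l] by (auto simp: mesh_nodes_def)
      then have "v (fst (dofs ! l)) = 0" using column by auto
      then have "0 = inner (v (fst (dofs ! l))) (snd (dofs ! l))" by simp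
      also have "\<dots> = (\<Sum>k<n. if k = l then x $ l else 0)"
        unfolding v_def inner_sum_left using phi_dof l by (intro sum.cong) auto
      also have "\<dots> = x $ l" using l by simp
      finally show "x $ l = 0\<^sub>v n $ l" using l by simp
    qed (use x in simp)
  qed
  moreover have "0 \<le> bform A x x" unfolding bform_A[OF x x] using nn by (rule sum_nonneg)
  ultimately show "0 < bform A x x" using \<open>x \<noteq> 0\<^sub>v n\<close> by fastforce
qed

lemma S_nth: "s \<in> {1..8} \<Longrightarrow> i < length (S s) \<Longrightarrow> S s ! i < n"
  using S_bound nth_mem by blast

lemma bform_AN:
  assumes s: "s \<in> {1..8}" and "x \<in> carrier_vec (length (S s))" "y \<in> carrier_vec (length (S s))"
  shows "bform (AN s) x y = (\<Sum>T\<in>cells s. mass E T *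
    energy_density (\<lambda>z. \<Sum>i<length (S s). x $ i *\<^sub>R F (S s ! i) T z) (\<lambda>z. \<Sum>i<length (S s). y $ i *\<^sub>R F (S s ! i) T z))"
proof (rule gram_bform[OF _ assms(2,3)])
  show "AN s = mat (length (S s)) (length (S s)) (\<lambda>(i, j). \<Sum>T\<in>cells s. mass E T * energy_density (F (S s ! i) T) (F (S s ! j) T))"
    unfolding neumann_matrix_def by (rule cong_mat) (auto simp: neumann_entry[OF s] S_nth[OF s])
qed

lemma AN_psd:
  assumes s: "s \<in> {1..8}"
  shows "psd_mat (length (S s)) (AN s)"
proof -
  have "sym_mat (length (S s)) (AN s)"
    unfolding sym_mat_def
    by (auto intro!: eq_matI simp: neumann_matrix_def neumann_entry[OF s] S_nth[OF s] energy_density_sym)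
  moreover have "0 \<le> bform (AN s) x x" if "x \<in> carrier_vec (length (S s))" for x
    unfolding bform_AN[OF s that that] using cells_mesh[OF s] mass_pos energy_density_nonneg
    by (intro sum_nonneg mult_nonneg_nonneg) (auto intro: less_imp_le)
  ultimately show ?thesis by (simp add: psd_mat_def)
qed

text \<open>Degrees of freedom outside \<open>S s\<close> have zero linear part on the triangles of
  the subdomain, so the local coefficients already determine the whole derivative there.\<close>

lemma comb_restriction:
  assumes s: "s \<in> {1..8}" and T: "T \<in> cells s" and x: "x \<in> carrier_vec n"
  shows "(\<lambda>z. \<Sum>i<length (S s). (R s *\<^sub>v x) $ i *\<^sub>R F (S s ! i) T z) = comb x T"
proof
  fix z
  have Tm: "T \<in> mesh asc" using T cells_mesh[OF s] by blast
  have "(\<Sum>i<length (S s). (R s *\<^sub>v x) $ i *\<^sub>R F (S s ! i) T z) = (\<Sum>i<length (S s). x $ (S s ! i) *\<^sub>R F (S s ! i) T z)"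
    using restriction_matrix_mult_vec[OF x _ S_bound[OF s]] by (intro sum.cong) auto
  also have "\<dots> = (\<Sum>k\<in>set (S s). x $ k *\<^sub>R F k T z)"
    by (rule sum_nth_distinct[OF S_distinct[OF s], of "\<lambda>k. x $ k *\<^sub>R F k T z"])
  also have "\<dots> = (\<Sum>k<n. x $ k *\<^sub>R F k T z)"
  proof (rule sum.mono_neutral_left)
    show "\<forall>k\<in>{..<n} - set (S s). x $ k *\<^sub>R F k T z = 0"
    proof
      fix k assume k: "k \<in> {..<n} - set (S s)"
      then have "fst (dofs ! k) \<notin> T" using T by (auto simp: S_set[OF s] subdomain_def)
      then show "x $ k *\<^sub>R F k T z = 0" using F_zero[OF _ Tm] k by simp
    qed
  qed (use S_bound[OF s] in auto)
  finally show "(\<Sum>i<length (S s). (R s *\<^sub>v x) $ i *\<^sub>R F (S s ! i) T z) = comb x T z" by (simp add: comb_def)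
qed

text \<open>Every triangle belongs to exactly one subdomain, and on it the local and the global
  energies agree. This is the quadratic form of \<open>A\<close> as the sum of the local Neumann
  matrices.\<close>

lemma neumann_splitting:
  assumes x: "x \<in> carrier_vec n"
  shows "(\<Sum>s\<in>{1..8}. bform (AN s) (R s *\<^sub>v x) (R s *\<^sub>v x)) = bform A x x"
proof -
  have "(\<Sum>s\<in>{1..8}. bform (AN s) (R s *\<^sub>v x) (R s *\<^sub>v x)) =
      (\<Sum>s\<in>{1..8}. \<Sum>T\<in>cells s. mass E T * energy_density (comb x T) (comb x T))"
  proof (rule sum.cong[OF refl])
    fix s assume s: "s \<in> {1..8::nat}"
    have c: "R s *\<^sub>v x \<in> carrier_vec (length (S s))" by (rule mult_mat_vec_carrier[OF restriction_matrix_carrier x])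
    show "bform (AN s) (R s *\<^sub>v x) (R s *\<^sub>v x) = (\<Sum>T\<in>cells s. mass E T * energy_density (comb x T) (comb x T))"
      unfolding bform_AN[OF s c c] by (intro sum.cong refl) (simp only: comb_restriction[OF s _ x])
  qed
  then show ?thesis by (simp only: sum_cells bform_A[OF x x])
qed

section \<open>Weights of the partition of unity\<close>

lemma dof_covered:
  assumes k: "k < n"
  obtains s where "s \<in> {1..8}" "k \<in> set (S s)"
proof -
  have "fst (dofs ! k) \<in> Omega"
    using dof_node[OF k] by (auto simp: mesh_nodes_def grid_point_def Omega_def)
  then obtain T where T: "T \<in> mesh asc" "fst (dofs ! k) \<in> T" using Union_mesh by blast
  then obtain s where "s \<in> {1..8}" "T \<in> cells s" using cells_Union by blast
  then show ?thesis using that[of s] T k by (auto simp: S_set subdomain_def)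
qed

text \<open>The diagonal entry of the Neumann matrix at the degree of freedom \<open>k\<close>,
  indexed globally so that it also makes sense, with value zero, for \<open>k\<close> outside
  \<open>S s\<close>.\<close>

definition local_energy :: "nat \<Rightarrow> nat \<Rightarrow> real" where
  "local_energy s k = (\<Sum>T\<in>cells s. mass E T * energy_density (F k T) (F k T))"

lemma local_energy_pos:
  assumes s: "s \<in> {1..8}" and k: "k \<in> set (S s)"
  shows "0 < local_energy s k"
proof -
  have kn: "k < n" using S_bound[OF s] k by auto
  obtain T where T: "T \<in> cells s" "fst (dofs ! k) \<in> T" using k by (auto simp: S_set[OF s] subdomain_def)
  have Tm: "T' \<in> mesh asc" if "T' \<in> cells s" for T' using that cells_mesh[OF s] by blast
  have "finite (cells s)" using cells_mesh[OF s] finite_mesh finite_subset by blast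
  moreover have "0 < mass E T * energy_density (F k T) (F k T)"
    using mass_pos[OF Tm[OF T(1)]] F_energy_pos[OF kn Tm[OF T(1)] T(2)] by simp
  moreover have "0 \<le> mass E T' * energy_density (F k T') (F k T')" if "T' \<in> cells s" for T'
    using mass_pos[OF Tm[OF that]] energy_density_nonneg by simp
  ultimately show ?thesis unfolding local_energy_def using T(1) by (intro sum_pos2[of _ T]) auto
qed

lemma local_energy_zero:
  assumes s: "s \<in> {1..8}" and k: "k < n" "k \<notin> set (S s)"
  shows "local_energy s k = 0"
proof -
  have "F k T = (\<lambda>_. 0)" if T: "T \<in> cells s" for T
  proof -
    have Tm: "T \<in> mesh asc" using T cells_mesh[OF s] by blast
    have "fst (dofs ! k) \<notin> T" using T k by (auto simp: S_set[OF s] subdomain_def)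
    then show ?thesis by (rule F_zero[OF k(1) Tm])
  qed
  then show ?thesis by (simp add: local_energy_def energy_density_def strain_of_def divergence_of_def)
qed

lemma A_diag: "k < n \<Longrightarrow> A $$ (k, k) = (\<Sum>s\<in>{1..8}. local_energy s k)"
  unfolding local_energy_def sum_cells by (simp add: stiffness_matrix_def stiffness_entry)

text \<open>Both scalings of the partition of unity are diagonal, with a weight \<open>\<omega> s k\<close> that
  depends only on the subdomain and on the degree of freedom.\<close>

lemma scaling_weights:
  assumes "(\<forall>s\<in>{1..8}. D s = multiplicity_scaling n R s) \<or> (\<forall>s\<in>{1..8}. D s = k_scaling A (R s) (AN s))"
  obtains \<omega> where "\<And>s k. s \<in> {1..8} \<Longrightarrow> k \<in> set (S s) \<Longrightarrow> \<omega> s k \<noteq> 0"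
    "\<And>k. k < n \<Longrightarrow> (\<Sum>s\<in>{1..8}. if k \<in> set (S s) then \<omega> s k else 0) = 1"
    "\<And>s. s \<in> {1..8} \<Longrightarrow> D s = mat (length (S s)) (length (S s)) (\<lambda>(i, j). if i = j then \<omega> s (S s ! i) else 0)"
  using assms
proof (elim disjE)
  assume D: "\<forall>s\<in>{1..8}. D s = multiplicity_scaling n R s"
  \<comment> \<open>The number of subdomains that contain the node of \<open>k\<close>; it is the
    diagonal entry of the sum of all \<open>(R t)^T R t\<close>, a diagonal matrix.\<close>
  define mult where "mult k = (\<Sum>s\<in>{1..8::nat}. if k \<in> set (S s) then 1 else 0 :: real)" for k
  have pos: "0 < mult k" if k: "k < n" for k
  proof -
    obtain s where "s \<in> {1..8}" "k \<in> set (S s)" using dof_covered[OF k] .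
    then show ?thesis unfolding mult_def by (intro sum_pos2[of _ s]) auto
  qed
  have entry: "((R s)\<^sup>T * R s) $$ (k, l) = (if k = l \<and> k \<in> set (S s) then 1 else 0)"
    if s: "s \<in> {1..8}" and kl: "k < n" "l < n" for s k l
  proof -
    have "((R s)\<^sup>T * R s) $$ (k, l) = (\<Sum>i<length (S s). if k = S s ! i \<and> l = S s ! i then 1 else 0)"
      using kl by (auto simp: restriction_matrix_def scalar_prod_def atLeast0LessThan intro!: sum.cong)
    also have "\<dots> = (\<Sum>m\<in>set (S s). if k = m \<and> l = m then 1 else 0)"
      by (rule sum_nth_distinct[OF S_distinct[OF s], of "\<lambda>m. if k = m \<and> l = m then 1 else 0"])
    also have "\<dots> = (\<Sum>m\<in>set (S s). if m = k then if k = l then 1 else 0 else 0)" by (intro sum.cong) auto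
    finally show ?thesis by simp
  qed
  have "mat_family_sum n n (\<lambda>s. (R s)\<^sup>T * R s) {1..8} = mat n n (\<lambda>(k, l). if k = l then mult k else 0)"
    unfolding mat_family_sum_def mult_def
  proof (rule cong_mat, goal_cases)
    case (3 k l)
    have "(\<Sum>s\<in>{1..8}. ((R s)\<^sup>T * R s) $$ (k, l)) = (\<Sum>s\<in>{1..8}. if k = l \<and> k \<in> set (S s) then 1 else 0)"
      using entry[OF _ 3] by (rule sum.cong[OF refl])
    then show ?case by (auto simp del: One_nat_def intro!: sum.cong)
  qed auto
  then have inv: "mat_inv (mat_family_sum n n (\<lambda>s. (R s)\<^sup>T * R s) {1..8}) = mat n n (\<lambda>(k, l). if k = l then inverse (mult k) else 0)"
    using mat_inv_diagonal[of n mult] pos by (metis less_irrefl)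
  show thesis
  proof (rule that[of "\<lambda>s k. inverse (mult k)"])
    show "inverse (mult k) \<noteq> 0" if "s \<in> {1..8}" "k \<in> set (S s)" for s k
      using pos[of k] S_bound[OF that(1)] that(2) by auto
    show "(\<Sum>s\<in>{1..8}. if k \<in> set (S s) then inverse (mult k) else 0) = 1" if "k < n" for k
    proof -
      have "(\<Sum>s\<in>{1..8::nat}. if k \<in> set (S s) then inverse (mult k) else 0) = (\<Sum>s\<in>{1..8::nat}. (if k \<in> set (S s) then 1 else 0) * inverse (mult k))"
        by (intro sum.cong) auto
      also have "\<dots> = mult k * inverse (mult k)" unfolding mult_def sum_distrib_right ..
      finally show ?thesis using pos[OF that] by simp
    qed
    fix s assume s: "s \<in> {1..8::nat}"
    have "D s = R s * mat n n (\<lambda>(k, l). if k = l then inverse (mult k) else 0) * (R s)\<^sup>T"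
      using D s inv by (simp add: multiplicity_scaling_def)
    moreover have "(R s * mat n n (\<lambda>(k, l). if k = l then inverse (mult k) else 0) * (R s)\<^sup>T) $$ (i, j) =
        (if i = j then inverse (mult (S s ! i)) else 0)" if "i < length (S s)" "j < length (S s)" for i j
      using restriction_sandwich[OF _ S_bound[OF s] that] S_nth[OF s] that S_distinct[OF s]
      by (simp add: nth_eq_iff_index_eq)
    ultimately show "D s = mat (length (S s)) (length (S s)) (\<lambda>(i, j). if i = j then inverse (mult (S s ! i)) else 0)"
      by (intro eq_matI) (auto simp: restriction_matrix_def)
  qed
next
  \<comment> \<open>For the \<open>k\<close>-scaling, the weights are nonzero because a local
    diagonal entry is the positive energy of one basis function, and they sum to one because these
    entries add up to the diagonal entry of \<open>A\<close>.\<close>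
  assume D: "\<forall>s\<in>{1..8}. D s = k_scaling A (R s) (AN s)"
  have Apos: "0 < A $$ (k, k)" if k: "k < n" for k
  proof -
    obtain s where s: "s \<in> {1..8}" "k \<in> set (S s)" using dof_covered[OF k] .
    have "0 \<le> local_energy t k" if "t \<in> {1..8}" for t
      using local_energy_pos[OF that, of k] local_energy_zero[OF that k] by force
    then show ?thesis unfolding A_diag[OF k] using local_energy_pos[OF s] s(1) by (intro sum_pos2[of _ s]) auto
  qed
  show thesis
  proof (rule that[of "\<lambda>s k. local_energy s k / A $$ (k, k)"])
    show "local_energy s k / A $$ (k, k) \<noteq> 0" if "s \<in> {1..8}" "k \<in> set (S s)" for s k
      using local_energy_pos[OF that] Apos[of k] S_bound[OF that(1)] that(2) by force
    show "(\<Sum>s\<in>{1..8}. if k \<in> set (S s) then local_energy s k / A $$ (k, k) else 0) = 1" if k: "k < n" for k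
    proof -
      have "(\<Sum>s\<in>{1..8}. if k \<in> set (S s) then local_energy s k / A $$ (k, k) else 0) = (\<Sum>s\<in>{1..8}. local_energy s k / A $$ (k, k))"
        using local_energy_zero[OF _ k] by (intro sum.cong) auto
      also have "\<dots> = A $$ (k, k) / A $$ (k, k)" unfolding A_diag[OF k] sum_divide_distrib ..
      finally show ?thesis using Apos[OF k] by simp
    qed
    fix s assume s: "s \<in> {1..8::nat}"
    have "AN s $$ (i, i) = local_energy s (S s ! i)" if "i < length (S s)" for i
      using that by (simp add: neumann_matrix_def neumann_entry[OF s S_nth[OF s] S_nth[OF s]] local_energy_def)
    moreover have "(R s * A * (R s)\<^sup>T) $$ (i, i) = A $$ (S s ! i, S s ! i)" if "i < length (S s)" for i
      by (rule restriction_sandwich[OF A_carrier S_bound[OF s] that that])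
    moreover have "D s = k_scaling A (R s) (AN s)" using D s by blast
    ultimately show "D s = mat (length (S s)) (length (S s)) (\<lambda>(i, j). if i = j then local_energy s (S s ! i) / A $$ (S s ! i, S s ! i) else 0)"
      by (intro eq_matI) (auto simp: k_scaling_def restriction_matrix_def)
  qed
qed

text \<open>The inverse weights in \<open>M s\<close> cancel those in \<open>D s R s x\<close>, so
  the weighted pieces cost exactly the Neumann energy of the unweighted ones, for either scaling.
  The last claim holds because the weights of each degree of freedom sum to one.\<close>

lemma scaling:
  assumes D: "(\<forall>s\<in>{1..8}. D s = multiplicity_scaling n R s) \<or> (\<forall>s\<in>{1..8}. D s = k_scaling A (R s) (AN s))"
  shows "s \<in> {1..8} \<Longrightarrow> D s \<in> carrier_mat (length (S s)) (length (S s))"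
    and "s \<in> {1..8} \<Longrightarrow> psd_mat (length (S s)) (mat_inv (D s) * AN s * mat_inv (D s))"
    and "s \<in> {1..8} \<Longrightarrow> y \<in> carrier_vec (length (S s)) \<Longrightarrow>
      bform (mat_inv (D s) * AN s * mat_inv (D s)) (D s *\<^sub>v y) (D s *\<^sub>v y) = bform (AN s) y y"
    and "x \<in> carrier_vec n \<Longrightarrow> vsum n (\<lambda>s. (R s)\<^sup>T *\<^sub>v (D s *\<^sub>v (R s *\<^sub>v x))) {1..8} = x"
proof -
  obtain \<omega> where \<omega>0: "\<And>s k. s \<in> {1..8} \<Longrightarrow> k \<in> set (S s) \<Longrightarrow> \<omega> s k \<noteq> 0"
    and \<omega>1: "\<And>k. k < n \<Longrightarrow> (\<Sum>s\<in>{1..8}. if k \<in> set (S s) then \<omega> s k else 0) = 1"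
    and D_eq: "\<And>s. s \<in> {1..8} \<Longrightarrow> D s = mat (length (S s)) (length (S s)) (\<lambda>(i, j). if i = j then \<omega> s (S s ! i) else 0)"
    using scaling_weights[OF D] by blast
  have Dc: "D s \<in> carrier_mat (length (S s)) (length (S s))" if "s \<in> {1..8}" for s
    unfolding D_eq[OF that] by simp
  then show "s \<in> {1..8} \<Longrightarrow> D s \<in> carrier_mat (length (S s)) (length (S s))" .
  have inv: "mat_inv (D s) = mat (length (S s)) (length (S s)) (\<lambda>(i, j). if i = j then inverse (\<omega> s (S s ! i)) else 0)"
    if s: "s \<in> {1..8}" for s
    unfolding D_eq[OF s] by (rule mat_inv_diagonal) (rule \<omega>0[OF s nth_mem])
  have Ic: "mat_inv (D s) \<in> carrier_mat (length (S s)) (length (S s))" if "s \<in> {1..8}" for s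
    unfolding inv[OF that] by simp
  have It: "(mat_inv (D s))\<^sup>T = mat_inv (D s)" if "s \<in> {1..8}" for s
    unfolding inv[OF that] by (rule eq_matI) auto
  have ID: "mat_inv (D s) *\<^sub>v (D s *\<^sub>v y) = y" if s: "s \<in> {1..8}" and y: "y \<in> carrier_vec (length (S s))" for s y
  proof (rule eq_vecI)
    fix i assume "i < dim_vec y"
    then have i: "i < length (S s)" using y by simp
    have Dy: "D s *\<^sub>v y \<in> carrier_vec (length (S s))" by (rule mult_mat_vec_carrier[OF Dc[OF s] y])
    have "(mat_inv (D s) *\<^sub>v (D s *\<^sub>v y)) $ i = inverse (\<omega> s (S s ! i)) * (D s *\<^sub>v y) $ i"
      unfolding inv[OF s] by (rule diagonal_mult_vec[OF Dy i])
    also have "(D s *\<^sub>v y) $ i = \<omega> s (S s ! i) * y $ i"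
      unfolding D_eq[OF s] by (rule diagonal_mult_vec[OF y i])
    finally show "(mat_inv (D s) *\<^sub>v (D s *\<^sub>v y)) $ i = y $ i" using \<omega>0[OF s nth_mem[OF i]] by simp
  qed (use Ic[OF s] y in simp)
  show "psd_mat (length (S s)) (mat_inv (D s) * AN s * mat_inv (D s))" if s: "s \<in> {1..8}"
    using psd_mat_congruence[OF AN_psd[OF s] Ic[OF s]] by (simp only: It[OF s])
  show "bform (mat_inv (D s) * AN s * mat_inv (D s)) (D s *\<^sub>v y) (D s *\<^sub>v y) = bform (AN s) y y"
    if s: "s \<in> {1..8}" and y: "y \<in> carrier_vec (length (S s))"
  proof -
    have Dy: "D s *\<^sub>v y \<in> carrier_vec (length (S s))" by (rule mult_mat_vec_carrier[OF Dc[OF s] y])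
    show ?thesis
      using bform_congruence[OF psd_matD(2)[OF AN_psd[OF s]] Ic[OF s] Dy Dy] by (simp only: It[OF s] ID[OF s y])
  qed
  show "vsum n (\<lambda>s. (R s)\<^sup>T *\<^sub>v (D s *\<^sub>v (R s *\<^sub>v x))) {1..8} = x" if x: "x \<in> carrier_vec n"
  proof (rule eq_vecI)
    fix k assume "k < dim_vec x"
    then have k: "k < n" using x by simp
    have "((R s)\<^sup>T *\<^sub>v (D s *\<^sub>v (R s *\<^sub>v x))) $ k = (if k \<in> set (S s) then \<omega> s k else 0) * x $ k"
      if s: "s \<in> {1..8}" for s
    proof -
      have Rx: "R s *\<^sub>v x \<in> carrier_vec (length (S s))" by (rule mult_mat_vec_carrier[OF restriction_matrix_carrier x])
      have DRx: "D s *\<^sub>v (R s *\<^sub>v x) \<in> carrier_vec (length (S s))" by (rule mult_mat_vec_carrier[OF Dc[OF s] Rx])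
      have "((R s)\<^sup>T *\<^sub>v (D s *\<^sub>v (R s *\<^sub>v x))) $ k = (\<Sum>i<length (S s). if k = S s ! i then (D s *\<^sub>v (R s *\<^sub>v x)) $ i else 0)"
        by (rule transpose_restriction_matrix_mult_vec[OF DRx k])
      also have "\<dots> = (\<Sum>i<length (S s). if k = S s ! i then \<omega> s (S s ! i) * x $ (S s ! i) else 0)"
      proof (intro sum.cong refl if_cong)
        fix i assume "i \<in> {..<length (S s)}"
        then have i: "i < length (S s)" by simp
        have "(D s *\<^sub>v (R s *\<^sub>v x)) $ i = \<omega> s (S s ! i) * (R s *\<^sub>v x) $ i"
          unfolding D_eq[OF s] by (rule diagonal_mult_vec[OF Rx i])
        then show "(D s *\<^sub>v (R s *\<^sub>v x)) $ i = \<omega> s (S s ! i) * x $ (S s ! i)"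
          using restriction_matrix_mult_vec[OF x i S_bound[OF s]] by simp
      qed
      also have "\<dots> = (\<Sum>m\<in>set (S s). if k = m then \<omega> s m * x $ m else 0)"
        by (rule sum_nth_distinct[OF S_distinct[OF s], of "\<lambda>m. if k = m then \<omega> s m * x $ m else 0"])
      finally show ?thesis by simp
    qed
    then have "vsum n (\<lambda>s. (R s)\<^sup>T *\<^sub>v (D s *\<^sub>v (R s *\<^sub>v x))) {1..8} $ k =
        (\<Sum>s\<in>{1..8}. (if k \<in> set (S s) then \<omega> s k else 0) * x $ k)"
      unfolding index_vsum[OF k] by (rule sum.cong[OF refl])
    also have "\<dots> = 1 * x $ k" unfolding sum_distrib_right[symmetric] \<omega>1[OF k] ..
    finally show "vsum n (\<lambda>s. (R s)\<^sup>T *\<^sub>v (D s *\<^sub>v (R s *\<^sub>v x))) {1..8} $ k = x $ k" by simp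
  qed (use x in simp)
qed

end

lemma no_fill_incomplete_cholesky_spd:
  assumes B: "dim_row B = m" and L: "no_fill_incomplete_cholesky B L"
  shows "spd_mat m (L * L\<^sup>T)"
proof (rule spd_mat_lower_triangular)
  show "L \<in> carrier_mat m m" using B L by (simp add: no_fill_incomplete_cholesky_def)
  show "0 < L $$ (i, i)" if "i < m" for i using B L that by (simp add: no_fill_incomplete_cholesky_def)
  show "L $$ (i, j) = 0" if "i < m" "j < m" "i < j" for i j
    using B L that unfolding no_fill_incomplete_cholesky_def by (metis linorder_not_less)
qed

theorem theorem25:
  fixes asc layered :: bool
    and cells :: "nat \<Rightarrow> pt set set"
    and dofs :: "(pt \<times> pt) list"
    and \<phi> :: "nat \<Rightarrow> pt \<Rightarrow> pt"
    and S :: "nat \<Rightarrow> nat list"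
    and E :: "pt \<Rightarrow> real"
    and n Nc :: nat
    and A H R0 P0 :: "real mat"
    and R AN D M L W :: "nat \<Rightarrow> real mat"
    and \<tau> \<upsilon> C_sharp :: real
    and V0 :: "real vec set"
  assumes partition: "mesh_partition asc cells"
    and young: "E = young_modulus cells layered"
    and dofs: "dof_numbering dofs"
    and n: "n = length dofs"
    and basis: "nodal_basis asc dofs \<phi>"
    and local_dofs: "local_dof_numbering dofs cells S"
    and A: "A = stiffness_matrix E n \<phi>"
    and R: "\<forall>s\<in>{1..8}. R s = restriction_matrix n (S s)"
    and AN: "\<forall>s\<in>{1..8}. AN s = neumann_matrix E (subdomain cells s) \<phi> (S s)"
    and D: "(\<forall>s\<in>{1..8}. D s = multiplicity_scaling n R s) \<or>
            (\<forall>s\<in>{1..8}. D s = k_scaling A (R s) (AN s))"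
    and M: "\<forall>s\<in>{1..8}. M s = mat_inv (D s) * AN s * mat_inv (D s)"
    and L: "\<forall>s\<in>{1..8}. no_fill_incomplete_cholesky (R s * A * transpose_mat (R s)) (L s)"
    and H: "H = one_level_schwarz n R L"
    and Nc: "coloring_constant A R Nc"
    and \<tau>: "1 < \<tau>"
    and \<upsilon>: "0 < \<upsilon>" "\<upsilon> < real Nc"
    and V0: "V0 = coarse_space_1 n A R L M \<tau> \<upsilon> \<or>
             ((\<forall>s\<in>{1..8}. orthonormal_basis_of_range (W s) (M s)) \<and>
              V0 = coarse_space_2 n A R L M W \<tau> \<upsilon>)"
    and R0: "rows_form_basis R0 n V0"
    and P0: "P0 = coarse_projection A R0"
    and C_sharp: "0 < C_sharp"
      "\<forall>s\<in>{1..8}. \<forall>x\<in>carrier_vec (length (S s)).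
         scalar_prod x ((R s * A * transpose_mat (R s)) *\<^sub>v x)
           \<le> inverse C_sharp * scalar_prod x ((L s * transpose_mat (L s)) *\<^sub>v x)"
  shows "(\<forall>k\<in>spectrum_of (H * A * P0). k \<noteq> 0 \<longrightarrow> real_between (1 / \<tau>) k (real Nc / \<upsilon>)) \<and>
         (\<forall>k\<in>spectrum_of (hybrid_preconditioner A H R0 * A).
            real_between (1 / \<tau>) k (real Nc / \<upsilon>)) \<and>
         (\<forall>k\<in>spectrum_of (additive_preconditioner A H R0 * A).
            real_between (inverse ((1 + 2 * real Nc / \<upsilon>) * \<tau>)) k (real Nc / C_sharp + 1))"
proof -
  interpret fem: elasticity_problem asc layered cells dofs \<phi> S
    by unfold_locales (fact partition dofs basis local_dofs)+
  let ?m = "\<lambda>s. length (S s)"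
  have A_eq: "A = fem.A" and spd: "spd_mat n A" using A n young fem.A_spd by auto
  have R_eq: "R s = fem.R s" if "s \<in> {1..8}" for s using R n that by simp
  have AN_eq: "AN s = fem.AN s" if "s \<in> {1..8}" for s using AN young that by simp
  have Rc: "R s \<in> carrier_mat (?m s) n" if "s \<in> {1..8}" for s
    unfolding R_eq[OF that] n by simp
  \<comment> \<open>\<open>R\<close> and \<open>fem.R\<close> agree only on \<open>{1..8}\<close>,
    while \<open>multiplicity_scaling\<close> takes the whole family; the sum inside it looks only
    at these indices.\<close>
  have "(\<Sum>s\<in>{1..8}. ((R s)\<^sup>T * R s) $$ ij) = (\<Sum>s\<in>{1..8}. ((fem.R s)\<^sup>T * fem.R s) $$ ij)" for ij
    by (rule sum.cong[OF refl]) (simp only: R_eq)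
  then have "mat_family_sum n n (\<lambda>t. (R t)\<^sup>T * R t) {1..8} =
      mat_family_sum n n (\<lambda>t. (fem.R t)\<^sup>T * fem.R t) {1..8}"
    unfolding mat_family_sum_def by presburger
  then have "multiplicity_scaling n R s = multiplicity_scaling fem.n fem.R s" if "s \<in> {1..8}" for s
    unfolding multiplicity_scaling_def R_eq[OF that] n by simp
  then have D': "(\<forall>s\<in>{1..8}. D s = multiplicity_scaling fem.n fem.R s) \<or>
      (\<forall>s\<in>{1..8}. D s = k_scaling fem.A (fem.R s) (fem.AN s))"
    using D R_eq AN_eq unfolding A_eq by metis
  note scaling = fem.scaling[OF D', folded n]
  have M_eq: "M s = mat_inv (D s) * fem.AN s * mat_inv (D s)" if "s \<in> {1..8}" for s
    using M AN_eq that by simp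
  have R_inj: "x = 0\<^sub>v (?m s)"
    if s: "s \<in> {1..8}" and "x \<in> carrier_vec (?m s)" "(R s)\<^sup>T *\<^sub>v x = 0\<^sub>v n" for s x
    by (rule transpose_restriction_matrix_inj[OF fem.S_distinct[OF s] fem.S_bound[OF s] that(2) that(3)[unfolded R_eq[OF s] n]])
  have L_spd: "spd_mat (?m s) (L s * (L s)\<^sup>T)" if s: "s \<in> {1..8}" for s
    using no_fill_incomplete_cholesky_spd[OF _ bspec[OF L s]] carrier_matD(1)[OF Rc[OF s]] by simp
  have M_psd: "psd_mat (?m s) (M s)" if "s \<in> {1..8}" for s
    unfolding M_eq[OF that] by (rule scaling(2)[OF that])
  have partition_of_unity: "vsum n (\<lambda>s. (R s)\<^sup>T *\<^sub>v (D s *\<^sub>v (R s *\<^sub>v x))) {1..8} = x"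
    if x: "x \<in> carrier_vec n" for x
  proof -
    have "vsum n (\<lambda>s. (R s)\<^sup>T *\<^sub>v (D s *\<^sub>v (R s *\<^sub>v x))) {1..8} =
        vsum n (\<lambda>s. (fem.R s)\<^sup>T *\<^sub>v (D s *\<^sub>v (fem.R s *\<^sub>v x))) {1..8}"
      by (rule vsum_cong) (simp only: R_eq)
    then show ?thesis using scaling(4)[OF x] n by simp
  qed
  have energy: "(\<Sum>s\<in>{1..8}. bform (M s) (D s *\<^sub>v (R s *\<^sub>v x)) (D s *\<^sub>v (R s *\<^sub>v x))) \<le> bform A x x"
    if x: "x \<in> carrier_vec n" for x
  proof -
    have "bform (M s) (D s *\<^sub>v (R s *\<^sub>v x)) (D s *\<^sub>v (R s *\<^sub>v x)) = bform (fem.AN s) (fem.R s *\<^sub>v x) (fem.R s *\<^sub>v x)"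
      if s: "s \<in> {1..8}" for s
      unfolding M_eq[OF s] using scaling(3)[OF s mult_mat_vec_carrier[OF Rc[OF s] x]] by (simp only: R_eq[OF s])
    then have "(\<Sum>s\<in>{1..8}. bform (M s) (D s *\<^sub>v (R s *\<^sub>v x)) (D s *\<^sub>v (R s *\<^sub>v x))) =
        (\<Sum>s\<in>{1..8}. bform (fem.AN s) (fem.R s *\<^sub>v x) (fem.R s *\<^sub>v x))"
      by (rule sum.cong[OF refl])
    also have "\<dots> = bform A x x" using fem.neumann_splitting x n A_eq by simp
    finally show ?thesis by simp
  qed
  have C': "bform (R s * A * (R s)\<^sup>T) x x \<le> inverse C_sharp * bform (L s * (L s)\<^sup>T) x x"
    if "s \<in> {1..8}" "x \<in> carrier_vec (?m s)" for s x
    using C_sharp(2) that by (simp add: bform_def)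
  note bounds = geneo_bounds[where m = ?m, OF spd Rc R_inj L_spd M_psd scaling(1) partition_of_unity energy
      Nc \<tau> \<upsilon> V0 R0 C_sharp(1) C', folded H]
  show ?thesis
    unfolding P0 using bounds by blast
qed

end
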